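(* Let $E$ be a locally finite directed graph with no sources and $\tau$ a faithful, semifinite, lower semicontinuous, gauge invariant trace on $C^*(E)$. Let $\mathcal{N}$ and $\tilde\tau:\mathcal{N}_+\to[0,\infty]$ be the von Neumann algebra and function defined in the context. Then $\tilde\tau$ defines a faithful normal semifinite trace on $\mathcal{N}$. Moreover $$End_F^{00}(X_c)\subset\mathcal{N}_{\tilde\tau}:=\mathrm{span}\{T\in\mathcal{N}_+:\tilde\tau(T)<\infty\},$$ the domain of definition of $\tilde\tau$, and $$\tilde\tau(\Theta^R_{x,y})=\langle y,x\rangle=\tau(y^*x),\qquad x,y\in X_c.$$
   Context: A directed graph $E=(E^0,E^1,r,s)$ has countable sets $E^0$ (vertices), $E^1$ (edges) and range and source maps $r,s:E^1\to E^0$. It is locally finite if each vertex emits and receives finitely many edges; it has no sources if each vertex receives at least one edge. A path of length $|\mu|=n\ge1$ is $\mu=\mu_1\cdots\mu_n$ with $r(\mu_i)=s(\mu_{i+1})$; vertices are paths of length $0$; $E^*$ is the set of all finite paths and $r,s$ extend to $E^*$. $C^*(E)$ is the universal $C^*$-algebra generated by mutually orthogonal projections $p_v$ and partial isometries $S_e$ with $S_e^*S_e=p_{r(e)}$ and $p_v=\sum_{s(e)=v}S_eS_e^*$ whenever $v$ emits at least one edge. $S_\mu=S_{\mu_1}\cdots S_{\mu_n}$, $S_v=p_v$. Write $A=C^*(E)$, $A_c=\mathrm{span}\{S_\mu S_\nu^*:r(\mu)=r(\nu)\}$. The gauge action of $S^1$ is $\gamma_z(S_e)=zS_e$, $\gamma_z(p_v)=p_v$;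 $F=A^\gamma$, and $\Phi(a)=\frac1{2\pi}\int_{S^1}\gamma_z(a)\,d\theta$ ($z=e^{i\theta}$) is the expectation $A\to F$. A trace on $A$ is a map $\tau:A^+\to[0,\infty]$, additive, positively homogeneous, with $\tau(a^*a)=\tau(aa^* )$; faithful if $\tau(a^*a)=0\Rightarrow a=0$; semifinite if finite on a norm dense subset of $A^+$; lower semicontinuous if $a_n\to a$ in norm in $A^+$ implies $\tau(a)\le\liminf\tau(a_n)$; gauge invariant if $\tau\circ\gamma_z=\tau$ for all $z$. A semifinite trace is finite on $A_c$ and is extended linearly. $X$ is the right $C^*$-$F$-module completion of $A$ for $(x|y)_R=\Phi(x^*y)$; $X_c$ is $A_c$ viewed in $X$. $\mathcal{H}$ is the Hilbert space completion of $X_c$ for $\langle x,y\rangle=\tau((x|y)_R)=\tau(x^*y)$. For $x,y\in X_c$, $\Theta^R_{x,y}z=x(y|z)_R$. $End_F^{00}(X_c)=\mathrm{span}\{\Theta^R_{x,y}:x,y\in X_c\}$, the finite rank operators on $X_c$, acting on $\mathcal{H}$, and $\mathcal{N}=(End_F^{00}(X_c))''$ with positive cone $\mathcal{N}_+$. For $v\in E^0$, $|v|_k$ is the number of paths of length $k$ with range $v$. For $T\in\mathcal{N}$ and $\mu\in E^*$ with $|\mu|\neq0$, $$\omega_\mu(T)=\langle S_\mu,TS_\mu\rangle+\frac{1}{|r(\mu)|_{|\mu|}}\langle S_\mu^*,TS_\mu^*\rangle,$$ and for $|\mu|=0$, $S_\mu=p_v$ and $\omega_\mu(T)=\langle S_\mu,TS_\mu\rangle$.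 Define $\tilde\tau(T)=\lim_{L\uparrow}\sum_{\mu\in L}\omega_\mu(T)$ for $T\in\mathcal{N}_+$, the limit being over the net of finite subsets $L\subset E^*$. *)

theory Defs
  imports "HOL-Analysis.Analysis" "Graph_Theory.Digraph" "Graph_Theory.Arc_Walk"
begin

section \<open>Complex normed spaces, Hilbert spaces and C*-algebras as type classes\<close>

class complex_vector = real_vector +
  fixes scaleC :: "complex \<Rightarrow> 'a \<Rightarrow> 'a"  (infixr \<open>*\<^sub>C\<close> 75)
  assumes scaleC_add_right: "c *\<^sub>C (x + y) = c *\<^sub>C x + c *\<^sub>C y"
    and scaleC_add_left: "(c + d) *\<^sub>C x = c *\<^sub>C x + d *\<^sub>C x"
    and scaleC_scaleC: "c *\<^sub>C (d *\<^sub>C x) = (c * d) *\<^sub>C x"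
    and scaleC_one: "1 *\<^sub>C x = x"
    and scaleR_scaleC: "r *\<^sub>R x = complex_of_real r *\<^sub>C x"

global_interpretation complex_vector: vector_space "scaleC :: complex \<Rightarrow> 'a \<Rightarrow> 'a::complex_vector"
  by unfold_locales (simp_all add: scaleC_add_right scaleC_add_left scaleC_scaleC scaleC_one)

abbreviation cspan :: "'a::complex_vector set \<Rightarrow> 'a set" where
  "cspan \<equiv> module.span scaleC"

class complex_normed_vector = complex_vector + real_normed_vector +
  assumes norm_scaleC: "norm (c *\<^sub>C x) = cmod c * norm x"

text \<open>Inner products are linear in the second variable.\<close>

class chilbert_space = complex_normed_vector + banach +
  fixes cinner :: "'a \<Rightarrow> 'a \<Rightarrow> complex"
  assumes cinner_add_right: "cinner x (y + z) = cinner x y + cinner x z"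
    and cinner_scaleC_right: "cinner x (c *\<^sub>C y) = c * cinner x y"
    and cinner_commute: "cinner x y = cnj (cinner y x)"
    and cinner_self: "cinner x x = complex_of_real ((norm x)\<^sup>2)"

class cstar_algebra = complex_normed_vector + real_normed_algebra + banach +
  fixes star :: "'a \<Rightarrow> 'a"
  assumes mult_scaleC_left: "(c *\<^sub>C x) * y = c *\<^sub>C (x * y)"
    and mult_scaleC_right: "x * (c *\<^sub>C y) = c *\<^sub>C (x * y)"
    and star_star: "star (star x) = x"
    and star_add: "star (x + y) = star x + star y"
    and star_scaleC: "star (c *\<^sub>C x) = cnj c *\<^sub>C star x"
    and star_mult: "star (x * y) = star y * star x"
    and cstar_identity: "norm (star x * x) = (norm x)\<^sup>2"

text \<open>
  The linear extension of a \<open>[0, \<infinity>]\<close>-valued function on a cone \<open>P\<close> to the linear span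
  of the elements of \<open>P\<close> on which it is finite.
\<close>

definition lin_ext :: "'a::complex_vector set \<Rightarrow> ('a \<Rightarrow> ennreal) \<Rightarrow> 'a \<Rightarrow> complex" where
  "lin_ext P \<phi> a = (THE c. \<exists>F k. finite F \<and> F \<subseteq> {q \<in> P. \<phi> q < \<infinity>}
      \<and> a = (\<Sum>q\<in>F. k q *\<^sub>C q) \<and> c = (\<Sum>q\<in>F. k q * complex_of_real (enn2real (\<phi> q))))"


section \<open>C*-algebras with explicit carrier\<close>

text \<open>
  The universal property of \<open>C\<^sup>*(E)\<close> quantifies over C*-algebras, hence over structures
  inside a formula, for which the type class cannot be used.
\<close>

record 'b cstar_record =
  cs_carrier :: "'b set"
  cs_zero :: 'b
  cs_add :: "'b \<Rightarrow> 'b \<Rightarrow> 'b"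
  cs_mult :: "'b \<Rightarrow> 'b \<Rightarrow> 'b"
  cs_scale :: "complex \<Rightarrow> 'b \<Rightarrow> 'b"
  cs_star :: "'b \<Rightarrow> 'b"
  cs_norm :: "'b \<Rightarrow> real"

locale cstar_structure =
  fixes B :: "'b cstar_record"
  assumes zero_closed: "cs_zero B \<in> cs_carrier B"
    and add_closed: "\<lbrakk>x \<in> cs_carrier B; y \<in> cs_carrier B\<rbrakk> \<Longrightarrow> cs_add B x y \<in> cs_carrier B"
    and mult_closed: "\<lbrakk>x \<in> cs_carrier B; y \<in> cs_carrier B\<rbrakk> \<Longrightarrow> cs_mult B x y \<in> cs_carrier B"
    and scale_closed: "x \<in> cs_carrier B \<Longrightarrow> cs_scale B c x \<in> cs_carrier B"
    and star_closed: "x \<in> cs_carrier B \<Longrightarrow> cs_star B x \<in> cs_carrier B"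
    and add_assoc: "\<lbrakk>x \<in> cs_carrier B; y \<in> cs_carrier B; z \<in> cs_carrier B\<rbrakk>
        \<Longrightarrow> cs_add B (cs_add B x y) z = cs_add B x (cs_add B y z)"
    and add_commute: "\<lbrakk>x \<in> cs_carrier B; y \<in> cs_carrier B\<rbrakk> \<Longrightarrow> cs_add B x y = cs_add B y x"
    and add_zero: "x \<in> cs_carrier B \<Longrightarrow> cs_add B (cs_zero B) x = x"
    and add_inverse: "x \<in> cs_carrier B \<Longrightarrow> cs_add B x (cs_scale B (-1) x) = cs_zero B"
    and scale_add_right: "\<lbrakk>x \<in> cs_carrier B; y \<in> cs_carrier B\<rbrakk>
        \<Longrightarrow> cs_scale B c (cs_add B x y) = cs_add B (cs_scale B c x) (cs_scale B c y)"
    and scale_add_left: "x \<in> cs_carrier B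
        \<Longrightarrow> cs_scale B (c + d) x = cs_add B (cs_scale B c x) (cs_scale B d x)"
    and scale_scale: "x \<in> cs_carrier B \<Longrightarrow> cs_scale B c (cs_scale B d x) = cs_scale B (c * d) x"
    and scale_one: "x \<in> cs_carrier B \<Longrightarrow> cs_scale B 1 x = x"
    and mult_assoc: "\<lbrakk>x \<in> cs_carrier B; y \<in> cs_carrier B; z \<in> cs_carrier B\<rbrakk>
        \<Longrightarrow> cs_mult B (cs_mult B x y) z = cs_mult B x (cs_mult B y z)"
    and mult_add_right: "\<lbrakk>x \<in> cs_carrier B; y \<in> cs_carrier B; z \<in> cs_carrier B\<rbrakk>
        \<Longrightarrow> cs_mult B x (cs_add B y z) = cs_add B (cs_mult B x y) (cs_mult B x z)"
    and mult_add_left: "\<lbrakk>x \<in> cs_carrier B; y \<in> cs_carrier B; z \<in> cs_carrier B\<rbrakk>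
        \<Longrightarrow> cs_mult B (cs_add B x y) z = cs_add B (cs_mult B x z) (cs_mult B y z)"
    and mult_scale_right: "\<lbrakk>x \<in> cs_carrier B; y \<in> cs_carrier B\<rbrakk>
        \<Longrightarrow> cs_mult B x (cs_scale B c y) = cs_scale B c (cs_mult B x y)"
    and mult_scale_left: "\<lbrakk>x \<in> cs_carrier B; y \<in> cs_carrier B\<rbrakk>
        \<Longrightarrow> cs_mult B (cs_scale B c x) y = cs_scale B c (cs_mult B x y)"
    and star_star: "x \<in> cs_carrier B \<Longrightarrow> cs_star B (cs_star B x) = x"
    and star_add: "\<lbrakk>x \<in> cs_carrier B; y \<in> cs_carrier B\<rbrakk>
        \<Longrightarrow> cs_star B (cs_add B x y) = cs_add B (cs_star B x) (cs_star B y)"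
    and star_scale: "x \<in> cs_carrier B
        \<Longrightarrow> cs_star B (cs_scale B c x) = cs_scale B (cnj c) (cs_star B x)"
    and star_mult: "\<lbrakk>x \<in> cs_carrier B; y \<in> cs_carrier B\<rbrakk>
        \<Longrightarrow> cs_star B (cs_mult B x y) = cs_mult B (cs_star B y) (cs_star B x)"
    and norm_nonneg: "x \<in> cs_carrier B \<Longrightarrow> 0 \<le> cs_norm B x"
    and norm_eq_zero: "x \<in> cs_carrier B \<Longrightarrow> cs_norm B x = 0 \<longleftrightarrow> x = cs_zero B"
    and norm_triangle: "\<lbrakk>x \<in> cs_carrier B; y \<in> cs_carrier B\<rbrakk>
        \<Longrightarrow> cs_norm B (cs_add B x y) \<le> cs_norm B x + cs_norm B y"
    and norm_scale: "x \<in> cs_carrier B \<Longrightarrow> cs_norm B (cs_scale B c x) = cmod c * cs_norm B x"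
    and norm_mult: "\<lbrakk>x \<in> cs_carrier B; y \<in> cs_carrier B\<rbrakk>
        \<Longrightarrow> cs_norm B (cs_mult B x y) \<le> cs_norm B x * cs_norm B y"
    and cstar_identity: "x \<in> cs_carrier B \<Longrightarrow> cs_norm B (cs_mult B (cs_star B x) x) = (cs_norm B x)\<^sup>2"
    and complete: "\<lbrakk>\<And>n. \<sigma> n \<in> cs_carrier B;
        \<And>\<epsilon>. 0 < \<epsilon> \<Longrightarrow> \<exists>N. \<forall>m\<ge>N. \<forall>n\<ge>N.
           cs_norm B (cs_add B (\<sigma> m) (cs_scale B (-1) (\<sigma> n))) < \<epsilon>\<rbrakk>
        \<Longrightarrow> \<exists>l\<in>cs_carrier B. (\<lambda>n. cs_norm B (cs_add B (\<sigma> n) (cs_scale B (-1) l))) \<longlonglongrightarrow> 0"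

definition of_class :: "'a::cstar_algebra cstar_record" where
  "of_class = \<lparr>cs_carrier = UNIV, cs_zero = 0, cs_add = (+), cs_mult = (*),
     cs_scale = scaleC, cs_star = star, cs_norm = norm\<rparr>"

lemma cstar_structure_of_class: "cstar_structure (of_class :: 'a::cstar_algebra cstar_record)"
proof -
  have minus: "(- 1) *\<^sub>C x = - x" for x :: 'a
    using scaleR_scaleC[of "-1" x] by simp
  have compl: "\<exists>l. (\<lambda>n. norm (\<sigma> n - l)) \<longlonglongrightarrow> 0"
    if "\<And>\<epsilon>. 0 < \<epsilon> \<Longrightarrow> \<exists>N. \<forall>m\<ge>N. \<forall>n\<ge>N. norm (\<sigma> m - \<sigma> n) < \<epsilon>" for \<sigma> :: "nat \<Rightarrow> 'a"
  proof -
    have "Cauchy \<sigma>" using that by (auto simp: Cauchy_def dist_norm)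
    then obtain l where "\<sigma> \<longlonglongrightarrow> l" by (auto simp: Cauchy_convergent_iff convergent_def)
    then show ?thesis using LIM_zero tendsto_norm_zero by blast
  qed
  show ?thesis
    by unfold_locales
      (use compl in \<open>auto simp: of_class_def minus algebra_simps scaleC_add_right scaleC_add_left
        scaleC_scaleC scaleC_one mult_scaleC_left mult_scaleC_right star_star star_add star_scaleC
        star_mult norm_scaleC norm_triangle_ineq norm_mult_ineq cstar_identity\<close>)
qed

definition star_hom :: "'a cstar_record \<Rightarrow> 'b cstar_record \<Rightarrow> ('a \<Rightarrow> 'b) \<Rightarrow> bool" where
  "star_hom A B \<pi> \<longleftrightarrow> \<pi> \<in> cs_carrier A \<rightarrow> cs_carrier B
    \<and> (\<forall>x\<in>cs_carrier A. \<forall>y\<in>cs_carrier A. \<pi> (cs_add A x y) = cs_add B (\<pi> x) (\<pi> y))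
    \<and> (\<forall>x\<in>cs_carrier A. \<forall>y\<in>cs_carrier A. \<pi> (cs_mult A x y) = cs_mult B (\<pi> x) (\<pi> y))
    \<and> (\<forall>c. \<forall>x\<in>cs_carrier A. \<pi> (cs_scale A c x) = cs_scale B c (\<pi> x))
    \<and> (\<forall>x\<in>cs_carrier A. \<pi> (cs_star A x) = cs_star B (\<pi> x))"


section \<open>Directed graphs\<close>

text \<open>The source and range maps are \<open>tail\<close> and \<open>head\<close>.\<close>

definition directed_graph :: "('v, 'e) pre_digraph \<Rightarrow> bool" where
  "directed_graph E \<longleftrightarrow> wf_digraph E \<and> countable (verts E) \<and> countable (arcs E)"

definition locally_finite_graph :: "('v, 'e) pre_digraph \<Rightarrow> bool" where
  "locally_finite_graph E \<longleftrightarrow> (\<forall>v\<in>verts E. finite (out_arcs E v) \<and> finite (in_arcs E v))"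

definition no_sources :: "('v, 'e) pre_digraph \<Rightarrow> bool" where
  "no_sources E \<longleftrightarrow> (\<forall>v\<in>verts E. in_arcs E v \<noteq> {})"

text \<open>A path is a pair of its initial vertex and its list of edges, so \<open>(v, [])\<close> is the vertex \<open>v\<close>.\<close>

definition paths :: "('v, 'e) pre_digraph \<Rightarrow> ('v \<times> 'e list) set" where
  "paths E = {(v, es). \<exists>w. pre_digraph.awalk E v es w}"

definition path_length :: "'v \<times> 'e list \<Rightarrow> nat" where
  "path_length \<mu> = length (snd \<mu>)"

definition path_range :: "('v, 'e) pre_digraph \<Rightarrow> 'v \<times> 'e list \<Rightarrow> 'v" where
  "path_range E \<mu> = last (pre_digraph.awalk_verts E (fst \<mu>) (snd \<mu>))"

definition num_paths_into :: "('v, 'e) pre_digraph \<Rightarrow> 'v \<Rightarrow> nat \<Rightarrow> nat" where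
  "num_paths_into E v k = card {\<mu> \<in> paths E. path_length \<mu> = k \<and> path_range E \<mu> = v}"


section \<open>The graph C*-algebra\<close>

definition cuntz_krieger_family ::
    "('v, 'e) pre_digraph \<Rightarrow> 'b cstar_record \<Rightarrow> ('v \<Rightarrow> 'b) \<Rightarrow> ('e \<Rightarrow> 'b) \<Rightarrow> bool" where
  "cuntz_krieger_family E B p S \<longleftrightarrow>
     (\<forall>v\<in>verts E. p v \<in> cs_carrier B \<and> cs_star B (p v) = p v \<and> cs_mult B (p v) (p v) = p v)
   \<and> (\<forall>v\<in>verts E. \<forall>w\<in>verts E. v \<noteq> w \<longrightarrow> cs_mult B (p v) (p w) = cs_zero B)
   \<and> (\<forall>e\<in>arcs E. S e \<in> cs_carrier B \<and> cs_mult B (cs_mult B (S e) (cs_star B (S e))) (S e) = S e)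
   \<and> (\<forall>e\<in>arcs E. cs_mult B (cs_star B (S e)) (S e) = p (head E e))
   \<and> (\<forall>v\<in>verts E. out_arcs E v \<noteq> {} \<longrightarrow>
        p v = Finite_Set.fold (\<lambda>e. cs_add B (cs_mult B (S e) (cs_star B (S e)))) (cs_zero B) (out_arcs E v))"

text \<open>
  The type \<open>'a\<close>, with \<open>p\<close> and \<open>S\<close>, is \<open>C\<^sup>*(E)\<close> for a row-finite \<open>E\<close>. The algebras \<open>B\<close> in
  the universal property have carriers inside the type \<open>'a \<times> real\<close>. This is no restriction on \<open>B\<close>:
  \<open>E\<close> is countable, so the C*-subalgebra generated by a Cuntz-Krieger family is separable,
  has at most continuum many elements, and is therefore isomorphic to one carried by a subset
  of this type. Uniqueness of \<open>\<pi>\<close> follows from the generation clause.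
\<close>

definition is_graph_cstar_algebra ::
    "('v, 'e) pre_digraph \<Rightarrow> ('v \<Rightarrow> 'a::cstar_algebra) \<Rightarrow> ('e \<Rightarrow> 'a) \<Rightarrow> bool" where
  "is_graph_cstar_algebra E p S \<longleftrightarrow>
     cuntz_krieger_family E of_class p S
   \<and> (\<lambda>M. closed M \<and> 0 \<in> M \<and> (\<forall>x\<in>M. \<forall>y\<in>M. x + y \<in> M \<and> x * y \<in> M)
         \<and> (\<forall>c. \<forall>x\<in>M. c *\<^sub>C x \<in> M) \<and> (\<forall>x\<in>M. star x \<in> M)) hull (p ` verts E \<union> S ` arcs E) = UNIV
   \<and> (\<forall>(B :: ('a \<times> real) cstar_record) q T.
         cstar_structure B \<and> cuntz_krieger_family E B q T \<longrightarrow>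
         (\<exists>\<pi>. star_hom of_class B \<pi> \<and> (\<forall>v\<in>verts E. \<pi> (p v) = q v) \<and> (\<forall>e\<in>arcs E. \<pi> (S e) = T e)))"

fun edge_prod :: "('e \<Rightarrow> 'a::cstar_algebra) \<Rightarrow> 'e list \<Rightarrow> 'a" where
  "edge_prod S [] = undefined"
| "edge_prod S [e] = S e"
| "edge_prod S (e # f # es) = S e * edge_prod S (f # es)"

definition path_elem :: "('v \<Rightarrow> 'a::cstar_algebra) \<Rightarrow> ('e \<Rightarrow> 'a) \<Rightarrow> 'v \<times> 'e list \<Rightarrow> 'a" where
  "path_elem p S \<mu> = (if snd \<mu> = [] then p (fst \<mu>) else edge_prod S (snd \<mu>))"

definition A_c :: "('v, 'e) pre_digraph \<Rightarrow> ('v \<Rightarrow> 'a::cstar_algebra) \<Rightarrow> ('e \<Rightarrow> 'a) \<Rightarrow> 'a set" where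
  "A_c E p S = cspan {path_elem p S \<mu> * star (path_elem p S \<nu>) |\<mu> \<nu>.
     \<mu> \<in> paths E \<and> \<nu> \<in> paths E \<and> path_range E \<mu> = path_range E \<nu>}"

definition gauge_action ::
    "('v, 'e) pre_digraph \<Rightarrow> ('v \<Rightarrow> 'a::cstar_algebra) \<Rightarrow> ('e \<Rightarrow> 'a) \<Rightarrow> complex \<Rightarrow> 'a \<Rightarrow> 'a" where
  "gauge_action E p S z = (THE \<gamma>. star_hom of_class of_class \<gamma>
     \<and> (\<forall>v\<in>verts E. \<gamma> (p v) = p v) \<and> (\<forall>e\<in>arcs E. \<gamma> (S e) = z *\<^sub>C S e))"

definition cond_exp ::
    "('v, 'e) pre_digraph \<Rightarrow> ('v \<Rightarrow> 'a::cstar_algebra) \<Rightarrow> ('e \<Rightarrow> 'a) \<Rightarrow> 'a \<Rightarrow> 'a" where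
  "cond_exp E p S a = (1 / (2 * pi)) *\<^sub>R integral {0..2 * pi} (\<lambda>\<theta>. gauge_action E p S (cis \<theta>) a)"


section \<open>Traces on a C*-algebra\<close>

definition pos_cone :: "'a::cstar_algebra set" where
  "pos_cone = range (\<lambda>a. star a * a)"

definition is_trace :: "('a::cstar_algebra \<Rightarrow> ennreal) \<Rightarrow> bool" where
  "is_trace \<tau> \<longleftrightarrow> (\<forall>a\<in>pos_cone. \<forall>b\<in>pos_cone. \<tau> (a + b) = \<tau> a + \<tau> b)
     \<and> (\<forall>r\<ge>0. \<forall>a\<in>pos_cone. \<tau> (r *\<^sub>R a) = ennreal r * \<tau> a)
     \<and> (\<forall>a. \<tau> (star a * a) = \<tau> (a * star a))"

definition faithful_trace :: "('a::cstar_algebra \<Rightarrow> ennreal) \<Rightarrow> bool" where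
  "faithful_trace \<tau> \<longleftrightarrow> (\<forall>a. \<tau> (star a * a) = 0 \<longrightarrow> a = 0)"

definition semifinite_trace :: "('a::cstar_algebra \<Rightarrow> ennreal) \<Rightarrow> bool" where
  "semifinite_trace \<tau> \<longleftrightarrow> pos_cone \<subseteq> closure {a \<in> pos_cone. \<tau> a < \<infinity>}"

definition lsc_trace :: "('a::cstar_algebra \<Rightarrow> ennreal) \<Rightarrow> bool" where
  "lsc_trace \<tau> \<longleftrightarrow> (\<forall>a l. range a \<subseteq> pos_cone \<and> l \<in> pos_cone \<and> a \<longlonglongrightarrow> l
     \<longrightarrow> \<tau> l \<le> liminf (\<lambda>n. \<tau> (a n)))"

definition gauge_invariant_trace ::
    "('v, 'e) pre_digraph \<Rightarrow> ('v \<Rightarrow> 'a::cstar_algebra) \<Rightarrow> ('e \<Rightarrow> 'a) \<Rightarrow> ('a \<Rightarrow> ennreal) \<Rightarrow> bool" where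
  "gauge_invariant_trace E p S \<tau> \<longleftrightarrow>
     (\<forall>z. cmod z = 1 \<longrightarrow> (\<forall>a\<in>pos_cone. \<tau> (gauge_action E p S z a) = \<tau> a))"

definition trace_ext :: "('a::cstar_algebra \<Rightarrow> ennreal) \<Rightarrow> 'a \<Rightarrow> complex" where
  "trace_ext \<tau> = lin_ext pos_cone \<tau>"


section \<open>The module inner product and the Hilbert space\<close>

definition module_inner ::
    "('v, 'e) pre_digraph \<Rightarrow> ('v \<Rightarrow> 'a::cstar_algebra) \<Rightarrow> ('e \<Rightarrow> 'a) \<Rightarrow> 'a \<Rightarrow> 'a \<Rightarrow> 'a" where
  "module_inner E p S x y = cond_exp E p S (star x * y)"

text \<open>
  The expectation is faithful, so \<open>A\<close> embeds in its module completion \<open>X\<close> and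
  \<open>X\<^sub>c\<close> is \<open>A_c\<close> as a vector space. The Hilbert space is only determined up to unitary
  equivalence: it is any complete space \<open>'h\<close> with a linear map \<open>\<iota>\<close> from \<open>X\<^sub>c\<close> onto a
  dense subspace that carries the given inner product to that of \<open>'h\<close>. The values of
  \<open>\<iota>\<close> outside \<open>A_c\<close> are irrelevant.
\<close>

definition hilbert_completion ::
    "('v, 'e) pre_digraph \<Rightarrow> ('v \<Rightarrow> 'a::cstar_algebra) \<Rightarrow> ('e \<Rightarrow> 'a) \<Rightarrow> ('a \<Rightarrow> ennreal)
      \<Rightarrow> ('a \<Rightarrow> 'h::chilbert_space) \<Rightarrow> bool" where
  "hilbert_completion E p S \<tau> \<iota> \<longleftrightarrow>
     (\<forall>x\<in>A_c E p S. \<forall>y\<in>A_c E p S. \<iota> (x + y) = \<iota> x + \<iota> y)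
   \<and> (\<forall>c. \<forall>x\<in>A_c E p S. \<iota> (c *\<^sub>C x) = c *\<^sub>C \<iota> x)
   \<and> (\<forall>x\<in>A_c E p S. \<forall>y\<in>A_c E p S. cinner (\<iota> x) (\<iota> y) = trace_ext \<tau> (module_inner E p S x y))
   \<and> closure (\<iota> ` A_c E p S) = UNIV"


section \<open>Operators and von Neumann algebras\<close>

instantiation blinfun :: (real_normed_vector, complex_normed_vector) complex_vector
begin

lift_definition scaleC_blinfun :: "complex \<Rightarrow> 'a \<Rightarrow>\<^sub>L 'b \<Rightarrow> 'a \<Rightarrow>\<^sub>L 'b" is "\<lambda>c f x. c *\<^sub>C f x"
proof -
  fix c and f :: "'a \<Rightarrow> 'b"
  assume f: "bounded_linear f"
  have "bounded_linear (\<lambda>y::'b. c *\<^sub>C y)"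
    by (rule bounded_linear_intro[where K = "cmod c"])
      (simp_all add: scaleC_add_right scaleR_scaleC scaleC_scaleC norm_scaleC mult.commute)
  from bounded_linear_compose[OF this f] show "bounded_linear (\<lambda>x. c *\<^sub>C f x)" .
qed

instance
  by standard
    (transfer, simp add: scaleC_add_right scaleC_add_left scaleC_scaleC scaleC_one scaleR_scaleC)+

end

text \<open>
  \<open>'h \<Rightarrow>\<^sub>L 'h\<close> consists of the bounded real linear operators; \<open>B(H)\<close> is its complex linear part.
\<close>

definition cbounded_ops :: "('h::chilbert_space \<Rightarrow>\<^sub>L 'h) set" where
  "cbounded_ops = {T. \<forall>c \<xi>. blinfun_apply T (c *\<^sub>C \<xi>) = c *\<^sub>C blinfun_apply T \<xi>}"

definition op_adj :: "('h::chilbert_space \<Rightarrow>\<^sub>L 'h) \<Rightarrow> 'h \<Rightarrow>\<^sub>L 'h" where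
  "op_adj T = (THE R. \<forall>\<xi> \<eta>. cinner (blinfun_apply R \<xi>) \<eta> = cinner \<xi> (blinfun_apply T \<eta>))"

definition op_pos :: "('h::chilbert_space \<Rightarrow>\<^sub>L 'h) \<Rightarrow> bool" where
  "op_pos T \<longleftrightarrow> T \<in> cbounded_ops \<and> (\<forall>\<xi>. cinner \<xi> (blinfun_apply T \<xi>) \<in> \<real>\<^sub>\<ge>\<^sub>0)"

definition op_le :: "('h::chilbert_space \<Rightarrow>\<^sub>L 'h) \<Rightarrow> ('h \<Rightarrow>\<^sub>L 'h) \<Rightarrow> bool" where
  "op_le T R \<longleftrightarrow> op_pos (R - T)"

definition commutant :: "('h::chilbert_space \<Rightarrow>\<^sub>L 'h) set \<Rightarrow> ('h \<Rightarrow>\<^sub>L 'h) set" where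
  "commutant M = {T \<in> cbounded_ops. \<forall>R\<in>M. T o\<^sub>L R = R o\<^sub>L T}"

definition vn_pos :: "('h::chilbert_space \<Rightarrow>\<^sub>L 'h) set \<Rightarrow> ('h \<Rightarrow>\<^sub>L 'h) set" where
  "vn_pos N = {T \<in> N. op_pos T}"

definition vn_trace :: "('h::chilbert_space \<Rightarrow>\<^sub>L 'h) set \<Rightarrow> (('h \<Rightarrow>\<^sub>L 'h) \<Rightarrow> ennreal) \<Rightarrow> bool" where
  "vn_trace N \<phi> \<longleftrightarrow> (\<forall>T\<in>vn_pos N. \<forall>R\<in>vn_pos N. \<phi> (T + R) = \<phi> T + \<phi> R)
     \<and> (\<forall>r\<ge>0. \<forall>T\<in>vn_pos N. \<phi> (r *\<^sub>R T) = ennreal r * \<phi> T)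
     \<and> (\<forall>T\<in>N. \<phi> (op_adj T o\<^sub>L T) = \<phi> (T o\<^sub>L op_adj T))"

definition vn_faithful :: "('h::chilbert_space \<Rightarrow>\<^sub>L 'h) set \<Rightarrow> (('h \<Rightarrow>\<^sub>L 'h) \<Rightarrow> ennreal) \<Rightarrow> bool" where
  "vn_faithful N \<phi> \<longleftrightarrow> (\<forall>T\<in>N. \<phi> (op_adj T o\<^sub>L T) = 0 \<longrightarrow> T = 0)"

text \<open>Normality: suprema of bounded increasing nets, here upward directed sets \<open>D\<close>, are preserved.\<close>

definition vn_normal :: "('h::chilbert_space \<Rightarrow>\<^sub>L 'h) set \<Rightarrow> (('h \<Rightarrow>\<^sub>L 'h) \<Rightarrow> ennreal) \<Rightarrow> bool" where
  "vn_normal N \<phi> \<longleftrightarrow> (\<forall>D T. D \<noteq> {} \<and> D \<subseteq> vn_pos N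
       \<and> (\<forall>R\<in>D. \<forall>R'\<in>D. \<exists>R''\<in>D. op_le R R'' \<and> op_le R' R'')
       \<and> T \<in> vn_pos N \<and> (\<forall>R\<in>D. op_le R T)
       \<and> (\<forall>U\<in>vn_pos N. (\<forall>R\<in>D. op_le R U) \<longrightarrow> op_le T U)
     \<longrightarrow> \<phi> T = (SUP R\<in>D. \<phi> R))"

definition vn_semifinite :: "('h::chilbert_space \<Rightarrow>\<^sub>L 'h) set \<Rightarrow> (('h \<Rightarrow>\<^sub>L 'h) \<Rightarrow> ennreal) \<Rightarrow> bool" where
  "vn_semifinite N \<phi> \<longleftrightarrow> (\<forall>T\<in>vn_pos N. T \<noteq> 0 \<longrightarrow>
     (\<exists>R\<in>vn_pos N. R \<noteq> 0 \<and> op_le R T \<and> \<phi> R < \<infinity>))"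


section \<open>The algebra of finite rank operators and the induced trace\<close>

text \<open>\<open>Theta E p S \<iota> x y\<close> is the bounded extension to \<open>H\<close> of \<open>z \<mapsto> x (y|z)\<^sub>R\<close> on \<open>X\<^sub>c\<close>.\<close>

definition Theta ::
    "('v, 'e) pre_digraph \<Rightarrow> ('v \<Rightarrow> 'a::cstar_algebra) \<Rightarrow> ('e \<Rightarrow> 'a)
      \<Rightarrow> ('a \<Rightarrow> 'h::chilbert_space) \<Rightarrow> 'a \<Rightarrow> 'a \<Rightarrow> 'h \<Rightarrow>\<^sub>L 'h" where
  "Theta E p S \<iota> x y = (THE T. T \<in> cbounded_ops
     \<and> (\<forall>z\<in>A_c E p S. blinfun_apply T (\<iota> z) = \<iota> (x * module_inner E p S y z)))"

definition End00 ::
    "('v, 'e) pre_digraph \<Rightarrow> ('v \<Rightarrow> 'a::cstar_algebra) \<Rightarrow> ('e \<Rightarrow> 'a)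
      \<Rightarrow> ('a \<Rightarrow> 'h::chilbert_space) \<Rightarrow> ('h \<Rightarrow>\<^sub>L 'h) set" where
  "End00 E p S \<iota> = cspan {Theta E p S \<iota> x y |x y. x \<in> A_c E p S \<and> y \<in> A_c E p S}"

definition vN_alg ::
    "('v, 'e) pre_digraph \<Rightarrow> ('v \<Rightarrow> 'a::cstar_algebra) \<Rightarrow> ('e \<Rightarrow> 'a)
      \<Rightarrow> ('a \<Rightarrow> 'h::chilbert_space) \<Rightarrow> ('h \<Rightarrow>\<^sub>L 'h) set" where
  "vN_alg E p S \<iota> = commutant (commutant (End00 E p S \<iota>))"

definition omega ::
    "('v, 'e) pre_digraph \<Rightarrow> ('v \<Rightarrow> 'a::cstar_algebra) \<Rightarrow> ('e \<Rightarrow> 'a)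
      \<Rightarrow> ('a \<Rightarrow> 'h::chilbert_space) \<Rightarrow> 'v \<times> 'e list \<Rightarrow> ('h \<Rightarrow>\<^sub>L 'h) \<Rightarrow> complex" where
  "omega E p S \<iota> \<mu> T =
     (let s = \<iota> (path_elem p S \<mu>); t = \<iota> (star (path_elem p S \<mu>)) in
      if path_length \<mu> = 0 then cinner s (blinfun_apply T s)
      else cinner s (blinfun_apply T s)
        + 1 / of_nat (num_paths_into E (path_range E \<mu>) (path_length \<mu>)) * cinner t (blinfun_apply T t))"

text \<open>
  \<open>omega\<close> is real and nonnegative on positive operators, so \<open>ennreal \<circ> Re\<close> loses nothing;
  \<open>infsum\<close> is the limit over the net of finite subsets.
\<close>

definition tau_tilde ::
    "('v, 'e) pre_digraph \<Rightarrow> ('v \<Rightarrow> 'a::cstar_algebra) \<Rightarrow> ('e \<Rightarrow> 'a)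
      \<Rightarrow> ('a \<Rightarrow> 'h::chilbert_space) \<Rightarrow> ('h \<Rightarrow>\<^sub>L 'h) \<Rightarrow> ennreal" where
  "tau_tilde E p S \<iota> T = infsum (\<lambda>\<mu>. ennreal (Re (omega E p S \<iota> \<mu> T))) (paths E)"

end

theory Submission
  imports Defs
begin

text \<open>
  The vectors \<open>S\<^sub>\<mu>\<close> and \<open>|r(\<mu>)|\<^sub>k\<^sup>-\<^sup>1\<^sup>/\<^sup>2 S\<^sub>\<mu>\<^sup>*\<close>, where \<open>k = |\<mu>|\<close>, form a frame
  \<open>e\<^sub>i\<close> of the module: \<open>z = \<Sum>\<^sub>i e\<^sub>i (e\<^sub>i|z)\<^sub>R\<close> is a finite sum for \<open>z \<in> X\<^sub>c\<close>. Since
  \<open>\<phi> T = \<Sum>\<^sub>i \<langle>e\<^sub>i, T e\<^sub>i\<rangle>\<close>, Parseval's identity turns \<open>\<phi> (T\<^sup>*T)\<close> into the double sum of the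
  \<open>\<parallel>(e\<^sub>j|T e\<^sub>i)\<^sub>R\<parallel>\<^sup>2\<close>. Elements of the von Neumann algebra commute with right
  multiplication by gauge invariant elements, and with the trace property of \<open>\<tau>\<close> on those this gives
  \<open>\<parallel>(e\<^sub>j|T e\<^sub>i)\<^sub>R\<parallel> = \<parallel>(e\<^sub>i|T\<^sup>* e\<^sub>j)\<^sub>R\<parallel>\<close>, whence the trace property of \<open>\<phi>\<close>. Normality is
  an exchange of suprema with sums. For semifiniteness, a positive \<open>T \<noteq> 0\<close> dominates a multiple of
  \<open>T \<Theta>\<^sup>2 T\<close>, where \<open>\<Theta> = \<Theta>\<^sup>R\<^sub>e\<^sub>,\<^sub>e\<close> for some frame vector \<open>e\<close>. That traces extend linearly
  rests on the theorem of Kelley and Vaught that \<open>a\<^sup>*a\<close> is positive, so that the positive cone is closed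
  under addition.
\<close>

section \<open>Elementary facts about C*-algebras\<close>

text \<open>The spectrum never appears. Positivity of a self-adjoint h is the norm condition that t
  - h has norm at most t for some t \<ge> 0. This makes the cone visibly closed under addition and
  moves the whole difficulty to showing that it contains every \<open>star a * a\<close>. Square
  roots, absolute values and negative parts all come from one norm-convergent iteration, which
  elements of A reach through a unitization. The second obstacle is that module coefficients take
  values in an algebra, while \<open>tau_tilde\<close> is built from scalars. The maps
  \<open>coeff_op\<close> bridge this: their ranges lie in the closure of the gauge invariant part
  \<open>Fc\<close>, where taking adjoints is isometric for the norm given by the trace. Gauge
  invariance allows the expectation to be dropped under the trace, since a monomial of nonzero
  degree has trace 0. Semifiniteness enters through the vertex projections: they have finite trace,
  and polarization extends this to all of \<open>Ac\<close>.\<close>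

lemma minus_one_scaleC: "(- 1) *\<^sub>C x = - (x :: 'a::complex_vector)"
  using scaleR_scaleC[of "-1" x] by simp

lemma bounded_linear_scaleC: "bounded_linear (\<lambda>x :: 'a::complex_normed_vector. c *\<^sub>C x)"
  by (rule bounded_linear_intro[where K = "cmod c"])
    (simp_all add: scaleC_add_right scaleR_scaleC scaleC_scaleC norm_scaleC mult.commute)

lemmas tendsto_scaleC_right = bounded_linear.tendsto[OF bounded_linear_scaleC]

lemma scaleR_scaleC_commute: "r *\<^sub>R c *\<^sub>C x = c *\<^sub>C r *\<^sub>R (x :: 'a::complex_vector)"
  by (simp add: scaleR_scaleC scaleC_scaleC mult.commute)

lemma star_zero [simp]: "star 0 = (0 :: 'a::cstar_algebra)"
  using star_add[of 0 0] by simp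

lemma star_minus [simp]: "star (- x) = - star (x :: 'a::cstar_algebra)"
  using star_add[of x "- x"] by (simp add: eq_neg_iff_add_eq_0 add.commute)

lemma star_diff: "star (x - y) = star x - star (y :: 'a::cstar_algebra)"
  using star_add[of x "- y"] by simp

lemma star_scaleR: "star (r *\<^sub>R x) = r *\<^sub>R star (x :: 'a::cstar_algebra)"
  by (simp add: scaleR_scaleC star_scaleC)

lemma star_sum: "star (sum f A) = (\<Sum>i\<in>A. star (f i :: 'a::cstar_algebra))"
  by (induction A rule: infinite_finite_induct) (auto simp: star_add)

lemma norm_star [simp]: "norm (star x) = norm (x :: 'a::cstar_algebra)"
proof -
  have le: "norm y \<le> norm (star y)" for y :: 'a
  proof (cases "norm y = 0")
    case False
    have "norm y * norm y \<le> norm (star y) * norm y"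
      using norm_mult_ineq[of "star y" y] by (simp add: cstar_identity power2_eq_square)
    with False show ?thesis by simp
  qed simp
  from le[of x] le[of "star x"] show ?thesis by (simp add: star_star)
qed

lemma star_mult_self_eq_0: "star x * x = 0 \<longleftrightarrow> x = (0 :: 'a::cstar_algebra)"
  using cstar_identity[of x] by auto

lemma bounded_linear_star: "bounded_linear (star :: 'a::cstar_algebra \<Rightarrow> 'a)"
  by (rule bounded_linear_intro[where K = 1]) (auto simp: star_add star_scaleR)

lemmas tendsto_star = bounded_linear.tendsto[OF bounded_linear_star]

lemma selfadjoint_square_eq_0:
  fixes x :: "'a::cstar_algebra"
  assumes "star x = x" "x * x = 0"
  shows "x = 0"
  using star_mult_self_eq_0[of x] assms by simp

lemmas scaleC_algebra = scaleC_add_right scaleC_add_left scaleC_scaleC mult_scaleC_left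
  mult_scaleC_right complex_vector.scale_right_diff_distrib complex_vector.scale_left_diff_distrib


section \<open>The unitization of a C*-algebra\<close>

text \<open>
  The C*-norm on \<open>A \<oplus> \<complex>\<close> is the maximum of two C*-seminorms: the norm as an operator on \<open>A\<close>,
  which degenerates when \<open>A\<close> is already unital, and the modulus of the scalar part.
\<close>

datatype 'a unitz = Unitz (upart: 'a) (uscal: complex)

definition uact :: "'a unitz \<Rightarrow> 'a \<Rightarrow> 'a::cstar_algebra" where
  "uact u x = upart u * x + uscal u *\<^sub>C x"

lemma bounded_linear_uact: "bounded_linear (uact u)"
  unfolding uact_def
  by (intro bounded_linear_add bounded_linear_mult_right bounded_linear_scaleC)

instantiation unitz :: (cstar_algebra) complex_normed_vector
begin

definition "0 = Unitz 0 0"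
definition "u + v = Unitz (upart u + upart v) (uscal u + uscal v)"
definition "- u = Unitz (- upart u) (- uscal u)"
definition "u - v = Unitz (upart u - upart v) (uscal u - uscal v)" for u v :: "'a unitz"
definition "c *\<^sub>C u = Unitz (c *\<^sub>C upart u) (c * uscal u)"
definition "r *\<^sub>R u = Unitz (r *\<^sub>R upart u) (complex_of_real r * uscal u)"
definition "norm u = max (cmod (uscal u)) (onorm (uact u))"
definition "sgn (u :: 'a unitz) = inverse (norm u) *\<^sub>R u"
definition "dist u v = norm (u - v :: 'a unitz)"
definition "(uniformity :: ('a unitz \<times> 'a unitz) filter) = (INF e\<in>{0<..}. principal {(x, y). dist x y < e})"
definition "open (U :: 'a unitz set) = (\<forall>x\<in>U. eventually (\<lambda>(x', y). x' = x \<longrightarrow> y \<in> U) uniformity)"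

lemmas unitz_defs = zero_unitz_def plus_unitz_def uminus_unitz_def minus_unitz_def
  scaleC_unitz_def scaleR_unitz_def

lemma uact_add: "uact (u + v) = (\<lambda>x. uact u x + uact v x)"
  by (rule ext) (simp add: uact_def unitz_defs algebra_simps scaleC_algebra)

lemma uact_scaleC: "uact (c *\<^sub>C u) = (\<lambda>x. c *\<^sub>C uact u x)"
  by (rule ext) (simp add: uact_def unitz_defs algebra_simps scaleC_algebra)

lemma norm_uact_le: "norm (uact u x) \<le> norm u * norm x"
proof -
  have "norm (uact u x) \<le> onorm (uact u) * norm x" by (rule onorm[OF bounded_linear_uact])
  also have "\<dots> \<le> norm u * norm x" by (intro mult_right_mono) (auto simp: norm_unitz_def)
  finally show ?thesis .
qed

lemma norm_uscal_le: "cmod (uscal u) \<le> norm u" by (simp add: norm_unitz_def)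

lemma norm_unitz_bound:
  "cmod (uscal u) \<le> K \<Longrightarrow> (\<And>x. norm (uact u x) \<le> K * norm x) \<Longrightarrow> norm u \<le> K"
  unfolding norm_unitz_def by (intro max.boundedI onorm_bound) (auto intro: order_trans[OF norm_ge_zero])

lemma norm_unitz_nonneg: "0 \<le> norm (u :: 'a unitz)"
  by (simp add: norm_unitz_def le_max_iff_disj)

text \<open>Acting on \<open>star (upart u)\<close> produces
  \<open>upart u * star (upart u)\<close>, of norm the square of \<open>norm (upart u)\<close>, plus
  a scalar multiple of \<open>star (upart u)\<close>. Definiteness of the norm and completeness of
  the unitization follow from this bound together with \<open>norm_uscal_le\<close>.\<close>

lemma norm_upart_le: "norm (upart u) \<le> 2 * norm u"
proof (cases "upart u = 0")
  case False
  let ?a = "upart u"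
  have "norm ?a * norm ?a = norm (?a * star ?a)"
    using cstar_identity[of "star ?a"] by (simp add: star_star power2_eq_square)
  also have "\<dots> = norm (uact u (star ?a) - uscal u *\<^sub>C star ?a)" by (simp add: uact_def)
  also have "\<dots> \<le> norm (uact u (star ?a)) + norm (uscal u *\<^sub>C star ?a)" by (rule norm_triangle_ineq4)
  also have "\<dots> \<le> norm u * norm ?a + norm u * norm ?a"
    using norm_uact_le[of u "star ?a"] norm_uscal_le[of u]
    by (intro add_mono) (auto simp: norm_scaleC mult_right_mono)
  finally have "norm ?a * norm ?a \<le> (2 * norm u) * norm ?a" by simp
  with False show ?thesis by (simp only: mult_le_cancel_right) auto
qed (simp add: norm_unitz_nonneg)

lemma norm_unitz_eq_0: "norm u = 0 \<Longrightarrow> u = (0 :: 'a unitz)"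
  using norm_upart_le[of u] norm_uscal_le[of u] by (cases u) (auto simp: unitz_defs)

lemma norm_unitz_scaleC_le: "norm (c *\<^sub>C u) \<le> cmod c * norm (u :: 'a unitz)"
proof (rule norm_unitz_bound)
  show "cmod (uscal (c *\<^sub>C u)) \<le> cmod c * norm u"
    using norm_uscal_le[of u] by (auto simp: unitz_defs norm_mult intro!: mult_left_mono)
  show "norm (uact (c *\<^sub>C u) x) \<le> cmod c * norm u * norm x" for x
    using mult_left_mono[OF norm_uact_le[of u x], of "cmod c"]
    by (simp add: uact_scaleC norm_scaleC mult.assoc)
qed

lemma unitz_scaleC_scaleC: "c *\<^sub>C (d *\<^sub>C u) = (c * d) *\<^sub>C (u :: 'a unitz)"
  by (simp add: unitz_defs scaleC_scaleC)

lemma unitz_scaleC_one: "1 *\<^sub>C u = (u :: 'a unitz)"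
  by (simp add: unitz_defs scaleC_one)

lemma norm_unitz_scaleC: "norm (c *\<^sub>C u) = cmod c * norm (u :: 'a unitz)"
proof (cases "c = 0")
  case True
  have "norm (0 *\<^sub>C u) \<le> 0" using norm_unitz_scaleC_le[of 0 u] by simp
  then show ?thesis using True norm_unitz_nonneg[of "0 *\<^sub>C u"] by simp
next
  case False
  have "norm u = norm (inverse c *\<^sub>C (c *\<^sub>C u))" using False
    by (simp add: unitz_scaleC_scaleC unitz_scaleC_one)
  also have "\<dots> \<le> inverse (cmod c) * norm (c *\<^sub>C u)"
    using norm_unitz_scaleC_le[of "inverse c" "c *\<^sub>C u"] by (simp add: norm_inverse)
  finally have "cmod c * norm u \<le> norm (c *\<^sub>C u)" using False by (simp add: field_simps)
  with norm_unitz_scaleC_le[of c u] show ?thesis by simp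
qed

lemma norm_unitz_triangle: "norm (u + v) \<le> norm u + norm (v :: 'a unitz)"
proof (rule norm_unitz_bound)
  show "cmod (uscal (u + v)) \<le> norm u + norm v"
    using norm_uscal_le[of u] norm_uscal_le[of v] norm_triangle_ineq[of "uscal u" "uscal v"]
    by (simp add: unitz_defs)
  show "norm (uact (u + v) x) \<le> (norm u + norm v) * norm x" for x
    using norm_uact_le[of u x] norm_uact_le[of v x] norm_triangle_ineq[of "uact u x" "uact v x"]
    by (simp add: uact_add algebra_simps)
qed

lemma norm_unitz_le: "norm (u :: 'a unitz) \<le> norm (upart u) + cmod (uscal u)"
proof (rule norm_unitz_bound)
  show "norm (uact u x) \<le> (norm (upart u) + cmod (uscal u)) * norm x" for x
    using norm_triangle_ineq[of "upart u * x" "uscal u *\<^sub>C x"] norm_mult_ineq[of "upart u" x]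
    by (simp add: uact_def norm_scaleC algebra_simps)
qed simp

instance
proof
  fix u v w :: "'a unitz" and c d :: complex and r s :: real
  show "u + v + w = u + (v + w)" "u + v = v + u" "0 + u = u" "- u + u = 0" "u - v = u + - v"
    by (simp_all add: unitz_defs)
  show "r *\<^sub>R (u + v) = r *\<^sub>R u + r *\<^sub>R v" "(r + s) *\<^sub>R u = r *\<^sub>R u + s *\<^sub>R u"
    "r *\<^sub>R s *\<^sub>R u = (r * s) *\<^sub>R u" "1 *\<^sub>R u = u"
    by (simp_all add: unitz_defs algebra_simps)
  show "c *\<^sub>C (u + v) = c *\<^sub>C u + c *\<^sub>C v" "(c + d) *\<^sub>C u = c *\<^sub>C u + d *\<^sub>C u"
    "r *\<^sub>R u = complex_of_real r *\<^sub>C u"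
    by (simp_all add: unitz_defs algebra_simps scaleC_algebra scaleR_scaleC)
  show "c *\<^sub>C (d *\<^sub>C u) = (c * d) *\<^sub>C u" "1 *\<^sub>C u = u"
    by (fact unitz_scaleC_scaleC unitz_scaleC_one)+
  show "dist u v = norm (u - v)" "sgn u = inverse (norm u) *\<^sub>R u"
    "(uniformity :: ('a unitz \<times> 'a unitz) filter) = (INF e\<in>{0<..}. principal {(x, y). dist x y < e})"
    by (fact dist_unitz_def sgn_unitz_def uniformity_unitz_def)+
  show "open U = (\<forall>x\<in>U. eventually (\<lambda>(x', y). x' = x \<longrightarrow> y \<in> U) uniformity)" for U :: "'a unitz set"
    by (rule open_unitz_def)
  show "norm (u + v) \<le> norm u + norm v" by (rule norm_unitz_triangle)
  show "norm (c *\<^sub>C u) = cmod c * norm u" by (rule norm_unitz_scaleC)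
  show "norm (r *\<^sub>R u) = \<bar>r\<bar> * norm u"
    using norm_unitz_scaleC[of "complex_of_real r" u] by (simp add: unitz_defs scaleR_scaleC)
  have "norm (0 :: 'a unitz) \<le> 0" using norm_unitz_le[of "0 :: 'a unitz"] by (simp add: unitz_defs)
  then show "norm u = 0 \<longleftrightarrow> u = 0"
    using norm_unitz_eq_0[of u] norm_unitz_nonneg[of "0 :: 'a unitz"] by auto
qed

end

instance unitz :: (cstar_algebra) banach
proof
  fix X :: "nat \<Rightarrow> 'a unitz"
  assume "Cauchy X"
  then have X: "\<exists>M. \<forall>m\<ge>M. \<forall>n\<ge>M. norm (X m - X n) < e" if "0 < e" for e
    using that by (simp add: Cauchy_def dist_unitz_def)
  have "Cauchy (\<lambda>n. upart (X n))"
  proof (rule metric_CauchyI)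
    fix e :: real assume "0 < e"
    with X[of "e / 2"] obtain M where M: "\<forall>m\<ge>M. \<forall>n\<ge>M. norm (X m - X n) < e / 2" by auto
    have "norm (upart (X m) - upart (X n)) < e" if "m \<ge> M" "n \<ge> M" for m n
      using norm_upart_le[of "X m - X n"] M[rule_format, OF that] by (simp add: minus_unitz_def)
    then show "\<exists>M. \<forall>m\<ge>M. \<forall>n\<ge>M. dist (upart (X m)) (upart (X n)) < e"
      by (auto simp: dist_norm)
  qed
  then obtain a where a: "(\<lambda>n. upart (X n)) \<longlonglongrightarrow> a" by (auto simp: Cauchy_convergent_iff convergent_def)
  have "Cauchy (\<lambda>n. uscal (X n))"
  proof (rule metric_CauchyI)
    fix e :: real assume "0 < e"
    with X[of e] obtain M where M: "\<forall>m\<ge>M. \<forall>n\<ge>M. norm (X m - X n) < e" by auto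
    have "norm (uscal (X m) - uscal (X n)) < e" if "m \<ge> M" "n \<ge> M" for m n
      using norm_uscal_le[of "X m - X n"] M[rule_format, OF that] by (simp add: minus_unitz_def)
    then show "\<exists>M. \<forall>m\<ge>M. \<forall>n\<ge>M. dist (uscal (X m)) (uscal (X n)) < e"
      by (auto simp: dist_norm)
  qed
  then obtain l where l: "(\<lambda>n. uscal (X n)) \<longlonglongrightarrow> l" by (auto simp: Cauchy_convergent_iff convergent_def)
  have "(\<lambda>n. norm (upart (X n) - a) + cmod (uscal (X n) - l)) \<longlonglongrightarrow> 0"
    using tendsto_add[OF tendsto_norm[OF tendsto_diff[OF a tendsto_const[of a]]]
        tendsto_norm[OF tendsto_diff[OF l tendsto_const[of l]]]] by simp
  then have "(\<lambda>n. dist (X n) (Unitz a l)) \<longlonglongrightarrow> 0"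
  proof (rule Lim_null_comparison[rotated], intro always_eventually allI)
    show "norm (dist (X n) (Unitz a l)) \<le> norm (upart (X n) - a) + cmod (uscal (X n) - l)" for n
      using norm_unitz_le[of "X n - Unitz a l"]
      by (simp add: minus_unitz_def dist_unitz_def norm_unitz_nonneg)
  qed
  then show "convergent X" using tendsto_dist_iff[of X] by (auto simp: convergent_def)
qed

instantiation unitz :: (cstar_algebra) cstar_algebra
begin

definition "u * v = Unitz (upart u * upart v + uscal u *\<^sub>C upart v + uscal v *\<^sub>C upart u) (uscal u * uscal v)"
definition "star u = Unitz (star (upart u)) (cnj (uscal u))"
lemmas unitz_mult_defs = times_unitz_def star_unitz_def unitz_defs

lemma uact_mult: "uact (u * v) = uact u \<circ> uact v"
  by (rule ext) (simp add: uact_def unitz_mult_defs algebra_simps scaleC_algebra)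

lemma norm_unitz_mult: "norm (u * v) \<le> norm u * norm (v :: 'a unitz)"
proof (rule norm_unitz_bound)
  show "cmod (uscal (u * v)) \<le> norm u * norm v"
    using norm_uscal_le[of u] norm_uscal_le[of v]
    by (auto simp: unitz_mult_defs norm_mult norm_unitz_nonneg intro!: mult_mono)
  fix x
  have "norm (uact (u * v) x) \<le> norm u * norm (uact v x)" by (simp add: uact_mult norm_uact_le)
  also have "\<dots> \<le> norm u * (norm v * norm x)"
    by (intro mult_left_mono norm_uact_le norm_unitz_nonneg)
  finally show "norm (uact (u * v) x) \<le> norm u * norm v * norm x" by (simp add: mult.assoc)
qed

text \<open>The C*-identity of A, applied to \<open>uact u x\<close>, leads to
  \<open>star x * uact (star u * u) x\<close>, so the action of \<open>star u * u\<close> controls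
  the square of the action of u. The scalar part is multiplicative.\<close>

lemma unitz_cstar_ge: "(norm u)\<^sup>2 \<le> norm (star u * u)" for u :: "'a unitz"
proof -
  let ?K = "norm (star u * u)"
  have "norm u \<le> sqrt ?K"
  proof (rule norm_unitz_bound)
    have "(cmod (uscal u))\<^sup>2 \<le> ?K"
      using norm_uscal_le[of "star u * u"]
      by (simp add: unitz_mult_defs norm_mult power2_eq_square)
    then show "cmod (uscal u) \<le> sqrt ?K" by (simp add: real_le_rsqrt)
    fix x
    have "(norm (uact u x))\<^sup>2 = norm (star (uact u x) * uact u x)" by (simp add: cstar_identity)
    also have "star (uact u x) * uact u x = star x * uact (star u * u) x"
      by (simp add: uact_def unitz_mult_defs algebra_simps scaleC_algebra star_add star_mult star_scaleC)
    also have "norm \<dots> \<le> norm x * (?K * norm x)"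
      using order_trans[OF norm_mult_ineq mult_left_mono[OF norm_uact_le[of "star u * u" x] norm_ge_zero[of "star x"]]]
      by simp
    finally have "(norm (uact u x))\<^sup>2 \<le> (sqrt ?K * norm x)\<^sup>2"
      by (simp add: power_mult_distrib norm_unitz_nonneg) (simp add: power2_eq_square mult_ac)
    then show "norm (uact u x) \<le> sqrt ?K * norm x"
      by (rule power2_le_imp_le) (simp add: norm_unitz_nonneg)
  qed
  then have "(norm u)\<^sup>2 \<le> (sqrt ?K)\<^sup>2" by (intro power_mono norm_unitz_nonneg)
  then show ?thesis by (simp add: norm_unitz_nonneg)
qed

lemma unitz_star_star: "star (star u) = (u :: 'a unitz)"
  by (simp add: unitz_mult_defs star_star)

lemma norm_unitz_star_le: "norm u \<le> norm (star u)" for u :: "'a unitz"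
proof (cases "norm u = 0")
  case True
  then show ?thesis by (simp add: norm_unitz_nonneg)
next
  case False
  have "norm u * norm u \<le> norm (star u) * norm u"
    using unitz_cstar_ge[of u] norm_unitz_mult[of "star u" u] by (simp add: power2_eq_square)
  then show ?thesis using False norm_unitz_nonneg[of u] by simp
qed

lemma norm_unitz_star: "norm (star u) = norm (u :: 'a unitz)"
  using norm_unitz_star_le[of u] norm_unitz_star_le[of "star u"] by (simp add: unitz_star_star)

instance
proof
  fix u v w :: "'a unitz" and c d :: complex and r s :: real
  show "u * v * w = u * (v * w)" "(u + v) * w = u * w + v * w" "u * (v + w) = u * v + u * w"
    by (simp_all add: unitz_mult_defs algebra_simps scaleC_algebra)
  show "r *\<^sub>R u * v = r *\<^sub>R (u * v)" "u * r *\<^sub>R v = r *\<^sub>R (u * v)"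
    by (simp_all add: unitz_mult_defs algebra_simps scaleC_algebra scaleR_scaleC)
  show "c *\<^sub>C u * v = c *\<^sub>C (u * v)" "u * c *\<^sub>C v = c *\<^sub>C (u * v)"
    by (simp_all add: unitz_mult_defs algebra_simps scaleC_algebra)
  show "star (star u) = u" by (rule unitz_star_star)
  show "star (u + v) = star u + star v" "star (c *\<^sub>C u) = cnj c *\<^sub>C star u" "star (u * v) = star v * star u"
    by (simp_all add: unitz_mult_defs star_add star_scaleC star_mult algebra_simps)
  show "norm (u * v) \<le> norm u * norm v" by (rule norm_unitz_mult)
  have "norm (star u * u) \<le> (norm u)\<^sup>2"
    using norm_unitz_mult[of "star u" u] by (simp only: norm_unitz_star power2_eq_square)
  then show "norm (star u * u) = (norm u)\<^sup>2"
    using unitz_cstar_ge[of u] by (rule antisym)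
qed

end

instantiation unitz :: (cstar_algebra) real_normed_algebra_1
begin

definition "1 = Unitz 0 1"

instance
proof
  fix u :: "'a unitz"
  show "1 * u = u" "u * 1 = u"
    by (simp_all add: one_unitz_def times_unitz_def scaleC_one)
  show "(0 :: 'a unitz) \<noteq> 1" by (simp add: one_unitz_def zero_unitz_def)
  have "norm (1 :: 'a unitz) \<le> 1"
    using norm_unitz_le[of "1 :: 'a unitz"] by (simp add: one_unitz_def)
  with norm_uscal_le[of "1 :: 'a unitz"] show "norm (1 :: 'a unitz) = 1"
    by (simp add: one_unitz_def)
qed

end

definition uemb :: "'a \<Rightarrow> 'a::cstar_algebra unitz" where "uemb a = Unitz a 0"

lemma uemb_simps:
  "uemb (a + b) = uemb a + uemb b" "uemb (a * b) = uemb a * uemb b" "uemb (a - b) = uemb a - uemb b"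
  "uemb (c *\<^sub>C a) = c *\<^sub>C uemb a" "uemb (r *\<^sub>R a) = r *\<^sub>R uemb a" "uemb (star a) = star (uemb a)"
  "uemb 0 = 0"
  by (simp_all add: uemb_def unitz_mult_defs)

lemma uemb_inj: "uemb a = uemb b \<longleftrightarrow> a = b"
  by (simp add: uemb_def)

text \<open>\<open>star a\<close> is the vector on which left multiplication by a attains the norm
  of a.\<close>

lemma norm_uemb [simp]: "norm (uemb a) = norm a"
proof (rule antisym)
  show "norm (uemb a) \<le> norm a" using norm_unitz_le[of "uemb a"] by (simp add: uemb_def)
  have "norm a * norm a = norm (uact (uemb a) (star a))"
    using cstar_identity[of "star a"] by (simp add: uact_def uemb_def star_star power2_eq_square)
  also have "\<dots> \<le> norm (uemb a) * norm a" using norm_uact_le[of "uemb a" "star a"] by simp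
  finally show "norm a \<le> norm (uemb a)" by (cases "a = 0") auto
qed

lemma uemb_upart: "uscal u = 0 \<Longrightarrow> uemb (upart u) = u"
  by (cases u) (simp add: uemb_def)

lemma uscal_mult: "uscal (u * v) = uscal u * uscal (v :: 'a::cstar_algebra unitz)"
  by (simp add: times_unitz_def)

lemma uscal_uemb [simp]: "uscal (uemb a) = 0"
  by (simp add: uemb_def)


section \<open>Positive elements of a unital C*-algebra\<close>

text \<open>
  For \<open>norm x \<le> 1\<close> the iterates converge to \<open>1 - sqrt (1 - x)\<close>: their increments are
  dominated by those of the scalar sequence for \<open>x = 1\<close>.
\<close>

fun sqrt_iter :: "'u::real_normed_algebra_1 \<Rightarrow> nat \<Rightarrow> 'u" where
  "sqrt_iter x 0 = 0"
| "sqrt_iter x (Suc n) = (1 / 2) *\<^sub>R (x + sqrt_iter x n * sqrt_iter x n)"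

definition sqrt_lim :: "'u::real_normed_algebra_1 \<Rightarrow> 'u" where
  "sqrt_lim x = lim (sqrt_iter x)"

text \<open>Stated for an intertwiner b rather than for a commuting element: later
  \<open>star b\<close> has to carry the absolute value of \<open>b * star b\<close> to that of
  \<open>star b * b\<close>.\<close>

lemma sqrt_iter_intertwine: "b * x = x' * b \<Longrightarrow> b * sqrt_iter x n = sqrt_iter x' n * b"
proof (induction n)
  case (Suc n)
  have "b * (sqrt_iter x n * sqrt_iter x n) = sqrt_iter x' n * sqrt_iter x' n * b"
    using Suc by (metis mult.assoc)
  then show ?case using Suc.prems by (simp add: algebra_simps)
qed simp

lemma sqrt_iter_commute: "sqrt_iter x m * sqrt_iter x n = sqrt_iter x n * sqrt_iter x m"
proof -
  have "x * sqrt_iter x m = sqrt_iter x m * x" by (rule sqrt_iter_intertwine) simp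
  then show ?thesis by (intro sqrt_iter_intertwine) simp
qed

lemma sqrt_iter_one_bounds: "0 \<le> sqrt_iter (1 :: real) n \<and> sqrt_iter (1 :: real) n \<le> 1"
  by (induction n) (auto simp: mult_le_one)

lemma sqrt_iter_one_mono: "sqrt_iter (1 :: real) n \<le> sqrt_iter (1 :: real) (Suc n)"
proof (induction n)
  case (Suc n)
  have "sqrt_iter (1 :: real) n * sqrt_iter 1 n \<le> sqrt_iter (1 :: real) (Suc n) * sqrt_iter 1 (Suc n)"
    using Suc sqrt_iter_one_bounds by (intro mult_mono) auto
  then show ?case by simp
qed simp

lemma norm_sqrt_iter: "norm x \<le> 1 \<Longrightarrow> norm (sqrt_iter x n) \<le> sqrt_iter (1 :: real) n"
proof (induction n)
  case (Suc n)
  have "norm (sqrt_iter x n * sqrt_iter x n) \<le> sqrt_iter (1 :: real) n * sqrt_iter 1 n"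
    using Suc by (intro order_trans[OF norm_mult_ineq] mult_mono) (auto simp: sqrt_iter_one_bounds)
  then have "norm (x + sqrt_iter x n * sqrt_iter x n) \<le> 1 + sqrt_iter (1 :: real) n * sqrt_iter 1 n"
    using Suc.prems by (intro norm_triangle_mono)
  then show ?case by simp
qed simp

text \<open>The iterates of x commute, so a difference of squares factors as (y + z) * (y - z). The
  scalar sequence at 1 satisfies the same factorization with equality, so the bounds on the two
  factors multiply.\<close>

lemma norm_sqrt_iter_step:
  assumes "norm x \<le> 1"
  shows "norm (sqrt_iter x (Suc n) - sqrt_iter x n) \<le> sqrt_iter (1 :: real) (Suc n) - sqrt_iter 1 n"
proof (induction n)
  case 0
  then show ?case using assms by simp
next
  case (Suc n)
  define y z where "y = sqrt_iter x (Suc n)" and "z = sqrt_iter x n"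
  define s t where "s = sqrt_iter (1 :: real) (Suc n)" and "t = sqrt_iter (1 :: real) n"
  have yz: "y * z = z * y" unfolding y_def z_def by (rule sqrt_iter_commute)
  have "sqrt_iter x (Suc (Suc n)) - sqrt_iter x (Suc n) = (1 / 2) *\<^sub>R (x + y * y) - (1 / 2) *\<^sub>R (x + z * z)"
    unfolding y_def z_def by simp
  also have "\<dots> = (1 / 2) *\<^sub>R ((y + z) * (y - z))"
    using yz by (simp add: algebra_simps)
  also have "norm \<dots> \<le> (1 / 2) * ((s + t) * (s - t))"
  proof -
    have "norm (y + z) \<le> s + t"
      using norm_sqrt_iter[OF assms] unfolding y_def z_def s_def t_def by (intro norm_triangle_mono)
    moreover have "norm (y - z) \<le> s - t" using Suc unfolding y_def z_def s_def t_def .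
    ultimately have "norm ((y + z) * (y - z)) \<le> (s + t) * (s - t)"
      by (intro order_trans[OF norm_mult_ineq] mult_mono) (auto simp: s_def t_def sqrt_iter_one_bounds
        add_nonneg_nonneg simp del: sqrt_iter.simps)
    then show ?thesis by simp
  qed
  also have "\<dots> = (1 / 2) *\<^sub>R (1 + s * s) - (1 / 2) *\<^sub>R (1 + t * t)" by (simp add: algebra_simps)
  also have "\<dots> = sqrt_iter (1 :: real) (Suc (Suc n)) - sqrt_iter 1 (Suc n)"
    unfolding s_def t_def by simp
  finally show ?case .
qed

lemma norm_sqrt_iter_diff:
  assumes "norm x \<le> 1" "n \<le> m"
  shows "norm (sqrt_iter x m - sqrt_iter x n) \<le> sqrt_iter (1 :: real) m - sqrt_iter 1 n"
  using assms(2)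
proof (induction m rule: dec_induct)
  case (step m)
  have "sqrt_iter x (Suc m) - sqrt_iter x n
      = (sqrt_iter x (Suc m) - sqrt_iter x m) + (sqrt_iter x m - sqrt_iter x n)" by simp
  also have "norm \<dots> \<le> (sqrt_iter (1 :: real) (Suc m) - sqrt_iter 1 m) + (sqrt_iter 1 m - sqrt_iter 1 n)"
    by (intro norm_triangle_mono norm_sqrt_iter_step assms step.IH)
  finally show ?case by simp
qed simp

lemma sqrt_iter_tendsto:
  fixes x :: "'u::{real_normed_algebra_1, banach}"
  assumes "norm x \<le> 1"
  shows "sqrt_iter x \<longlonglongrightarrow> sqrt_lim x"
proof -
  have "convergent (sqrt_iter (1 :: real))"
    using Bseq_mono_convergent[of "sqrt_iter (1 :: real)"] sqrt_iter_one_mono sqrt_iter_one_bounds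
    by (metis BseqI' abs_of_nonneg incseq_SucI incseq_def real_norm_def)
  then have C: "Cauchy (sqrt_iter (1 :: real))" by (simp add: Cauchy_convergent_iff)
  have "Cauchy (sqrt_iter x)"
  proof (rule CauchyI')
    fix e :: real assume "0 < e"
    with C obtain M where M: "\<forall>m\<ge>M. \<forall>n\<ge>M. norm (sqrt_iter (1 :: real) m - sqrt_iter 1 n) < e"
      by (auto dest: CauchyD)
    have "norm (sqrt_iter x m - sqrt_iter x n) < e" if "m \<ge> M" "n > m" for m n
    proof -
      have "norm (sqrt_iter x m - sqrt_iter x n) \<le> sqrt_iter (1 :: real) n - sqrt_iter 1 m"
        using norm_sqrt_iter_diff[OF assms, of m n] that by (simp add: norm_minus_commute)
      also have "\<dots> \<le> norm (sqrt_iter (1 :: real) n - sqrt_iter 1 m)" by simp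
      also have "\<dots> < e" using M that by simp
      finally show ?thesis .
    qed
    then show "\<exists>M. \<forall>m\<ge>M. \<forall>n>m. dist (sqrt_iter x m) (sqrt_iter x n) < e" by (auto simp: dist_norm)
  qed
  then show ?thesis
    by (simp add: Cauchy_convergent_iff convergent_LIMSEQ_iff sqrt_lim_def)
qed

context
  fixes x :: "'u::{real_normed_algebra_1, banach}"
  assumes x: "norm x \<le> 1"
begin

lemma sqrt_lim_fixpoint: "2 *\<^sub>R sqrt_lim x = x + sqrt_lim x * sqrt_lim x"
proof -
  have "(\<lambda>n. sqrt_iter x (Suc n)) \<longlonglongrightarrow> (1 / 2) *\<^sub>R (x + sqrt_lim x * sqrt_lim x)"
    unfolding sqrt_iter.simps by (intro tendsto_intros sqrt_iter_tendsto x)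
  moreover have "(\<lambda>n. sqrt_iter x (Suc n)) \<longlonglongrightarrow> sqrt_lim x"
    using sqrt_iter_tendsto[OF x] by (rule LIMSEQ_Suc)
  ultimately have "sqrt_lim x = (1 / 2) *\<^sub>R (x + sqrt_lim x * sqrt_lim x)"
    using LIMSEQ_unique by blast
  then have "2 *\<^sub>R sqrt_lim x = 2 *\<^sub>R ((1 / 2) *\<^sub>R (x + sqrt_lim x * sqrt_lim x))" by (rule arg_cong)
  then show ?thesis by simp
qed

lemma sqrt_lim_square: "(1 - sqrt_lim x) * (1 - sqrt_lim x) = 1 - x"
  using sqrt_lim_fixpoint by (simp add: algebra_simps scaleR_2)

lemma norm_sqrt_lim: "norm (sqrt_lim x) \<le> 1"
proof (rule tendsto_upperbound)
  show "(\<lambda>n. norm (sqrt_iter x n)) \<longlonglongrightarrow> norm (sqrt_lim x)"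
    by (intro tendsto_intros sqrt_iter_tendsto x)
  show "\<forall>\<^sub>F n in sequentially. norm (sqrt_iter x n) \<le> 1"
    using norm_sqrt_iter[OF x] sqrt_iter_one_bounds by (intro always_eventually allI) (meson order_trans)
qed simp

lemma sqrt_lim_intertwine:
  assumes "norm x' \<le> 1" "b * x = x' * b"
  shows "b * sqrt_lim x = sqrt_lim x' * b"
proof (rule LIMSEQ_unique)
  show "(\<lambda>n. b * sqrt_iter x n) \<longlonglongrightarrow> b * sqrt_lim x"
    by (intro tendsto_intros sqrt_iter_tendsto x)
  show "(\<lambda>n. b * sqrt_iter x n) \<longlonglongrightarrow> sqrt_lim x' * b"
    unfolding sqrt_iter_intertwine[OF assms(2)] by (intro tendsto_intros sqrt_iter_tendsto assms)
qed

end

lemma star_one [simp]: "star 1 = (1 :: 'u::{cstar_algebra, real_normed_algebra_1})"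
  by (metis mult.right_neutral star_mult star_star)

lemma star_sqrt_lim:
  fixes x :: "'u::{cstar_algebra, real_normed_algebra_1}"
  assumes "norm x \<le> 1" "star x = x"
  shows "star (sqrt_lim x) = sqrt_lim x"
proof (rule LIMSEQ_unique)
  have "star (sqrt_iter x n) = sqrt_iter x n" for n
    by (induction n) (auto simp: star_add star_mult star_scaleR assms)
  with tendsto_star[OF sqrt_iter_tendsto[OF assms(1)]]
  show "sqrt_iter x \<longlonglongrightarrow> star (sqrt_lim x)" by simp
qed (rule sqrt_iter_tendsto[OF assms(1)])

text \<open>For self-adjoint h the norm condition says that the spectrum lies between 0 and 2 * t.
  In this form sums are handled by the triangle inequality, adding the radii.\<close>

definition cpos :: "'u::{cstar_algebra, real_normed_algebra_1} \<Rightarrow> bool" where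
  "cpos h \<longleftrightarrow> star h = h \<and> (\<exists>t\<ge>0. norm (t *\<^sub>R 1 - h) \<le> t)"

lemma cpos_star: "cpos h \<Longrightarrow> star h = h"
  by (simp add: cpos_def)

lemma cpos_zero: "cpos 0"
  by (auto simp: cpos_def intro: exI[of _ 0])

lemma cpos_add:
  assumes "cpos h" "cpos k"
  shows "cpos (h + k)"
proof -
  from assms obtain s t where st: "s \<ge> 0" "t \<ge> 0" "norm (s *\<^sub>R 1 - h) \<le> s" "norm (t *\<^sub>R 1 - k) \<le> t"
    by (auto simp: cpos_def)
  have "norm ((s + t) *\<^sub>R 1 - (h + k)) \<le> s + t"
    using norm_triangle_mono[OF st(3,4)] by (simp add: algebra_simps)
  with st assms show ?thesis by (auto simp: cpos_def star_add intro!: exI[of _ "s + t"])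
qed

lemma cpos_scaleR:
  assumes "0 \<le> r" "cpos h"
  shows "cpos (r *\<^sub>R h)"
proof -
  from assms obtain t where t: "t \<ge> 0" "norm (t *\<^sub>R 1 - h) \<le> t" by (auto simp: cpos_def)
  have "norm ((r * t) *\<^sub>R 1 - r *\<^sub>R h) = r * norm (t *\<^sub>R 1 - h)"
    using assms(1) by (metis abs_of_nonneg norm_scaleR scaleR_right_diff_distrib scaleR_scaleR)
  also have "\<dots> \<le> r * t" using assms(1) t by (intro mult_left_mono)
  finally show ?thesis using assms t
    by (auto simp: cpos_def star_scaleR intro!: exI[of _ "r * t"])
qed

lemma cpos_diff_norm:
  assumes "star c = c" "norm c \<le> t"
  shows "cpos (t *\<^sub>R 1 - c)"
  using assms order_trans[OF norm_ge_zero assms(2)]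
  by (auto simp: cpos_def star_diff star_scaleR intro!: exI[of _ t])

text \<open>Dividing by t turns h into 1 - x with x in the unit ball, where \<open>sqrt_lim\<close>
  applies; t = 0 forces h = 0. The commutation clause later provides commuting roots of commuting
  elements.\<close>

lemma cpos_sqrt:
  assumes "cpos h"
  obtains k where "cpos k" "k * k = h" "\<And>c. c * h = h * c \<Longrightarrow> c * k = k * c"
proof -
  from assms obtain t where t: "t \<ge> 0" "norm (t *\<^sub>R 1 - h) \<le> t" and h: "star h = h"
    by (auto simp: cpos_def)
  show thesis
  proof (cases "t = 0")
    case True
    with t have "h = 0" by simp
    then show thesis using that[of 0] cpos_zero by simp
  next
    case False
    with t have t0: "t > 0" by simp
    define x where "x = 1 - (1 / t) *\<^sub>R h"
    have "norm x = norm ((1 / t) *\<^sub>R (t *\<^sub>R 1 - h))"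
      unfolding x_def using t0 by (simp add: scaleR_right_diff_distrib)
    also have "\<dots> = (1 / t) * norm (t *\<^sub>R 1 - h)" using t0 by (simp only: norm_scaleR) simp
    also have "\<dots> \<le> 1" using t0 t by (simp add: field_simps)
    finally have x: "norm x \<le> 1" .
    define k where "k = sqrt t *\<^sub>R (1 - sqrt_lim x)"
    have sx: "star (sqrt_lim x) = sqrt_lim x"
      by (rule star_sqrt_lim[OF x]) (simp add: x_def star_diff star_scaleR h)
    have "norm (sqrt t *\<^sub>R 1 - k) = norm (sqrt t *\<^sub>R sqrt_lim x)" by (simp add: k_def algebra_simps)
    also have "\<dots> \<le> sqrt t" using norm_sqrt_lim[OF x] t by (simp add: mult_left_le)
    finally have "cpos k" using t sx
      by (auto simp: cpos_def k_def star_diff star_scaleR intro!: exI[of _ "sqrt t"])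
    moreover have "k * k = t *\<^sub>R ((1 - sqrt_lim x) * (1 - sqrt_lim x))" using t by (simp add: k_def)
    then have "k * k = h" using t0 unfolding sqrt_lim_square[OF x] by (simp add: x_def)
    moreover have "c * k = k * c" if "c * h = h * c" for c
    proof -
      have "c * x = x * c" using that by (simp add: x_def algebra_simps)
      then have "c * sqrt_lim x = sqrt_lim x * c" by (rule sqrt_lim_intertwine[OF x x])
      then show ?thesis by (simp add: k_def algebra_simps)
    qed
    ultimately show thesis by (rule that)
  qed
qed

text \<open>\<open>u + \<i> sqrt (1 - u\<^sup>2)\<close> is unitary.\<close>

lemma norm_one_minus_square:
  fixes u :: "'u::{cstar_algebra, real_normed_algebra_1}"
  assumes u: "star u = u" "norm u \<le> 1"
  shows "norm (1 - u * u) \<le> 1"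
proof -
  have uu: "norm (u * u) \<le> 1"
    using norm_mult_ineq[of u u] u(2) by (meson mult_le_one norm_ge_zero order_trans)
  define v where "v = 1 - sqrt_lim (u * u)"
  have v: "star v = v" using star_sqrt_lim[OF uu] u by (simp add: v_def star_diff star_mult)
  have vv: "v * v = 1 - u * u" unfolding v_def by (rule sqrt_lim_square[OF uu])
  have "u * sqrt_lim (u * u) = sqrt_lim (u * u) * u"
    by (rule sqrt_lim_intertwine[OF uu uu]) (simp add: mult.assoc)
  then have uv: "u * v = v * u" by (simp add: v_def algebra_simps)
  define w where "w = u + \<i> *\<^sub>C v"
  have sw: "star w = u - \<i> *\<^sub>C v"
    by (simp add: w_def star_add star_scaleC u v complex_vector.scale_minus_left)
  have "star w * w = u * u + v * v"
    unfolding sw by (simp add: w_def algebra_simps scaleC_algebra uv minus_one_scaleC)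
  then have "(norm w)\<^sup>2 = 1" using vv cstar_identity[of w] by simp
  then have nw: "norm w = 1" by (metis norm_ge_zero power2_eq_1_iff not_one_le_zero neg_0_le_iff_le zero_le_one order_antisym zero_neq_one)
  \<comment> \<open>\<open>v\<close> is the imaginary part of the norm one element \<open>w\<close>,
    hence a contraction, and \<open>v * v\<close> is the element to be estimated.\<close>
  have "2 * norm v = norm (w - star w)"
  proof -
    have "w - star w = 2 *\<^sub>R (\<i> *\<^sub>C v)" unfolding sw by (simp add: w_def scaleR_2)
    then show ?thesis by (simp add: norm_scaleC)
  qed
  also have "\<dots> \<le> 2" using norm_triangle_ineq4[of w "star w"] nw by simp
  finally have nv: "norm v \<le> 1" by simp
  have "norm (v * v) \<le> norm v * norm v" by (rule norm_mult_ineq)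
  also have "\<dots> \<le> 1" using nv by (simp add: mult_le_one)
  finally show ?thesis by (simp add: vv)
qed

text \<open>After normalizing k to u, the bound on \<open>1 - u * u\<close> says that
  \<open>(norm k)\<^sup>2\<close> serves as radius.\<close>

lemma cpos_square:
  assumes "star k = k"
  shows "cpos (k * k)"
proof (cases "k = 0")
  case False
  define u where "u = (1 / norm k) *\<^sub>R k"
  have k: "k * k = (norm k)\<^sup>2 *\<^sub>R (u * u)"
    using False by (simp add: u_def power2_eq_square)
  have "star u = u" "norm u \<le> 1" using False assms by (simp_all add: u_def star_scaleR)
  then have "norm (1 - u * u) \<le> 1" by (rule norm_one_minus_square)
  then have "norm ((norm k)\<^sup>2 *\<^sub>R (1 - u * u)) \<le> (norm k)\<^sup>2" by (simp add: mult_left_le)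
  then have "norm ((norm k)\<^sup>2 *\<^sub>R 1 - k * k) \<le> (norm k)\<^sup>2"
    unfolding k by (simp add: scaleR_right_diff_distrib)
  then show ?thesis using assms by (auto simp: cpos_def star_mult intro!: exI[of _ "(norm k)\<^sup>2"])
qed (simp add: cpos_zero)

text \<open>Let x and y be roots of h and s - h. They commute, so w = x + i y satisfies star w * w =
  s. As the real part of w, x has norm at most that of w, and h = x * x. The case s = 0 gives
  antisymmetry of the order.\<close>

lemma cpos_norm_le:
  assumes h: "cpos h" and sh: "cpos (s *\<^sub>R 1 - h)"
  shows "norm h \<le> \<bar>s\<bar>"
proof -
  from h obtain x where x: "cpos x" "x * x = h" "\<And>c. c * h = h * c \<Longrightarrow> c * x = x * c"
    by (rule cpos_sqrt) blast
  from sh obtain y where y: "cpos y" "y * y = s *\<^sub>R 1 - h"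
      "\<And>c. c * (s *\<^sub>R 1 - h) = (s *\<^sub>R 1 - h) * c \<Longrightarrow> c * y = y * c"
    by (rule cpos_sqrt) blast
  have "x * h = h * x" by (simp add: x(2)[symmetric] mult.assoc)
  then have xy: "x * y = y * x" by (intro y(3)) (simp add: algebra_simps)
  define w where "w = x + \<i> *\<^sub>C y"
  have sw: "star w = x - \<i> *\<^sub>C y"
    using cpos_star[OF x(1)] cpos_star[OF y(1)]
    by (simp add: w_def star_add star_scaleC complex_vector.scale_minus_left)
  have "star w * w = x * x + y * y"
    unfolding sw by (simp add: w_def algebra_simps scaleC_algebra xy minus_one_scaleC)
  then have nw: "(norm w)\<^sup>2 = \<bar>s\<bar>" using x(2) y(2) cstar_identity[of w] by simp
  have "2 * norm x = norm (w + star w)"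
    unfolding sw by (simp add: w_def flip: scaleR_2)
  also have "\<dots> \<le> 2 * norm w" using norm_triangle_ineq[of w "star w"] by simp
  finally have "norm x \<le> norm w" by simp
  then have "norm x * norm x \<le> norm w * norm w" by (intro mult_mono) auto
  with norm_mult_ineq[of x x] nw show ?thesis unfolding x(2) by (simp add: power2_eq_square)
qed

lemma cpos_antisym: "cpos h \<Longrightarrow> cpos (- h) \<Longrightarrow> h = 0"
  using cpos_norm_le[of h 0] by simp

text \<open>With d = p - q, both d * p * d and d * q * d are positive, and their sum vanishes
  because d * (p + q) = p * p - q * q = 0. So both are 0, their difference gives d * d * d = 0, and
  a self-adjoint nilpotent is 0.\<close>

lemma cpos_sqrt_unique:
  assumes p: "cpos p" and q: "cpos q" and pq: "p * q = q * p" and sq: "p * p = q * q"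
  shows "p = q"
proof -
  define d where "d = p - q"
  have sd: "star d = d" using p q by (simp add: d_def star_diff cpos_star)
  have conj_pos: "cpos (d * r * d)" if r: "cpos r" and rd: "d * r = r * d" for r
  proof -
    from r obtain k where k: "cpos k" "k * k = r" "\<And>c. c * r = r * c \<Longrightarrow> c * k = k * c"
      by (rule cpos_sqrt) blast
    have dk: "d * k = k * d" using rd by (rule k(3))
    have "star (k * d) = k * d" using dk k(1) sd by (simp add: star_mult cpos_star)
    then have "cpos ((k * d) * (k * d))" by (rule cpos_square)
    also have "(k * d) * (k * d) = (d * k) * (k * d)" by (simp only: dk)
    also have "\<dots> = d * (k * k) * d" by (simp only: mult.assoc)
    finally show ?thesis by (simp add: k(2))
  qed
  have 1: "cpos (d * p * d)" "cpos (d * q * d)"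
    by (rule conj_pos; use p q pq in \<open>simp add: d_def algebra_simps\<close>)+
  have "d * (p + q) = 0" using pq sq by (simp add: d_def algebra_simps)
  moreover have "d * p * d + d * q * d = d * (p + q) * d" by (simp add: algebra_simps)
  ultimately have "d * p * d + d * q * d = 0" by simp
  then have 2: "d * q * d = - (d * p * d)" by (simp add: eq_neg_iff_add_eq_0 add.commute)
  with 1 have "d * p * d = 0" by (intro cpos_antisym) auto
  with 2 have "d * p * d = 0" "d * q * d = 0" by simp_all
  then have "d * (p - q) * d = 0" by (simp add: algebra_simps)
  then have ddd: "d * d * d = 0" by (simp add: d_def)
  have "(d * d) * (d * d) = (d * d * d) * d" by (simp only: mult.assoc)
  then have "(d * d) * (d * d) = 0" using ddd by simp
  then have "d * d = 0" using selfadjoint_square_eq_0[of "d * d"] sd by (simp add: star_mult)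
  then have "d = 0" using sd selfadjoint_square_eq_0[of d] by simp
  then show ?thesis by (simp add: d_def)
qed

text \<open>The absolute value of a self-adjoint \<open>x\<close> with \<open>norm x \<le> M\<close>; it does not depend on \<open>M\<close>.\<close>

definition cabs :: "real \<Rightarrow> 'u::{cstar_algebra, real_normed_algebra_1} \<Rightarrow> 'u" where
  "cabs M x = M *\<^sub>R (1 - sqrt_lim (1 - (1 / M\<^sup>2) *\<^sub>R (x * x)))"

context
  fixes M :: real
  assumes M: "M > 0"
begin

lemma norm_cabs_arg:
  fixes x :: "'u::{cstar_algebra, real_normed_algebra_1}"
  assumes "star x = x" "norm x \<le> M"
  shows "norm (1 - (1 / M\<^sup>2) *\<^sub>R (x * x)) \<le> 1"
  using norm_one_minus_square[of "(1 / M) *\<^sub>R x"] assms M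
  by (simp add: star_scaleR power2_eq_square)

lemma cabs_cpos:
  assumes "star x = x" "norm x \<le> M"
  shows "cpos (cabs M x)"
proof -
  let ?x = "1 - (1 / M\<^sup>2) *\<^sub>R (x * x)"
  note n = norm_cabs_arg[OF assms]
  have "norm (M *\<^sub>R 1 - cabs M x) = norm (M *\<^sub>R sqrt_lim ?x)" by (simp add: cabs_def algebra_simps)
  also have "\<dots> \<le> M" using norm_sqrt_lim[OF n] M by (simp add: mult_left_le)
  moreover have "star (cabs M x) = cabs M x"
    using star_sqrt_lim[OF n] assms by (simp add: cabs_def star_diff star_scaleR star_mult)
  ultimately show ?thesis using M by (auto simp: cpos_def intro!: exI[of _ M])
qed

lemma cabs_square:
  assumes "star x = x" "norm x \<le> M"
  shows "cabs M x * cabs M x = x * x"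
  using sqrt_lim_square[OF norm_cabs_arg[OF assms]] M by (simp add: cabs_def power2_eq_square)

text \<open>The relation passes from x and y to their squares and then through the iteration to its
  limit. The common M is what makes both absolute values the same limit construction.\<close>

lemma cabs_intertwine:
  assumes "star x = x" "norm x \<le> M" "star y = y" "norm y \<le> M" "b * x = y * b"
  shows "b * cabs M x = cabs M y * b"
proof -
  have bx: "b * (x * x) = y * y * b"
  proof -
    have "b * (x * x) = (b * x) * x" by (simp only: mult.assoc)
    also have "\<dots> = y * (b * x)" using assms(5) by (simp add: mult.assoc)
    also have "\<dots> = y * y * b" using assms(5) by (simp add: mult.assoc)
    finally show ?thesis .
  qed
  have arg: "b * (1 - (1 / M\<^sup>2) *\<^sub>R (x * x)) = (1 - (1 / M\<^sup>2) *\<^sub>R (y * y)) * b"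
    unfolding left_diff_distrib right_diff_distrib mult_scaleR_left mult_scaleR_right bx by simp
  have "b * sqrt_lim (1 - (1 / M\<^sup>2) *\<^sub>R (x * x)) = sqrt_lim (1 - (1 / M\<^sup>2) *\<^sub>R (y * y)) * b"
    by (rule sqrt_lim_intertwine[OF norm_cabs_arg[OF assms(1,2)] norm_cabs_arg[OF assms(3,4)] arg])
  then show ?thesis
    unfolding cabs_def left_diff_distrib right_diff_distrib mult_scaleR_left mult_scaleR_right by simp
qed

lemma cabs_commute:
  assumes "star x = x" "norm x \<le> M"
  shows "x * cabs M x = cabs M x * x"
  by (rule cabs_intertwine) (use assms in auto)

lemma cabs_eq_self:
  assumes "cpos x" "norm x \<le> M"
  shows "cabs M x = x"
  using assms cpos_star[OF assms(1)]
  by (intro cpos_sqrt_unique[of "cabs M x" x]) (simp_all add: cabs_cpos cabs_square cabs_commute)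

text \<open>\<open>cabs\<close> depends only on the square of its argument, so this is the previous
  case for \<open>- x\<close>.\<close>

lemma cabs_eq_neg:
  assumes "cpos (- x)" "norm x \<le> M"
  shows "cabs M x = - x"
  using cabs_eq_self[of "- x"] assms by (simp add: cabs_def)

end

text \<open>Since h + c, with h = star b * b and c = b * star b, is half of a sum of two squares of
  self-adjoint elements, c is positive when -h is. Now star b intertwines c and h, hence also their
  absolute values c and -h. Thus star b * c = - (h * star b) = - (star b * c) vanishes, and so do c
  * c and c.\<close>

lemma cpos_neg_star_mult:
  fixes b :: "'u::{cstar_algebra, real_normed_algebra_1}"
  assumes "cpos (- (star b * b))"
  shows "b = 0"
proof -
  define c h where "c = b * star b" and "h = star b * b"
  define x y where "x = b + star b" and "y = \<i> *\<^sub>C (b - star b)"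
  have "star x = x" "star y = y"
    by (simp_all add: x_def y_def star_add star_diff star_star star_scaleC add.commute scaleC_algebra
        complex_vector.scale_minus_left)
  then have xy: "cpos (x * x + y * y)" by (intro cpos_add cpos_square)
  have "x * x + y * y = 2 *\<^sub>R (h + c)"
    unfolding x_def y_def h_def c_def
    by (simp add: distrib_left distrib_right left_diff_distrib right_diff_distrib scaleC_algebra
      minus_one_scaleC scaleR_2)
  with xy have "cpos (2 *\<^sub>R (h + c))" by simp
  from cpos_add[OF cpos_scaleR[OF _ this, of "1 / 2"] assms[folded h_def]]
  have c: "cpos c" by simp
  define M where "M = 1 + (norm b)\<^sup>2"
  have M: "M > 0" by (simp add: M_def add_pos_nonneg)
  have nM: "norm c \<le> M" "norm h \<le> M"
    using cstar_identity[of b] cstar_identity[of "star b"] by (simp_all add: M_def c_def h_def star_star)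
  have "star b * cabs M c = cabs M h * star b"
    using nM by (intro cabs_intertwine M) (auto simp: c_def h_def star_mult star_star mult.assoc)
  then have "star b * c = - (h * star b)"
    using cabs_eq_self[OF M c nM(1)] cabs_eq_neg[OF M assms[folded h_def] nM(2)] by simp
  moreover have "h * star b = star b * c" by (simp add: c_def h_def mult.assoc)
  ultimately have "star b * c = - (star b * c)" by simp
  then have "2 *\<^sub>R (star b * c) = 0" unfolding scaleR_2 by (metis add.right_inverse)
  then have "star b * c = 0" by simp
  then have "c * c = 0" unfolding c_def by (simp add: mult.assoc)
  then have "c = 0" using cpos_star[OF c] selfadjoint_square_eq_0[of c] by simp
  then show ?thesis using star_mult_self_eq_0[of "star b"] unfolding c_def star_star
    by (metis star_star star_zero)
qed

text \<open>Let n be the negative part of h = star a * a, half the difference of its absolute value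
  r and h, and let q be the root of r. From h * n = - (r * n), \<open>star (a * n) * (a * n)\<close>
  is minus the square of the self-adjoint q * n. By the previous lemma a * n = 0, so r * n and h * n
  vanish, whence n * n = 0 and h = r.\<close>

theorem cpos_star_mult: "cpos (star a * a)"
proof -
  define h where "h = star a * a"
  have sh: "star h = h" by (simp add: h_def star_mult star_star)
  define M where "M = 1 + norm h"
  have M: "M > 0" "norm h \<le> M" by (simp_all add: M_def add_pos_nonneg)
  define r where "r = cabs M h"
  have r: "cpos r" "r * r = h * h" "h * r = r * h"
    unfolding r_def using M sh by (simp_all add: cabs_cpos cabs_square cabs_commute)
  define n where "n = (1 / 2) *\<^sub>R (r - h)"
  have sn: "star n = n" using r sh by (simp add: n_def star_scaleR star_diff cpos_star)
  have hn: "h * n = - (r * n)" using r by (simp add: n_def algebra_simps)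
  from r(1) obtain q where q: "cpos q" "q * q = r" "\<And>c. c * r = r * c \<Longrightarrow> c * q = q * c"
    by (rule cpos_sqrt) blast
  have "n * r = r * n" using r(3) by (simp add: n_def algebra_simps)
  then have qn: "n * q = q * n" by (rule q(3))
  have sqn: "star (q * n) = q * n" using qn q(1) sn by (simp add: star_mult cpos_star)
  have "star (a * n) * (a * n) = n * (h * n)" by (simp add: star_mult sn h_def mult.assoc)
  also have "\<dots> = - (n * (q * q * n))" by (simp add: hn q(2))
  also have "n * (q * q * n) = (n * q) * (q * n)" by (simp only: mult.assoc)
  also have "\<dots> = (q * n) * (q * n)" by (simp only: qn)
  finally have an: "star (a * n) * (a * n) = - ((q * n) * (q * n))" .
  have "a * n = 0" by (rule cpos_neg_star_mult) (simp add: an cpos_square sqn)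
  then have "(q * n) * (q * n) = 0" using an by simp
  then have "q * n = 0" using sqn selfadjoint_square_eq_0[of "q * n"] by simp
  then have rn: "r * n = 0" by (simp add: q(2)[symmetric] mult.assoc)
  have "n * n = (1 / 2) *\<^sub>R (r * n - h * n)" by (simp add: n_def algebra_simps)
  then have "n * n = 0" using rn hn by simp
  then have "n = 0" using sn selfadjoint_square_eq_0[of n] by simp
  then have "r = h" by (simp add: n_def)
  then show ?thesis using r(1) by (simp add: h_def)
qed


section \<open>The positive cone of a C*-algebra\<close>

lemma pos_cone_star: "a \<in> pos_cone \<Longrightarrow> star a = a"
  by (auto simp: pos_cone_def star_mult star_star)

text \<open>The scalar part of a root of an element of A has square 0, so the root lies in A itself.
  Positivity in the unitization is therefore witnessed inside A.\<close>

lemma pos_cone_iff_cpos: "a \<in> pos_cone \<longleftrightarrow> cpos (uemb a)"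
proof
  assume "a \<in> pos_cone"
  then show "cpos (uemb a)" by (auto simp: pos_cone_def uemb_simps cpos_star_mult)
next
  assume "cpos (uemb a)"
  then obtain k where k: "cpos k" "k * k = uemb a" by (rule cpos_sqrt)
  then have "uscal k * uscal k = 0" by (metis uscal_mult uscal_uemb)
  then have ku: "uemb (upart k) = k" by (intro uemb_upart) simp
  have "uemb (star (upart k) * upart k) = uemb a"
    using k by (simp add: uemb_simps ku cpos_star)
  then show "a \<in> pos_cone" unfolding uemb_inj pos_cone_def by auto
qed

lemma pos_cone_star_mult: "star a * a \<in> pos_cone"
  by (simp add: pos_cone_def)

lemma pos_cone_mult_star: "a * star a \<in> pos_cone"
  using pos_cone_star_mult[of "star a"] by (simp add: star_star)

lemma pos_cone_zero: "0 \<in> pos_cone"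
  using pos_cone_star_mult[of 0] by simp

lemma pos_cone_add: "a \<in> pos_cone \<Longrightarrow> b \<in> pos_cone \<Longrightarrow> a + b \<in> pos_cone"
  by (simp add: pos_cone_iff_cpos uemb_simps cpos_add)

lemma pos_cone_scaleR: "0 \<le> r \<Longrightarrow> a \<in> pos_cone \<Longrightarrow> r *\<^sub>R a \<in> pos_cone"
  by (simp add: pos_cone_iff_cpos uemb_simps cpos_scaleR)

text \<open>The root k of M - c is taken in the unitization, but its product with y lies in the
  ideal A, and that product is the witness.\<close>

lemma pos_cone_norm_diff:
  assumes "star c = c" "norm c \<le> M"
  shows "M *\<^sub>R (star y * y) - star y * c * y \<in> pos_cone"
proof -
  have "star (uemb c) = uemb c" by (simp add: assms(1) flip: uemb_simps)
  then have "cpos (M *\<^sub>R 1 - uemb c)" using assms by (intro cpos_diff_norm) auto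
  then obtain k where k: "cpos k" "k * k = M *\<^sub>R 1 - uemb c" by (rule cpos_sqrt)
  let ?z = "upart (k * uemb y)"
  have z: "uemb ?z = k * uemb y" by (rule uemb_upart) (simp add: uscal_mult)
  have "uemb (star ?z * ?z) = star (uemb y) * (k * k) * uemb y"
    using cpos_star[OF k(1)] by (simp add: uemb_simps z star_mult mult.assoc)
  also have "\<dots> = uemb (M *\<^sub>R (star y * y) - star y * c * y)"
    by (simp add: k(2) uemb_simps algebra_simps)
  finally show ?thesis unfolding uemb_inj using pos_cone_star_mult[of ?z] by simp
qed

section \<open>Star-homomorphisms of C*-algebras are contractive\<close>

lemma star_homD:
  assumes "star_hom of_class of_class (\<gamma> :: 'a::cstar_algebra \<Rightarrow> 'b::cstar_algebra)"
  shows "\<gamma> (x + y) = \<gamma> x + \<gamma> y" "\<gamma> (x * y) = \<gamma> x * \<gamma> y" "\<gamma> (c *\<^sub>C x) = c *\<^sub>C \<gamma> x"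
    "\<gamma> (star x) = star (\<gamma> x)"
  using assms by (auto simp: star_hom_def of_class_def)

text \<open>\<open>star_hom\<close> is purely algebraic, yet the unital extension \<open>g\<close>
  preserves squares: it maps a root of \<open>(norm a)\<^sup>2\<close> minus
  \<open>star a * a\<close> to a self-adjoint root of the corresponding element for
  \<open>\<gamma> a\<close>. That element is therefore positive, which is the norm bound.\<close>

lemma star_hom_norm_le:
  assumes hom: "star_hom of_class of_class (\<gamma> :: 'a::cstar_algebra \<Rightarrow> 'b::cstar_algebra)"
  shows "norm (\<gamma> a) \<le> norm a"
proof -
  note h = star_homD[OF hom]
  define g where "g u = Unitz (\<gamma> (upart u)) (uscal u)" for u
  have g_mult: "g (u * v) = g u * g v" and g_star: "g (star u) = star (g u)" for u v
    by (simp_all add: g_def unitz_mult_defs h)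
  let ?M = "(norm a)\<^sup>2"
  have "star (uemb (star a * a)) = uemb (star a * a)"
    by (simp add: uemb_simps star_mult star_star)
  then have "cpos (?M *\<^sub>R 1 - uemb (star a * a))"
    by (intro cpos_diff_norm) (simp_all add: cstar_identity)
  then obtain k where k: "cpos k" "k * k = ?M *\<^sub>R 1 - uemb (star a * a)" by (rule cpos_sqrt)
  have "\<gamma> 0 = 0" using h(1)[of 0 0] by simp
  have gm: "\<gamma> (- x) = - \<gamma> x" for x
    using h(3)[of "-1" x] by (simp add: minus_one_scaleC)
  have "g k * g k = g (?M *\<^sub>R 1 - uemb (star a * a))" by (simp add: g_mult[symmetric] k(2))
  also have "\<dots> = ?M *\<^sub>R 1 - uemb (star (\<gamma> a) * \<gamma> a)"
    by (simp add: g_def unitz_mult_defs one_unitz_def uemb_def h gm)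
  finally have gk: "g k * g k = ?M *\<^sub>R 1 - uemb (star (\<gamma> a) * \<gamma> a)" .
  have "star (g k) = g k" using cpos_star[OF k(1)] by (simp flip: g_star)
  then have "cpos (?M *\<^sub>R 1 - uemb (star (\<gamma> a) * \<gamma> a))" unfolding gk[symmetric] by (rule cpos_square)
  then have "norm (uemb (star (\<gamma> a) * \<gamma> a)) \<le> \<bar>?M\<bar>"
    by (intro cpos_norm_le) (simp_all add: uemb_simps cpos_star_mult)
  then have "(norm (\<gamma> a))\<^sup>2 \<le> ?M" by (simp add: cstar_identity)
  then show ?thesis by (rule power2_le_imp_le) simp
qed


section \<open>Linear extension of a weight on a cone\<close>

text \<open>Instantiated twice, for the trace on \<open>pos_cone\<close> and for
  \<open>tau_tilde\<close> on \<open>vn_pos N\<close>. \<open>P_separate\<close> says that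
  differences of cone elements behave as independent real and imaginary parts; it takes the place of
  an involution.\<close>

locale weight_cone =
  fixes P :: "'a::complex_vector set" and \<phi> :: "'a \<Rightarrow> ennreal"
  assumes P_zero: "0 \<in> P"
    and P_add: "a \<in> P \<Longrightarrow> b \<in> P \<Longrightarrow> a + b \<in> P"
    and P_scale: "0 \<le> r \<Longrightarrow> a \<in> P \<Longrightarrow> r *\<^sub>R a \<in> P"
    and P_separate: "\<lbrakk>a \<in> P; b \<in> P; c \<in> P; d \<in> P; (a - b) + \<i> *\<^sub>C (c - d) = 0\<rbrakk> \<Longrightarrow> a = b \<and> c = d"
    and weight_add: "a \<in> P \<Longrightarrow> b \<in> P \<Longrightarrow> \<phi> (a + b) = \<phi> a + \<phi> b"
    and weight_scale: "0 \<le> r \<Longrightarrow> a \<in> P \<Longrightarrow> \<phi> (r *\<^sub>R a) = ennreal r * \<phi> a"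
begin

definition "fin = {q \<in> P. \<phi> q < \<infinity>}"
definition "wt q = enn2real (\<phi> q)"
definition "wdom = cspan fin"

lemma weight_zero: "\<phi> 0 = 0"
  using weight_scale[of 0 0] P_zero by simp

lemma finD: "q \<in> fin \<Longrightarrow> q \<in> P" "q \<in> fin \<Longrightarrow> \<phi> q = ennreal (wt q)"
  by (auto simp: fin_def wt_def less_top)

lemma wt_nonneg: "0 \<le> wt q"
  by (simp add: wt_def)

lemma fin_scale: "0 \<le> r \<Longrightarrow> q \<in> fin \<Longrightarrow> r *\<^sub>R q \<in> fin"
  by (auto simp: fin_def P_scale weight_scale ennreal_mult_less_top)

lemma pos_sum:
  assumes "finite I" "\<And>i. i \<in> I \<Longrightarrow> q i \<in> P"
  shows "(\<Sum>i\<in>I. q i) \<in> P \<and> \<phi> (\<Sum>i\<in>I. q i) = (\<Sum>i\<in>I. \<phi> (q i))"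
  using assms by (induction I rule: finite_induct) (auto simp: P_zero weight_zero P_add weight_add)

lemma fin_sum:
  assumes "finite I" "\<And>i. i \<in> I \<Longrightarrow> q i \<in> fin" "\<And>i. i \<in> I \<Longrightarrow> 0 \<le> r i"
  shows "(\<Sum>i\<in>I. r i *\<^sub>R q i) \<in> fin" "wt (\<Sum>i\<in>I. r i *\<^sub>R q i) = (\<Sum>i\<in>I. r i * wt (q i))"
proof -
  have P: "r i *\<^sub>R q i \<in> P" if "i \<in> I" for i using fin_scale[OF assms(3,2)[OF that]] finD by blast
  have "\<phi> (\<Sum>i\<in>I. r i *\<^sub>R q i) = (\<Sum>i\<in>I. \<phi> (r i *\<^sub>R q i))"
    using pos_sum[OF assms(1), of "\<lambda>i. r i *\<^sub>R q i"] P by blast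
  also have "\<dots> = (\<Sum>i\<in>I. ennreal (r i * wt (q i)))"
    by (intro sum.cong refl) (simp add: weight_scale finD assms ennreal_mult wt_nonneg)
  also have "\<dots> = ennreal (\<Sum>i\<in>I. r i * wt (q i))"
    by (intro sum_ennreal mult_nonneg_nonneg assms wt_nonneg)
  finally have *: "\<phi> (\<Sum>i\<in>I. r i *\<^sub>R q i) = ennreal (\<Sum>i\<in>I. r i * wt (q i))" .
  then show "(\<Sum>i\<in>I. r i *\<^sub>R q i) \<in> fin" using pos_sum[OF assms(1), of "\<lambda>i. r i *\<^sub>R q i"] P by (simp add: fin_def)
  show "wt (\<Sum>i\<in>I. r i *\<^sub>R q i) = (\<Sum>i\<in>I. r i * wt (q i))"
    unfolding wt_def[of "sum _ _"] * by (intro enn2real_ennreal sum_nonneg mult_nonneg_nonneg assms wt_nonneg)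
qed

lemma complex_four_parts:
  "c = complex_of_real (max (Re c) 0) - complex_of_real (max (- Re c) 0)
    + \<i> * (complex_of_real (max (Im c) 0) - complex_of_real (max (- Im c) 0))"
  by (auto simp: complex_eq_iff max_def)

lemma combination_four_parts:
  assumes "finite I" "\<And>i. i \<in> I \<Longrightarrow> q i \<in> fin"
  obtains x1 x2 x3 x4 where "x1 \<in> fin" "x2 \<in> fin" "x3 \<in> fin" "x4 \<in> fin"
    "(\<Sum>i\<in>I. c i *\<^sub>C q i) = (x1 - x2) + \<i> *\<^sub>C (x3 - x4)"
    "(\<Sum>i\<in>I. c i * wt (q i)) = complex_of_real (wt x1 - wt x2) + \<i> * complex_of_real (wt x3 - wt x4)"
proof -
  define x where "x f = (\<Sum>i\<in>I. max (f (c i)) 0 *\<^sub>R q i)" for f :: "complex \<Rightarrow> real"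
  have x: "x f \<in> fin" "wt (x f) = (\<Sum>i\<in>I. max (f (c i)) 0 * wt (q i))" for f
    unfolding x_def by (rule fin_sum; use assms in auto)+
  show thesis
  proof (rule that[of "x Re" "x (\<lambda>z. - Re z)" "x Im" "x (\<lambda>z. - Im z)"])
    have "c i *\<^sub>C q i = (max (Re (c i)) 0 *\<^sub>R q i - max (- Re (c i)) 0 *\<^sub>R q i)
        + \<i> *\<^sub>C (max (Im (c i)) 0 *\<^sub>R q i - max (- Im (c i)) 0 *\<^sub>R q i)" for i
      by (subst complex_four_parts) (simp only: scaleR_scaleC scaleC_algebra right_diff_distrib)
    then show "(\<Sum>i\<in>I. c i *\<^sub>C q i) = x Re - x (\<lambda>z. - Re z) + \<i> *\<^sub>C (x Im - x (\<lambda>z. - Im z))"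
      by (simp add: x_def sum.distrib sum_subtractf flip: complex_vector.scale_sum_right)
    have "c i * wt (q i) = complex_of_real (max (Re (c i)) 0 * wt (q i)) - complex_of_real (max (- Re (c i)) 0 * wt (q i))
        + \<i> * (complex_of_real (max (Im (c i)) 0 * wt (q i)) - complex_of_real (max (- Im (c i)) 0 * wt (q i)))" for i
      by (subst complex_four_parts[of "c i"]) (simp add: algebra_simps)
    then show "(\<Sum>i\<in>I. c i * wt (q i)) = complex_of_real (wt (x Re) - wt (x (\<lambda>z. - Re z)))
        + \<i> * complex_of_real (wt (x Im) - wt (x (\<lambda>z. - Im z)))"
      by (simp add: x sum.distrib sum_subtractf flip: sum_distrib_left)
  qed (rule x)+
qed

text \<open>This is the well-definedness of the linear extension: by \<open>P_separate\<close> the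
  four positive parts of a vanishing combination agree in pairs, and so do their weights.\<close>

lemma combination_zero:
  assumes "finite I" "\<And>i. i \<in> I \<Longrightarrow> q i \<in> fin" "(\<Sum>i\<in>I. c i *\<^sub>C q i) = 0"
  shows "(\<Sum>i\<in>I. c i * wt (q i)) = 0"
proof -
  obtain x1 x2 x3 x4 where x: "x1 \<in> fin" "x2 \<in> fin" "x3 \<in> fin" "x4 \<in> fin"
    "(\<Sum>i\<in>I. c i *\<^sub>C q i) = (x1 - x2) + \<i> *\<^sub>C (x3 - x4)"
    "(\<Sum>i\<in>I. c i * wt (q i)) = complex_of_real (wt x1 - wt x2) + \<i> * complex_of_real (wt x3 - wt x4)"
    by (rule combination_four_parts[OF assms(1,2), where c = c]) blast+
  have "x1 = x2 \<and> x3 = x4" using x assms(3) finD(1) by (intro P_separate) auto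
  then show ?thesis using x by simp
qed

lemma lin_ext_combination:
  assumes "finite I" "\<And>i. i \<in> I \<Longrightarrow> q i \<in> fin"
  shows "lin_ext P \<phi> (\<Sum>i\<in>I. c i *\<^sub>C q i) = (\<Sum>i\<in>I. c i * wt (q i))"
  unfolding lin_ext_def
proof (rule the_equality)
  \<comment> \<open>\<open>lin_ext\<close> sums over sets of cone elements, so the coefficients of a
    repeated value of q are collected over its fibre.\<close>
  define k where "k x = (\<Sum>i | i \<in> I \<and> q i = x. c i)" for x
  have 1: "(\<Sum>i\<in>I. c i *\<^sub>C q i) = (\<Sum>x\<in>q ` I. k x *\<^sub>C x)"
    unfolding k_def complex_vector.scale_sum_left
    by (subst sum.image_gen[OF assms(1), of _ q]) (intro sum.cong refl, auto)
  have 2: "(\<Sum>i\<in>I. c i * wt (q i)) = (\<Sum>x\<in>q ` I. k x * wt x)"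
    unfolding k_def sum_distrib_right
    by (subst sum.image_gen[OF assms(1), of _ q]) (intro sum.cong refl, auto)
  show "\<exists>F k. finite F \<and> F \<subseteq> {q \<in> P. \<phi> q < \<infinity>} \<and> (\<Sum>i\<in>I. c i *\<^sub>C q i) = (\<Sum>q\<in>F. k q *\<^sub>C q)
      \<and> (\<Sum>i\<in>I. c i * wt (q i)) = (\<Sum>q\<in>F. k q * complex_of_real (enn2real (\<phi> q)))"
    using 1 2 assms by (intro exI[of _ "q ` I"] exI[of _ k]) (auto simp: fin_def wt_def)
next
  fix d
  assume "\<exists>F k. finite F \<and> F \<subseteq> {q \<in> P. \<phi> q < \<infinity>} \<and> (\<Sum>i\<in>I. c i *\<^sub>C q i) = (\<Sum>q\<in>F. k q *\<^sub>C q)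
      \<and> d = (\<Sum>q\<in>F. k q * complex_of_real (enn2real (\<phi> q)))"
  then obtain F k where F: "finite F" "F \<subseteq> fin" "(\<Sum>i\<in>I. c i *\<^sub>C q i) = (\<Sum>q\<in>F. k q *\<^sub>C q)"
      "d = (\<Sum>q\<in>F. k q * wt q)"
    by (auto simp: fin_def wt_def)
  \<comment> \<open>Indexing by the disjoint sum turns the difference of two representations into
    one vanishing combination, even when they share elements.\<close>
  let ?q = "case_sum q id" and ?c = "case_sum c (\<lambda>x. - k x)"
  have "(\<Sum>i\<in>I <+> F. ?c i *\<^sub>C ?q i) = 0"
    by (subst sum.Plus) (use assms F in \<open>auto simp: sum_negf\<close>)
  then have "(\<Sum>i\<in>I <+> F. ?c i * wt (?q i)) = 0"
    by (intro combination_zero) (use assms F in auto)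
  then show "d = (\<Sum>i\<in>I. c i * wt (q i))"
    by (subst (asm) sum.Plus) (use assms F in \<open>auto simp: sum_negf\<close>)
qed

lemma wdomE:
  assumes "x \<in> wdom"
  obtains F k where "finite F" "F \<subseteq> fin" "x = (\<Sum>q\<in>F. k q *\<^sub>C q)"
  using assms unfolding wdom_def complex_vector.span_explicit by auto

lemma wdom_add: "x \<in> wdom \<Longrightarrow> y \<in> wdom \<Longrightarrow> x + y \<in> wdom"
  and wdom_scale: "x \<in> wdom \<Longrightarrow> c *\<^sub>C x \<in> wdom"
  and wdom_diff: "x \<in> wdom \<Longrightarrow> y \<in> wdom \<Longrightarrow> x - y \<in> wdom"
  and wdom_zero: "0 \<in> wdom"
  and wdom_fin: "q \<in> fin \<Longrightarrow> q \<in> wdom"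
  unfolding wdom_def
  by (simp_all add: complex_vector.span_add complex_vector.span_scale complex_vector.span_diff
      complex_vector.span_zero complex_vector.span_base)

lemma lin_ext_fin: "q \<in> fin \<Longrightarrow> lin_ext P \<phi> q = wt q"
  using lin_ext_combination[of "{()}" "\<lambda>_. q" "\<lambda>_. 1"] by (simp add: scaleC_one)

lemma lin_ext_add:
  assumes "x \<in> wdom" "y \<in> wdom"
  shows "lin_ext P \<phi> (x + y) = lin_ext P \<phi> x + lin_ext P \<phi> y"
proof -
  obtain F k where F: "finite F" "F \<subseteq> fin" "x = (\<Sum>q\<in>F. k q *\<^sub>C q)" using assms(1) by (rule wdomE)
  obtain G l where G: "finite G" "G \<subseteq> fin" "y = (\<Sum>q\<in>G. l q *\<^sub>C q)" using assms(2) by (rule wdomE)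
  let ?q = "case_sum id id" and ?c = "case_sum k l"
  have "x + y = (\<Sum>i\<in>F <+> G. ?c i *\<^sub>C ?q i)"
    by (subst sum.Plus) (use F G in auto)
  also have "lin_ext P \<phi> \<dots> = (\<Sum>i\<in>F <+> G. ?c i * wt (?q i))"
    by (intro lin_ext_combination) (use F G in auto)
  also have "\<dots> = (\<Sum>q\<in>F. k q * wt q) + (\<Sum>q\<in>G. l q * wt q)"
    by (subst sum.Plus) (use F G in auto)
  also have "\<dots> = lin_ext P \<phi> x + lin_ext P \<phi> y"
    unfolding F(3) G(3) using lin_ext_combination[of F id k] lin_ext_combination[of G id l] F G
    by (auto simp: subset_iff)
  finally show ?thesis .
qed

lemma lin_ext_scale:
  assumes "x \<in> wdom"
  shows "lin_ext P \<phi> (c *\<^sub>C x) = c * lin_ext P \<phi> x"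
proof -
  obtain F k where F: "finite F" "F \<subseteq> fin" "x = (\<Sum>q\<in>F. k q *\<^sub>C q)" using assms(1) by (rule wdomE)
  have "c *\<^sub>C x = (\<Sum>q\<in>F. (c * k q) *\<^sub>C q)"
    by (simp add: F complex_vector.scale_sum_right scaleC_scaleC)
  then have "lin_ext P \<phi> (c *\<^sub>C x) = (\<Sum>q\<in>F. (c * k q) * wt q)"
    using lin_ext_combination[of F id "\<lambda>q. c * k q"] F by (auto simp: subset_iff)
  also have "\<dots> = c * (\<Sum>q\<in>F. k q * wt q)" by (simp add: sum_distrib_left mult.assoc)
  also have "\<dots> = c * lin_ext P \<phi> x"
    unfolding F(3) using lin_ext_combination[of F id k] F by (auto simp: subset_iff)
  finally show ?thesis .
qed

lemma lin_ext_diff: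
  assumes "x \<in> wdom" "y \<in> wdom"
  shows "lin_ext P \<phi> (x - y) = lin_ext P \<phi> x - lin_ext P \<phi> y"
  using lin_ext_add[OF assms(1) wdom_scale[OF assms(2), of "-1"]] lin_ext_scale[OF assms(2), of "-1"]
  by (simp add: minus_one_scaleC)

lemma lin_ext_zero: "lin_ext P \<phi> 0 = 0"
  using lin_ext_scale[OF wdom_zero, of 0] by simp

text \<open>Comparing q with its decomposition into four finite parts gives q + x2 = x1, which
  bounds the weight of q. Polarization only shows membership in the span; this turns it into
  finiteness.\<close>

lemma fin_if_wdom:
  assumes "q \<in> P" "q \<in> wdom"
  shows "q \<in> fin"
proof -
  obtain F k where F: "finite F" "F \<subseteq> fin" "q = (\<Sum>q\<in>F. k q *\<^sub>C q)" using assms(2) by (rule wdomE)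
  obtain x1 x2 x3 x4 where x: "x1 \<in> fin" "x2 \<in> fin" "x3 \<in> fin" "x4 \<in> fin"
    "(\<Sum>i\<in>F. k i *\<^sub>C id i) = (x1 - x2) + \<i> *\<^sub>C (x3 - x4)"
    by (rule combination_four_parts[of F id, where c = k]) (use F in auto)
  then have "((q + x2) - x1) + \<i> *\<^sub>C (x4 - x3) = 0"
    using F(3) by (simp add: complex_vector.scale_right_diff_distrib)
  then have "q + x2 = x1" using x(1-4) finD(1) assms(1) P_add by (meson P_separate)
  then have "\<phi> q + \<phi> x2 = \<phi> x1" using weight_add[of q x2] assms(1) x finD(1) by auto
  moreover have "\<phi> x1 < \<infinity>" using x by (simp add: fin_def)
  moreover have "\<phi> q \<le> \<phi> q + \<phi> x2" by (rule add_increasing2) auto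
  ultimately show ?thesis using assms(1) by (simp add: fin_def)
qed

lemma fin_if_le:
  assumes "q \<in> P" "r \<in> fin" "r - q \<in> P"
  shows "q \<in> fin"
proof -
  have "\<phi> r = \<phi> q + \<phi> (r - q)" using weight_add[of q "r - q"] assms by simp
  then have "\<phi> q \<le> \<phi> r" by simp
  also have "\<dots> < \<infinity>" using assms(2) by (simp add: fin_def)
  finally show ?thesis using assms(1) by (simp add: fin_def)
qed

end


section \<open>Polarization and families of projections\<close>

lemma four_scaleC: "z + z + (z + z) = 4 *\<^sub>C (z :: 'a::complex_vector)"
proof -
  have "z + z + (z + z) = ((1 + 1) + (1 + 1)) *\<^sub>C z" by (simp only: scaleC_add_left scaleC_one)
  then show ?thesis by simp
qed

lemma polarization_star_mult:
  fixes x y :: "'a::cstar_algebra"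
  shows "star y * x = (1 / 4) *\<^sub>C ((star (y + x) * (y + x) - star (y - x) * (y - x))
    + \<i> *\<^sub>C (star (y - \<i> *\<^sub>C x) * (y - \<i> *\<^sub>C x) - star (y + \<i> *\<^sub>C x) * (y + \<i> *\<^sub>C x)))"
proof -
  have "((star (y + x) * (y + x) - star (y - x) * (y - x))
    + \<i> *\<^sub>C (star (y - \<i> *\<^sub>C x) * (y - \<i> *\<^sub>C x) - star (y + \<i> *\<^sub>C x) * (y + \<i> *\<^sub>C x)))
    = 4 *\<^sub>R (star y * x)"
    by (simp add: star_add star_diff star_scaleC distrib_left distrib_right left_diff_distrib
        right_diff_distrib scaleC_algebra complex_vector.scale_minus_left minus_one_scaleC scaleR_scaleC)
      (simp add: four_scaleC)
  then show ?thesis by (simp add: scaleR_scaleC scaleC_scaleC scaleC_one)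
qed

lemma polarization_mult_star:
  fixes x y :: "'a::cstar_algebra"
  shows "x * star y = (1 / 4) *\<^sub>C (((y + x) * star (y + x) - (y - x) * star (y - x))
    + \<i> *\<^sub>C ((y - \<i> *\<^sub>C x) * star (y - \<i> *\<^sub>C x) - (y + \<i> *\<^sub>C x) * star (y + \<i> *\<^sub>C x)))"
proof -
  have "(((y + x) * star (y + x) - (y - x) * star (y - x))
    + \<i> *\<^sub>C ((y - \<i> *\<^sub>C x) * star (y - \<i> *\<^sub>C x) - (y + \<i> *\<^sub>C x) * star (y + \<i> *\<^sub>C x)))
    = 4 *\<^sub>R (x * star y)"
    by (simp add: star_add star_diff star_scaleC distrib_left distrib_right left_diff_distrib
        right_diff_distrib scaleC_algebra complex_vector.scale_minus_left minus_one_scaleC scaleR_scaleC)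
      (simp add: four_scaleC)
  then show ?thesis by (simp add: scaleR_scaleC scaleC_scaleC scaleC_one)
qed

lemma pos_cone_sum: "(\<And>i. i \<in> I \<Longrightarrow> q i \<in> pos_cone) \<Longrightarrow> (\<Sum>i\<in>I. q i) \<in> pos_cone"
  by (induction I rule: infinite_finite_induct) (auto simp: pos_cone_zero pos_cone_add)

lemma pos_cone_antisym:
  assumes "a \<in> pos_cone" "- a \<in> pos_cone"
  shows "a = 0"
  using assms cpos_antisym[of "uemb a"] uemb_simps(3)[of 0 a] uemb_inj[of a 0]
  by (simp add: pos_cone_iff_cpos uemb_simps(7))

text \<open>The remaining summands add up to minus the j-th one. Their sum is positive, and
  antisymmetry leaves only 0.\<close>

lemma sum_star_mult_eq_0:
  assumes "finite I" "(\<Sum>i\<in>I. star (a i) * a i) = 0" "j \<in> I"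
  shows "a j = 0"
proof -
  have "star (a j) * a j + (\<Sum>i\<in>I - {j}. star (a i) * a i) = 0"
    using assms(2) sum.remove[OF assms(1,3), of "\<lambda>i. star (a i) * a i"] by simp
  then have "- (star (a j) * a j) = (\<Sum>i\<in>I - {j}. star (a i) * a i)"
    by (simp add: minus_unique)
  moreover have "(\<Sum>i\<in>I - {j}. star (a i) * a i) \<in> pos_cone"
    by (intro pos_cone_sum pos_cone_star_mult)
  ultimately have "star (a j) * a j = 0" by (intro pos_cone_antisym) (auto simp: pos_cone_star_mult)
  then show ?thesis by (simp add: star_mult_self_eq_0)
qed

text \<open>The Cuntz-Krieger relations do not state that the range projections of edges with one
  source are orthogonal; it follows because their sum p is a projection. The star squares of q i - q
  i * p add up to p - p * p - p * p + p * p * p = 0. Those of q j * q i add up to q i over all j,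
  which the term j = i already exhausts.\<close>

lemma sum_projections:
  fixes q :: "'i \<Rightarrow> 'a::cstar_algebra"
  assumes fin: "finite I" and q: "\<And>i. i \<in> I \<Longrightarrow> star (q i) = q i" "\<And>i. i \<in> I \<Longrightarrow> q i * q i = q i"
    and p: "p = (\<Sum>i\<in>I. q i)" "p * p = p" and i: "i \<in> I"
  shows "p * q i = q i" "j \<in> I \<Longrightarrow> j \<noteq> i \<Longrightarrow> q j * q i = 0"
proof -
  have sp: "star p = p" unfolding p(1) by (simp add: star_sum q)
  have "(\<Sum>i\<in>I. star (q i - q i * p) * (q i - q i * p)) = (\<Sum>i\<in>I. q i - p * q i - q i * p + p * q i * p)"
  proof (rule sum.cong)
    fix i assume i: "i \<in> I"
    have "q i * (q i * p) = q i * p" using q(2)[OF i] by (simp flip: mult.assoc)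
    then show "star (q i - q i * p) * (q i - q i * p) = q i - p * q i - q i * p + p * q i * p"
      by (simp add: star_diff star_mult q i sp algebra_simps)
  qed simp
  also have "\<dots> = p - p * p - p * p + p * p * p"
    unfolding sum.distrib sum_subtractf sum_distrib_left[symmetric] sum_distrib_right[symmetric] p(1)[symmetric] ..
  also have "\<dots> = 0" by (simp add: p(2))
  finally have "q i - q i * p = 0" by (rule sum_star_mult_eq_0[OF fin _ i])
  then have "star (q i * p) = star (q i)" by simp
  then show pq: "p * q i = q i" by (simp add: star_mult sp q i)
  have "(\<Sum>j\<in>I. star (q j * q i) * (q j * q i)) = (\<Sum>j\<in>I. q i * q j * q i)"
  proof (rule sum.cong)
    fix j assume j: "j \<in> I"
    have "q j * (q j * q i) = q j * q i" using q(2)[OF j] by (simp flip: mult.assoc)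
    then show "star (q j * q i) * (q j * q i) = q i * q j * q i"
      by (simp add: star_mult q i j mult.assoc)
  qed simp
  also have "\<dots> = q i * p * q i"
    unfolding sum_distrib_left[symmetric] sum_distrib_right[symmetric] p(1)[symmetric] ..
  also have "\<dots> = q i" by (simp add: mult.assoc pq q i)
  finally have "(\<Sum>j\<in>I - {i}. star (q j * q i) * (q j * q i)) + star (q i * q i) * (q i * q i) = q i"
    using fin i by (simp add: sum.remove[of I i] add.commute)
  then have "(\<Sum>j\<in>I - {i}. star (q j * q i) * (q j * q i)) = 0" by (simp add: q i)
  then show "q j * q i = 0" if "j \<in> I" "j \<noteq> i"
    using sum_star_mult_eq_0[of "I - {i}" "\<lambda>j. q j * q i" j] fin that by simp
qed


section \<open>Graph C*-algebras\<close>

lemma bounded_linear_scaleC_left: "bounded_linear (\<lambda>c. c *\<^sub>C (x :: 'a::complex_normed_vector))"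
  by (rule bounded_linear_intro[where K = "norm x"])
    (simp_all add: scaleC_add_left norm_scaleC scaleR_scaleC scaleC_scaleC scaleR_conv_of_real)

lemma has_integral_cis_multiple:
  assumes "k \<in> \<int>" "k \<noteq> 0"
  shows "((\<lambda>\<theta>. cis (k * \<theta>)) has_integral 0) {0..2 * pi}"
proof -
  have "((\<lambda>\<theta>. cis (k * \<theta>)) has_integral
      cis (k * (2 * pi)) / (\<i> * k) - cis (k * 0) / (\<i> * k)) {0..2 * pi}"
  proof (rule fundamental_theorem_of_calculus)
    fix \<theta> :: real
    show "((\<lambda>\<theta>. cis (k * \<theta>) / (\<i> * k)) has_vector_derivative cis (k * \<theta>)) (at \<theta> within {0..2 * pi})"
      unfolding has_vector_derivative_def using assms(2)
      by (auto intro!: derivative_eq_intros ext simp: scaleR_conv_of_real) (simp add: algebra_simps)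
  qed simp
  moreover have "cis (k * (2 * pi)) = 1" using cis_multiple_2pi[OF assms(1)] by (simp add: mult_ac)
  ultimately show ?thesis by simp
qed

text \<open>A copy of \<open>'a\<close> inside \<open>'a \<times> real\<close>, to which the universal property applies.\<close>

definition cs_copy :: "('a::cstar_algebra \<times> real) cstar_record" where
  "cs_copy = \<lparr>cs_carrier = UNIV \<times> {0}, cs_zero = (0, 0), cs_add = (\<lambda>x y. (fst x + fst y, 0)),
    cs_mult = (\<lambda>x y. (fst x * fst y, 0)), cs_scale = (\<lambda>c x. (c *\<^sub>C fst x, 0)),
    cs_star = (\<lambda>x. (star (fst x), 0)), cs_norm = (\<lambda>x. norm (fst x))\<rparr>"

lemma cstar_structure_cs_copy: "cstar_structure (cs_copy :: ('a::cstar_algebra \<times> real) cstar_record)"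
proof -
  have compl: "\<exists>l. (\<lambda>n. norm (fst (\<sigma> n) - l)) \<longlonglongrightarrow> 0"
    if "\<And>\<epsilon>. 0 < \<epsilon> \<Longrightarrow> \<exists>N. \<forall>m\<ge>N. \<forall>n\<ge>N. norm (fst (\<sigma> m) - fst (\<sigma> n)) < \<epsilon>"
    for \<sigma> :: "nat \<Rightarrow> 'a \<times> real"
  proof -
    have "Cauchy (\<lambda>n. fst (\<sigma> n))" using that by (auto simp: Cauchy_def dist_norm)
    then obtain l where "(\<lambda>n. fst (\<sigma> n)) \<longlonglongrightarrow> l" by (auto simp: Cauchy_convergent_iff convergent_def)
    then show ?thesis using LIM_zero tendsto_norm_zero by blast
  qed
  show ?thesis
    by unfold_locales
      (use compl in \<open>auto simp: cs_copy_def minus_one_scaleC algebra_simps scaleC_add_right scaleC_add_left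
        scaleC_scaleC scaleC_one mult_scaleC_left mult_scaleC_right star_star star_add star_scaleC
        star_mult norm_scaleC norm_triangle_ineq norm_mult_ineq cstar_identity\<close>)
qed

lemma fold_cs_copy:
  assumes "finite A"
  shows "Finite_Set.fold (\<lambda>e. cs_add cs_copy (g e)) (cs_zero cs_copy) A = (\<Sum>e\<in>A. fst (g e), 0)"
proof -
  interpret comp_fun_commute "\<lambda>e. cs_add cs_copy (g e)"
    by unfold_locales (auto simp: cs_copy_def fun_eq_iff algebra_simps)
  show ?thesis using assms
  proof (induction A rule: finite_induct)
    case (insert x F)
    then show ?case by (simp only: fold_insert subset_UNIV sum.insert not_False_eq_True) (simp add: cs_copy_def)
  qed (simp add: cs_copy_def)
qed

locale graph_algebra = wf_digraph E for E :: "('v, 'e) pre_digraph" +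
  fixes p :: "'v \<Rightarrow> 'a::cstar_algebra" and S :: "'e \<Rightarrow> 'a"
  assumes locally_finite: "locally_finite_graph E"
    and no_source: "no_sources E"
    and graph_cstar: "is_graph_cstar_algebra E p S"
begin

lemma CK: "cuntz_krieger_family E of_class p S"
  using graph_cstar by (simp add: is_graph_cstar_algebra_def)

lemma p_star [simp]: "v \<in> verts E \<Longrightarrow> star (p v) = p v"
  and p_idem [simp]: "v \<in> verts E \<Longrightarrow> p v * p v = p v"
  and p_orth: "v \<in> verts E \<Longrightarrow> w \<in> verts E \<Longrightarrow> v \<noteq> w \<Longrightarrow> p v * p w = 0"
  and S_partial_isometry: "e \<in> arcs E \<Longrightarrow> S e * star (S e) * S e = S e"
  and star_S_S: "e \<in> arcs E \<Longrightarrow> star (S e) * S e = p (head E e)"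
  using CK by (auto simp: cuntz_krieger_family_def of_class_def)

lemma p_eq_sum_out_arcs: "v \<in> verts E \<Longrightarrow> out_arcs E v \<noteq> {} \<Longrightarrow> p v = (\<Sum>e\<in>out_arcs E v. S e * star (S e))"
  using CK by (auto simp: cuntz_krieger_family_def of_class_def sum.eq_fold comp_def)

lemma S_p: "e \<in> arcs E \<Longrightarrow> S e * p (head E e) = S e"
  by (simp add: star_S_S[symmetric] S_partial_isometry flip: mult.assoc)

lemma range_projections:
  assumes e: "e \<in> arcs E"
  shows "p (tail E e) * (S e * star (S e)) = S e * star (S e)"
    "f \<in> arcs E \<Longrightarrow> tail E f = tail E e \<Longrightarrow> f \<noteq> e \<Longrightarrow> (S f * star (S f)) * (S e * star (S e)) = 0"
proof -
  let ?v = "tail E e" and ?q = "\<lambda>e. S e * star (S e)"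
  have v: "?v \<in> verts E" using e by simp
  have fin: "finite (out_arcs E ?v)" using locally_finite v by (auto simp: locally_finite_graph_def)
  have q: "star (?q f) = ?q f" "?q f * ?q f = ?q f" if "f \<in> out_arcs E ?v" for f
    using that S_partial_isometry[of f] by (auto simp: star_mult star_star simp flip: mult.assoc)
  have "out_arcs E ?v \<noteq> {}" using e by auto
  then have p: "p ?v = (\<Sum>f\<in>out_arcs E ?v. ?q f)" by (rule p_eq_sum_out_arcs[OF v])
  from sum_projections[OF fin q p p_idem[OF v]] e
  show "p ?v * ?q e = ?q e"
    "f \<in> arcs E \<Longrightarrow> tail E f = tail E e \<Longrightarrow> f \<noteq> e \<Longrightarrow> ?q f * ?q e = 0"
    by auto
qed

lemma p_S:
  assumes "e \<in> arcs E"
  shows "p (tail E e) * S e = S e"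
proof -
  have "p (tail E e) * S e = p (tail E e) * (S e * star (S e)) * S e"
    using S_partial_isometry[OF assms] by (simp add: mult.assoc)
  also have "\<dots> = S e" by (simp add: range_projections assms S_partial_isometry)
  finally show ?thesis .
qed

lemma star_S_p: "e \<in> arcs E \<Longrightarrow> star (S e) * p (tail E e) = star (S e)"
  using arg_cong[OF p_S[of e], of star] by (simp add: star_mult)

lemma S_orth:
  assumes "e \<in> arcs E" "f \<in> arcs E" "e \<noteq> f"
  shows "star (S e) * S f = 0"
proof (cases "tail E e = tail E f")
  case True
  have "star (S e) * S f = star (S e) * (S e * star (S e)) * (S f * star (S f)) * S f"
    using S_partial_isometry[OF assms(2)] arg_cong[OF S_partial_isometry[OF assms(1)], of star]
    by (simp add: star_mult star_star mult.assoc)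
  also have "\<dots> = star (S e) * ((S e * star (S e)) * (S f * star (S f))) * S f" by (simp only: mult.assoc)
  also have "\<dots> = 0" by (simp only: range_projections(2)[OF assms(2,1) True assms(3)] mult_zero_left mult_zero_right)
  finally show ?thesis .
next
  case False
  have "star (S e) * S f = (star (S e) * p (tail E e)) * (p (tail E f) * S f)"
    by (simp only: star_S_p p_S assms)
  also have "\<dots> = star (S e) * (p (tail E e) * p (tail E f)) * S f" by (simp only: mult.assoc)
  also have "\<dots> = 0" using assms False by (simp add: p_orth)
  finally show ?thesis .
qed

subsection \<open>The gauge action\<close>

text \<open>Rescaling each \<open>S e\<close> by z preserves the relations, because z cancels
  against its conjugate in both \<open>S e * star (S e)\<close> and \<open>star (S e) * S e\<close>.
  The universal property then yields the homomorphism.\<close>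

lemma gauge_hom_exists:
  assumes z: "cmod z = 1"
  shows "\<exists>\<gamma>. star_hom of_class of_class \<gamma> \<and> (\<forall>v\<in>verts E. \<gamma> (p v) = p v) \<and> (\<forall>e\<in>arcs E. \<gamma> (S e) = z *\<^sub>C S e)"
proof -
  have zz: "cnj z * z = 1" using z complex_norm_square[of z] by (simp add: mult.commute)
  have fin: "finite (out_arcs E v)" if "v \<in> verts E" for v
    using locally_finite that by (auto simp: locally_finite_graph_def)
  have "cuntz_krieger_family E cs_copy (\<lambda>v. (p v, 0)) (\<lambda>e. (z *\<^sub>C S e, 0))"
    unfolding cuntz_krieger_family_def
  proof (intro conjI ballI impI)
    fix v assume v: "v \<in> verts E" "out_arcs E v \<noteq> {}"
    have "(\<Sum>e\<in>out_arcs E v. z *\<^sub>C S e * star (z *\<^sub>C S e)) = (\<Sum>e\<in>out_arcs E v. S e * star (S e))"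
      by (simp add: star_scaleC scaleC_algebra zz scaleC_one mult.commute[of z])
    then show "(p v, 0) = Finite_Set.fold (\<lambda>e. cs_add cs_copy (cs_mult cs_copy (z *\<^sub>C S e, 0)
        (cs_star cs_copy (z *\<^sub>C S e, 0)))) (cs_zero cs_copy) (out_arcs E v)"
      by (simp add: fold_cs_copy[OF fin[OF v(1)]] p_eq_sum_out_arcs[OF v]) (simp add: cs_copy_def)
  qed (auto simp: cs_copy_def p_orth star_scaleC scaleC_algebra S_partial_isometry star_S_S zz
      mult.assoc[of z] scaleC_one mult.commute[of z])
  moreover have "\<forall>(B :: ('a \<times> real) cstar_record) q T. cstar_structure B \<and> cuntz_krieger_family E B q T \<longrightarrow>
      (\<exists>\<pi>. star_hom of_class B \<pi> \<and> (\<forall>v\<in>verts E. \<pi> (p v) = q v) \<and> (\<forall>e\<in>arcs E. \<pi> (S e) = T e))"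
    using graph_cstar unfolding is_graph_cstar_algebra_def by (elim conjE)
  ultimately obtain \<pi> where \<pi>: "star_hom of_class (cs_copy :: ('a \<times> real) cstar_record) \<pi>"
      "\<forall>v\<in>verts E. \<pi> (p v) = (p v, 0)" "\<forall>e\<in>arcs E. \<pi> (S e) = (z *\<^sub>C S e, 0)"
    using cstar_structure_cs_copy by blast
  have "star_hom of_class of_class (fst \<circ> \<pi>)"
    using \<pi>(1) by (simp add: star_hom_def of_class_def cs_copy_def)
  then show ?thesis using \<pi>(2,3) by (intro exI[of _ "fst \<circ> \<pi>"]) simp
qed

text \<open>Both maps are contractive, so the set on which they agree is a closed star-subalgebra
  containing the generators.\<close>

lemma gauge_hom_unique:
  assumes "star_hom of_class of_class \<gamma>" "star_hom of_class of_class (\<delta> :: 'a \<Rightarrow> 'a)"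
    and "\<And>v. v \<in> verts E \<Longrightarrow> \<gamma> (p v) = \<delta> (p v)" "\<And>e. e \<in> arcs E \<Longrightarrow> \<gamma> (S e) = \<delta> (S e)"
  shows "\<gamma> = \<delta>"
proof -
  have cont: "continuous_on UNIV \<eta>" if "star_hom of_class of_class \<eta>" for \<eta> :: "'a \<Rightarrow> 'a"
  proof -
    have "bounded_linear \<eta>"
      by (rule bounded_linear_intro[where K = 1])
        (simp_all add: star_homD[OF that] scaleR_scaleC star_hom_norm_le[OF that])
    then show ?thesis by (rule linear_continuous_on)
  qed
  let ?M = "{x. \<gamma> x = \<delta> x}"
  note h = star_homD[OF assms(1)] star_homD[OF assms(2)]
  have "closed ?M" using cont[OF assms(1)] cont[OF assms(2)] by (rule closed_Collect_eq)
  moreover have "0 \<in> ?M" using h(3)[of 0 0] h(7)[of 0 0] by simp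
  ultimately have "(\<lambda>M. closed M \<and> 0 \<in> M \<and> (\<forall>x\<in>M. \<forall>y\<in>M. x + y \<in> M \<and> x * y \<in> M)
         \<and> (\<forall>c. \<forall>x\<in>M. c *\<^sub>C x \<in> M) \<and> (\<forall>x\<in>M. star x \<in> M)) hull (p ` verts E \<union> S ` arcs E) \<subseteq> ?M"
    using assms(3,4) by (intro hull_minimal) (auto simp: h)
  then show ?thesis using graph_cstar by (auto simp: is_graph_cstar_algebra_def fun_eq_iff)
qed

definition "gam \<theta> = gauge_action E p S (cis \<theta>)"

lemma gam_props:
  "star_hom of_class of_class (gam \<theta>) \<and> (\<forall>v\<in>verts E. gam \<theta> (p v) = p v)
    \<and> (\<forall>e\<in>arcs E. gam \<theta> (S e) = cis \<theta> *\<^sub>C S e)"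
proof -
  let ?P = "\<lambda>\<gamma>. star_hom of_class of_class \<gamma> \<and> (\<forall>v\<in>verts E. \<gamma> (p v) = p v)
    \<and> (\<forall>e\<in>arcs E. \<gamma> (S e) = cis \<theta> *\<^sub>C S e)"
  have "\<exists>\<gamma>. ?P \<gamma>" by (rule gauge_hom_exists) simp
  then have "\<exists>!\<gamma>. ?P \<gamma>"
  proof (rule ex_ex1I)
    fix \<gamma> \<delta> assume "?P \<gamma>" "?P \<delta>"
    then show "\<gamma> = \<delta>" by (intro gauge_hom_unique) auto
  qed
  from theI'[OF this] show ?thesis unfolding gam_def gauge_action_def .
qed

lemma gam_hom: "star_hom of_class of_class (gam \<theta>)"
  using gam_props by blast

lemmas gam_simps = star_homD[OF gam_hom]

lemma gam_zero: "gam \<theta> 0 = 0"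
  using gam_simps(3)[of \<theta> 0 0] by simp

lemma gam_gen: "v \<in> verts E \<Longrightarrow> gam \<theta> (p v) = p v" "e \<in> arcs E \<Longrightarrow> gam \<theta> (S e) = cis \<theta> *\<^sub>C S e"
  using gam_props by auto

subsection \<open>Paths\<close>

abbreviation "pe \<equiv> path_elem p S"

lemma in_paths_iff: "(v, es) \<in> paths E \<longleftrightarrow> (\<exists>w. awalk v es w)"
  by (simp add: paths_def)

lemma path_range_eq: "awalk v es w \<Longrightarrow> path_range E (v, es) = w"
  by (simp add: path_range_def)

lemma pe_Nil [simp]: "pe (v, []) = p v"
  by (simp add: path_elem_def)

lemma pe_Cons:
  assumes "awalk v (e # es) w"
  shows "pe (v, e # es) = S e * pe (head E e, es)"
  using assms by (cases es) (auto simp: path_elem_def awalk_Cons_iff S_p)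

lemma pe_left: "awalk v es w \<Longrightarrow> p v * pe (v, es) = pe (v, es)"
  by (cases es) (auto simp: awalk_Nil_iff pe_Cons awalk_Cons_iff p_S simp flip: mult.assoc)

lemma pe_right: "awalk v es w \<Longrightarrow> pe (v, es) * p w = pe (v, es)"
  by (induction es arbitrary: v) (auto simp: awalk_Nil_iff pe_Cons awalk_Cons_iff mult.assoc)

lemma pe_isometry: "awalk v es w \<Longrightarrow> star (pe (v, es)) * pe (v, es) = p w"
proof (induction es arbitrary: v)
  case (Cons e es)
  then have e: "e \<in> arcs E" "awalk (head E e) es w" by (auto simp: awalk_Cons_iff)
  have "star (pe (v, e # es)) * pe (v, e # es)
      = star (pe (head E e, es)) * ((star (S e) * S e) * pe (head E e, es))"
    by (simp add: pe_Cons[OF Cons.prems] star_mult mult.assoc)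
  then show ?case using e Cons.IH[OF e(2)] by (simp add: star_S_S pe_left)
qed (simp add: awalk_Nil_iff)

lemma pe_append:
  "awalk v es w \<Longrightarrow> awalk w fs u \<Longrightarrow> pe (v, es @ fs) = pe (v, es) * pe (w, fs)"
proof (induction es arbitrary: v)
  case Nil
  then show ?case by (auto simp: awalk_Nil_iff pe_left)
next
  case (Cons e es)
  then have e: "awalk (head E e) es w" by (auto simp: awalk_Cons_iff)
  have "awalk v (e # es @ fs) u" using awalk_appendI[OF Cons.prems] by simp
  then show ?case using Cons.IH[OF e Cons.prems(2)]
    by (simp add: pe_Cons[OF Cons.prems(1)] pe_Cons mult.assoc)
qed

lemma pe_orth:
  "awalk v es w \<Longrightarrow> awalk v' es' w' \<Longrightarrow> length es = length es' \<Longrightarrow> (v, es) \<noteq> (v', es')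
    \<Longrightarrow> star (pe (v, es)) * pe (v', es') = 0"
proof (induction es arbitrary: v v' es')
  case Nil
  then show ?case by (auto simp: awalk_Nil_iff p_orth)
next
  case (Cons e es)
  then obtain e' fs where es': "es' = e' # fs" by (cases es') auto
  have a: "e \<in> arcs E" "awalk (head E e) es w" "e' \<in> arcs E" "awalk (head E e') fs w'"
    "v = tail E e" "v' = tail E e'"
    using Cons.prems by (auto simp: es' awalk_Cons_iff)
  have eq: "star (pe (v, e # es)) * pe (v', e' # fs)
      = star (pe (head E e, es)) * ((star (S e) * S e') * pe (head E e', fs))"
    using Cons.prems by (simp add: pe_Cons es' star_mult mult.assoc)
  show ?case
  proof (cases "e = e'")
    case True
    then have "star (pe (head E e, es)) * pe (head E e', fs) = 0"
      using Cons.prems a es' by (intro Cons.IH) auto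
    then show ?thesis using True a eq by (simp add: es' star_S_S pe_left)
  next
    case False
    then show ?thesis using eq a by (simp add: es' S_orth)
  qed
qed

text \<open>Cutting the longer path at the length of the shorter one leaves two paths of equal
  length, for which \<open>pe_isometry\<close> or \<open>pe_orth\<close> decides.\<close>

lemma star_pe_mult:
  assumes "awalk v es w" "awalk v' es' w'" "length es \<le> length es'"
  shows "star (pe (v, es)) * pe (v', es') = 0
    \<or> (\<exists>fs. v' = v \<and> es' = es @ fs \<and> awalk w fs w' \<and> star (pe (v, es)) * pe (v', es') = pe (w, fs))"
proof -
  let ?gs = "take (length es) es'" and ?fs = "drop (length es) es'"
  obtain u where u: "awalk v' ?gs u" "awalk u ?fs w'"
    using assms(2) awalk_append_iff[of v' ?gs ?fs w'] by auto
  have eq: "star (pe (v, es)) * pe (v', es') = (star (pe (v, es)) * pe (v', ?gs)) * pe (u, ?fs)"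
    using pe_append[OF u] by (simp add: mult.assoc)
  show ?thesis
  proof (cases "(v, es) = (v', ?gs)")
    case True
    then have "u = w" using path_range_eq[OF u(1)] path_range_eq[OF assms(1)] by simp
    then have "star (pe (v, es)) * pe (v', es') = pe (w, ?fs)"
      using eq True pe_isometry[OF assms(1)] u pe_left by simp
    moreover have "es' = es @ ?fs" "v' = v" using True by (metis append_take_drop_id Pair_inject)+
    ultimately show ?thesis using u(2) \<open>u = w\<close> by blast
  next
    case False
    then have "star (pe (v, es)) * pe (v', ?gs) = 0" using assms u by (intro pe_orth) auto
    then show ?thesis using eq by simp
  qed
qed

lemma gam_pe: "awalk v es w \<Longrightarrow> gam \<theta> (pe (v, es)) = cis (real (length es) * \<theta>) *\<^sub>C pe (v, es)"
proof (induction es arbitrary: v)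
  case (Cons e es)
  then have "e \<in> arcs E" "gam \<theta> (pe (head E e, es)) = cis (real (length es) * \<theta>) *\<^sub>C pe (head E e, es)"
    by (auto simp: awalk_Cons_iff)
  then show ?case
    by (simp add: pe_Cons[OF Cons.prems] gam_simps gam_gen scaleC_algebra cis_mult algebra_simps)
qed (simp add: awalk_Nil_iff gam_gen scaleC_one)

subsection \<open>The dense subalgebra\<close>

abbreviation "Ac \<equiv> A_c E p S"

lemma Ac_gen: "awalk a es w \<Longrightarrow> awalk b fs w \<Longrightarrow> pe (a, es) * star (pe (b, fs)) \<in> Ac"
  unfolding A_c_def
  by (intro complex_vector.span_base CollectI exI[of _ "(a, es)"] exI[of _ "(b, fs)"])
    (auto simp: in_paths_iff path_range_eq)

lemma Ac_add: "x \<in> Ac \<Longrightarrow> y \<in> Ac \<Longrightarrow> x + y \<in> Ac"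
  and Ac_diff: "x \<in> Ac \<Longrightarrow> y \<in> Ac \<Longrightarrow> x - y \<in> Ac"
  and Ac_scaleC: "x \<in> Ac \<Longrightarrow> c *\<^sub>C x \<in> Ac"
  and Ac_zero: "0 \<in> Ac"
  unfolding A_c_def
  by (simp_all add: complex_vector.span_add complex_vector.span_scale complex_vector.span_diff
      complex_vector.span_zero)

lemma Ac_scaleR: "x \<in> Ac \<Longrightarrow> r *\<^sub>R x \<in> Ac"
  by (simp add: scaleR_scaleC Ac_scaleC)

lemma Ac_sum: "(\<And>i. i \<in> I \<Longrightarrow> f i \<in> Ac) \<Longrightarrow> sum f I \<in> Ac"
  unfolding A_c_def by (rule complex_vector.span_sum)

lemma Ac_induct [consumes 1, case_names zero mono add scale]:
  assumes "x \<in> Ac" and "P 0"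
    and mono: "\<And>a es b fs w. awalk a es w \<Longrightarrow> awalk b fs w \<Longrightarrow> P (pe (a, es) * star (pe (b, fs)))"
    and add: "\<And>x y. x \<in> Ac \<Longrightarrow> y \<in> Ac \<Longrightarrow> P x \<Longrightarrow> P y \<Longrightarrow> P (x + y)"
    and scale: "\<And>c x. x \<in> Ac \<Longrightarrow> P x \<Longrightarrow> P (c *\<^sub>C x)"
  shows "P x"
proof -
  have "x \<in> Ac \<and> P x"
    using assms(1) unfolding A_c_def
  proof (induction rule: complex_vector.span_induct_alt)
    case base
    show ?case using assms(2) Ac_zero by (simp add: A_c_def)
  next
    case (step c x y)
    then obtain a es b fs w where x: "x = pe (a, es) * star (pe (b, fs))" "awalk a es w" "awalk b fs w"
      by (force simp: paths_def path_range_eq)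
    then have "x \<in> Ac" "P x" using Ac_gen mono by auto
    with step show ?case using Ac_scaleC[of x c] Ac_add add scale unfolding A_c_def[symmetric] by auto
  qed
  then show ?thesis ..
qed

lemma Ac_star: "x \<in> Ac \<Longrightarrow> star x \<in> Ac"
  by (induction rule: Ac_induct)
    (auto simp: Ac_zero star_mult star_star Ac_gen star_add Ac_add star_scaleC Ac_scaleC)

lemma Ac_mult_gen:
  assumes "awalk a es w" "awalk b fs w" "awalk c gs u" "awalk d hs u"
  shows "(pe (a, es) * star (pe (b, fs))) * (pe (c, gs) * star (pe (d, hs))) \<in> Ac"
proof (cases "length fs \<le> length gs")
  case True
  from star_pe_mult[OF assms(2,3) this] show ?thesis
  proof (elim disjE exE conjE)
    assume "star (pe (b, fs)) * pe (c, gs) = 0"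
    then have "(pe (a, es) * star (pe (b, fs))) * (pe (c, gs) * star (pe (d, hs))) = 0"
      by (metis mult.assoc mult_zero_left mult_zero_right)
    then show ?thesis by (simp add: Ac_zero)
  next
    fix ks assume ks: "awalk w ks u" "star (pe (b, fs)) * pe (c, gs) = pe (w, ks)"
    have "(pe (a, es) * star (pe (b, fs))) * (pe (c, gs) * star (pe (d, hs)))
        = pe (a, es) * (star (pe (b, fs)) * pe (c, gs)) * star (pe (d, hs))" by (simp only: mult.assoc)
    also have "\<dots> = pe (a, es @ ks) * star (pe (d, hs))"
      by (simp only: ks(2) pe_append[OF assms(1) ks(1)])
    finally show ?thesis using Ac_gen[OF awalk_appendI[OF assms(1) ks(1)] assms(4)] by simp
  qed
next
  case False
  then have "length gs \<le> length fs" by simp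
  from star_pe_mult[OF assms(3,2) this] show ?thesis
  proof (elim disjE exE conjE)
    assume "star (pe (c, gs)) * pe (b, fs) = 0"
    then have "star (star (pe (c, gs)) * pe (b, fs)) = 0" by simp
    then have "star (pe (b, fs)) * pe (c, gs) = 0" by (simp add: star_mult star_star)
    then have "(pe (a, es) * star (pe (b, fs))) * (pe (c, gs) * star (pe (d, hs))) = 0"
      by (metis mult.assoc mult_zero_left mult_zero_right)
    then show ?thesis by (simp add: Ac_zero)
  next
    fix ks assume ks: "awalk u ks w" "star (pe (c, gs)) * pe (b, fs) = pe (u, ks)"
    have ks': "star (pe (b, fs)) * pe (c, gs) = star (pe (u, ks))"
      by (simp add: ks(2)[symmetric] star_mult star_star)
    have "(pe (a, es) * star (pe (b, fs))) * (pe (c, gs) * star (pe (d, hs)))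
        = pe (a, es) * ((star (pe (b, fs)) * pe (c, gs)) * star (pe (d, hs)))" by (simp only: mult.assoc)
    also have "\<dots> = pe (a, es) * star (pe (d, hs @ ks))"
      by (simp only: ks' pe_append[OF assms(4) ks(1)] star_mult)
    finally show ?thesis using Ac_gen[OF assms(1) awalk_appendI[OF assms(4) ks(1)]] by simp
  qed
qed

lemma Ac_mult:
  assumes "x \<in> Ac" "y \<in> Ac"
  shows "x * y \<in> Ac"
  using assms(1)
proof (induction rule: Ac_induct)
  case (mono a es b fs w)
  show ?case using assms(2)
    by (induction rule: Ac_induct)
      (auto simp: Ac_zero Ac_mult_gen[OF mono] distrib_left Ac_add mult_scaleC_right Ac_scaleC)
qed (auto simp: Ac_zero distrib_right Ac_add mult_scaleC_left Ac_scaleC)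

lemma Ac_pe: "awalk v es w \<Longrightarrow> pe (v, es) \<in> Ac"
  using Ac_gen[of v es w w "[]"] by (auto simp: awalk_Nil_iff pe_right)

subsection \<open>The conditional expectation\<close>

abbreviation "Phi \<equiv> cond_exp E p S"

lemma gam_mono:
  "awalk a es w \<Longrightarrow> awalk b fs w \<Longrightarrow> gam \<theta> (pe (a, es) * star (pe (b, fs)))
    = cis ((real (length es) - real (length fs)) * \<theta>) *\<^sub>C (pe (a, es) * star (pe (b, fs)))"
  by (simp add: gam_simps gam_pe star_scaleC scaleC_algebra cis_cnj cis_mult algebra_simps)

text \<open>Monomials are eigenvectors of the gauge action with continuous eigenvalue, and
  continuity passes to their span.\<close>

lemma continuous_gam: "x \<in> Ac \<Longrightarrow> continuous_on UNIV (\<lambda>\<theta>. gam \<theta> x)"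
proof (induction rule: Ac_induct)
  case (mono a es b fs w)
  show ?case unfolding gam_mono[OF mono]
    by (rule bounded_linear.continuous_on[OF bounded_linear_scaleC_left]) (intro continuous_intros)
next
  case (scale c x)
  then show ?case unfolding gam_simps by (intro bounded_linear.continuous_on[OF bounded_linear_scaleC])
qed (simp_all add: gam_zero gam_simps continuous_on_add)

lemma integrable_gam: "x \<in> Ac \<Longrightarrow> (\<lambda>\<theta>. gam \<theta> x) integrable_on {a..b}"
  by (rule integrable_continuous_real) (rule continuous_on_subset[OF continuous_gam], auto)

lemma Phi_eq: "Phi x = (1 / (2 * pi)) *\<^sub>R integral {0..2 * pi} (\<lambda>\<theta>. gam \<theta> x)"
  by (simp add: cond_exp_def gam_def)

text \<open>One lemma covers scalars, adjoints and multiplication by \<open>Fc\<close>: a bounded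
  map compatible with the gauge action passes through the integral. Linearity is real so that
  \<open>star\<close> qualifies.\<close>

lemma Phi_linear:
  assumes "x \<in> Ac" "bounded_linear h" "\<And>\<theta>. gam \<theta> y = h (gam \<theta> x)"
  shows "Phi y = h (Phi x)"
proof -
  have "integral {0..2 * pi} (\<lambda>\<theta>. gam \<theta> y) = h (integral {0..2 * pi} (\<lambda>\<theta>. gam \<theta> x))"
    using integral_linear[OF integrable_gam[OF assms(1), of 0 "2 * pi"] assms(2)] by (simp add: comp_def assms(3))
  then show ?thesis
    by (simp add: Phi_eq linear_scale[OF bounded_linear.linear[OF assms(2)]])
qed

lemma Phi_add: "x \<in> Ac \<Longrightarrow> y \<in> Ac \<Longrightarrow> Phi (x + y) = Phi x + Phi y"
  by (simp add: Phi_eq gam_simps integral_add[OF integrable_gam integrable_gam] scaleR_add_right)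

lemma Phi_scaleC: "x \<in> Ac \<Longrightarrow> Phi (c *\<^sub>C x) = c *\<^sub>C Phi x"
  by (rule Phi_linear[OF _ bounded_linear_scaleC]) (auto simp: gam_simps)

lemma Phi_star: "x \<in> Ac \<Longrightarrow> Phi (star x) = star (Phi x)"
  by (rule Phi_linear[OF _ bounded_linear_star]) (auto simp: gam_simps)

lemma Phi_zero: "Phi 0 = 0"
  by (simp add: Phi_eq gam_zero)

lemma Phi_invariant: "(\<And>\<theta>. gam \<theta> x = x) \<Longrightarrow> Phi x = x"
  by (simp add: Phi_eq)

lemma Phi_degree:
  assumes "\<And>\<theta>. gam \<theta> x = cis (k * \<theta>) *\<^sub>C x" "k \<in> \<int>" "k \<noteq> 0"
  shows "Phi x = 0"
proof -
  have "((\<lambda>\<theta>. cis (k * \<theta>) *\<^sub>C x) has_integral 0) {0..2 * pi}"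
    using has_integral_linear[OF has_integral_cis_multiple[OF assms(2,3)] bounded_linear_scaleC_left[of x]]
    by (simp add: comp_def)
  then show ?thesis by (simp add: Phi_eq assms(1) integral_unique)
qed

lemma Phi_mono:
  assumes "awalk a es w" "awalk b fs w"
  shows "Phi (pe (a, es) * star (pe (b, fs)))
    = (if length es = length fs then pe (a, es) * star (pe (b, fs)) else 0)"
proof (cases "length es = length fs")
  case True
  then show ?thesis using gam_mono[OF assms] by (simp add: Phi_invariant scaleC_one)
next
  case False
  then show ?thesis using gam_mono[OF assms]
    by (simp, intro Phi_degree[of _ "real (length es) - real (length fs)"]) auto
qed

definition "Fc = {f \<in> Ac. \<forall>\<theta>. gam \<theta> f = f}"

lemma Phi_Fc: "x \<in> Ac \<Longrightarrow> Phi x \<in> Fc"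
proof (induction rule: Ac_induct)
  case (mono a es b fs w)
  then show ?case using gam_mono[OF mono]
    by (auto simp: Phi_mono Fc_def Ac_zero gam_zero Ac_gen scaleC_one)
qed (auto simp: Phi_zero Phi_add Phi_scaleC Fc_def Ac_zero gam_zero gam_simps Ac_add Ac_scaleC)

lemma FcD: "f \<in> Fc \<Longrightarrow> f \<in> Ac" "f \<in> Fc \<Longrightarrow> gam \<theta> f = f" "f \<in> Fc \<Longrightarrow> Phi f = f"
  by (auto simp: Fc_def Phi_invariant)

lemma Phi_Ac: "x \<in> Ac \<Longrightarrow> Phi x \<in> Ac"
  using Phi_Fc FcD by blast

lemma Fc_star: "f \<in> Fc \<Longrightarrow> star f \<in> Fc"
  by (auto simp: Fc_def gam_simps Ac_star)

lemma Phi_mult_left: "f \<in> Fc \<Longrightarrow> x \<in> Ac \<Longrightarrow> Phi (f * x) = f * Phi x"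
  by (rule Phi_linear[OF _ bounded_linear_mult_right]) (auto simp: gam_simps FcD)

lemma Phi_mult_right: "f \<in> Fc \<Longrightarrow> x \<in> Ac \<Longrightarrow> Phi (x * f) = Phi x * f"
  by (rule Phi_linear[OF _ bounded_linear_mult_left]) (auto simp: gam_simps FcD)

end


subsection \<open>A frame for the module\<close>

context graph_algebra
begin

definition "paths_into v k = {(u, gs). awalk u gs v \<and> length gs = k}"

lemma finite_paths_into: "v \<in> verts E \<Longrightarrow> finite (paths_into v k)"
proof (induction k arbitrary: v)
  case 0
  have "paths_into v 0 \<subseteq> {(v, [])}" by (auto simp: paths_into_def awalk_Nil_iff)
  then show ?case by (rule finite_subset) simp
next
  case (Suc k)
  have "paths_into v (Suc k) \<subseteq> (\<Union>e\<in>in_arcs E v. (\<lambda>(u, gs). (u, gs @ [e])) ` paths_into (tail E e) k)"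
  proof
    fix \<mu> assume "\<mu> \<in> paths_into v (Suc k)"
    then obtain u gs where \<mu>: "\<mu> = (u, gs)" "awalk u gs v" "length gs = Suc k"
      by (auto simp: paths_into_def)
    then obtain hs e where gs: "gs = hs @ [e]" by (metis length_0_conv rev_exhaust nat.distinct(1))
    with \<mu> have "e \<in> in_arcs E v" "awalk u hs (tail E e)" "length hs = k"
      by (auto simp: awalk_Cons_iff awalk_Nil_iff)
    then show "\<mu> \<in> (\<Union>e\<in>in_arcs E v. (\<lambda>(u, gs). (u, gs @ [e])) ` paths_into (tail E e) k)"
      unfolding \<mu>(1) gs by (intro UN_I[of e]) (auto simp: paths_into_def image_iff)
  qed
  moreover have "finite (in_arcs E v)" using locally_finite Suc.prems by (auto simp: locally_finite_graph_def)
  ultimately show ?case using Suc.IH by (auto intro: finite_subset)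
qed

text \<open>Every vertex has an incoming edge, so paths can be prolonged backwards indefinitely.
  This makes the path count in \<open>frame\<close> a legitimate divisor.\<close>

lemma paths_into_nonempty: "v \<in> verts E \<Longrightarrow> paths_into v k \<noteq> {}"
proof (induction k arbitrary: v)
  case 0
  then have "(v, []) \<in> paths_into v 0" by (auto simp: paths_into_def awalk_Nil_iff)
  then show ?case by blast
next
  case (Suc k)
  then have "in_arcs E v \<noteq> {}" using no_source by (auto simp: no_sources_def)
  then obtain e where e: "e \<in> in_arcs E v" by blast
  then have "paths_into (tail E e) k \<noteq> {}" by (intro Suc.IH) auto
  then obtain u gs where "awalk u gs (tail E e)" "length gs = k" by (auto simp: paths_into_def)
  then have "(u, gs @ [e]) \<in> paths_into v (Suc k)"
    using e arc_implies_awalk[of e] awalk_appendI[of u gs "tail E e" "[e]" "head E e"]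
    by (auto simp: paths_into_def)
  then show ?case by blast
qed

lemma num_paths_into_eq: "num_paths_into E v k = card (paths_into v k)"
proof -
  have "{\<mu> \<in> paths E. path_length \<mu> = k \<and> path_range E \<mu> = v} = paths_into v k"
    by (auto simp: paths_def paths_into_def path_length_def path_range_eq)
  then show ?thesis by (simp add: num_paths_into_def)
qed

lemma num_paths_into_pos: "v \<in> verts E \<Longrightarrow> num_paths_into E v k > 0"
  using finite_paths_into paths_into_nonempty by (simp add: num_paths_into_eq card_gt_0_iff)

text \<open>
  The positively graded part of the module is spanned by the orthogonal family \<open>S\<^sub>\<mu>\<close>; the
  negatively graded part by the \<open>S\<^sub>\<mu>\<^sup>*\<close>, where all the \<open>\<mu>\<close> of one length
  with the same range contribute equally, whence the normalisation.
\<close>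

definition frame :: "('v \<times> 'e list) \<times> bool \<Rightarrow> 'a" where
  "frame i = (case i of (\<mu>, b) \<Rightarrow> if \<not> b then pe \<mu> else if path_length \<mu> = 0 then 0
     else (1 / sqrt (num_paths_into E (path_range E \<mu>) (path_length \<mu>))) *\<^sub>R star (pe \<mu>))"

text \<open>The flag selects the path element or its scaled adjoint. For a vertex the adjoint copy
  is the zero vector, so that vertices count once, as in \<open>omega\<close>.\<close>

definition "idx = paths E \<times> (UNIV :: bool set)"

lemma frame_False [simp]: "frame (\<mu>, False) = pe \<mu>"
  by (simp add: frame_def)

lemma frame_True:
  "awalk u gs v \<Longrightarrow> frame ((u, gs), True) =
    (if gs = [] then 0 else (1 / sqrt (num_paths_into E v (length gs))) *\<^sub>R star (pe (u, gs)))"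
  by (simp add: frame_def path_length_def path_range_eq)

lemma idxE:
  assumes "i \<in> idx"
  obtains u gs v b where "i = ((u, gs), b)" "awalk u gs v"
  using assms by (cases i) (auto simp: idx_def paths_def)

lemma idxI: "awalk u gs v \<Longrightarrow> ((u, gs), b) \<in> idx"
  by (auto simp: idx_def paths_def)

lemma frame_Ac: "i \<in> idx \<Longrightarrow> frame i \<in> Ac"
  by (erule idxE, case_tac b) (auto simp: frame_True Ac_zero Ac_scaleR Ac_star Ac_pe)

text \<open>The gauge degree of \<open>frame (\<mu>, b)\<close> is this sign times the length of the
  path.\<close>

definition "bsign b = (if b then -1 else 1 :: real)"

lemma gam_frame:
  assumes "awalk u gs v"
  shows "gam \<theta> (frame ((u, gs), b)) = cis (bsign b * real (length gs) * \<theta>) *\<^sub>C frame ((u, gs), b)"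
proof (cases b)
  case True
  have "gam \<theta> (r *\<^sub>R x) = r *\<^sub>R gam \<theta> x" for r x by (simp add: scaleR_scaleC gam_simps)
  then show ?thesis using assms True
    by (simp add: frame_True gam_zero gam_simps gam_pe star_scaleC cis_cnj bsign_def scaleR_scaleC_commute)
qed (use assms in \<open>simp add: gam_pe bsign_def\<close>)

lemma gam_star_frame_mult:
  assumes "awalk u gs v" "awalk a es w" "awalk b fs w"
  defines "x \<equiv> pe (a, es) * star (pe (b, fs))"
  shows "gam \<theta> (star (frame ((u, gs), c)) * x) =
    cis ((real (length es) - real (length fs) - bsign c * real (length gs)) * \<theta>) *\<^sub>C (star (frame ((u, gs), c)) * x)"
  unfolding x_def gam_simps(2,4)[of _ "star _"] gam_simps(2)[of _ "star (frame _)"] gam_simps(4)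
    gam_frame[OF assms(1)]
  by (simp add: gam_simps gam_pe[OF assms(2)] gam_pe[OF assms(3)] star_scaleC scaleC_algebra cis_cnj
      cis_mult algebra_simps)

text \<open>This is the rank one operator of a frame vector with itself, applied to x.\<close>

definition "frame_part i x = frame i * Phi (star (frame i) * x)"

lemma frame_part_zero_degree:
  assumes "awalk u gs v" "awalk a es w" "awalk b fs w"
    and "real (length es) - real (length fs) \<noteq> bsign c * real (length gs)"
  shows "frame_part ((u, gs), c) (pe (a, es) * star (pe (b, fs))) = 0"
proof -
  have "Phi (star (frame ((u, gs), c)) * (pe (a, es) * star (pe (b, fs)))) = 0"
    by (rule Phi_degree[OF gam_star_frame_mult[OF assms(1-3)]]) (use assms(4) in \<open>auto simp: bsign_def\<close>)
  then show ?thesis by (simp add: frame_part_def)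
qed

text \<open>Let d = length es - length fs be the gauge degree. For d \<ge> 0 the initial segment of
  es of length d returns x on its own. For d < 0 each of the N paths of length -d ending at a
  returns x / N. Terms of another degree vanish under Phi, the others by orthogonality.\<close>

lemma frame_mono:
  assumes a: "awalk a es w" and b: "awalk b fs w"
  defines "x \<equiv> pe (a, es) * star (pe (b, fs))"
  shows "\<exists>I0. finite I0 \<and> I0 \<subseteq> idx \<and> (\<Sum>i\<in>I0. frame_part i x) = x \<and> (\<forall>i\<in>idx - I0. frame_part i x = 0)"
proof (cases "length fs \<le> length es")
  case True
  define k where "k = length es - length fs"
  obtain u where u: "awalk a (take k es) u" "awalk u (drop k es) w"
    using a awalk_append_iff[of a "take k es" "drop k es" w] by auto
  have split: "pe (a, es) = pe (a, take k es) * pe (u, drop k es)" using pe_append[OF u] by simp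
  have "star (pe (a, take k es)) * x = (star (pe (a, take k es)) * pe (a, take k es)) * pe (u, drop k es) * star (pe (b, fs))"
    by (simp add: x_def split mult.assoc)
  also have "\<dots> = pe (u, drop k es) * star (pe (b, fs))"
    by (simp only: pe_isometry[OF u(1)] pe_left[OF u(2)])
  finally have sx: "star (pe (a, take k es)) * x = pe (u, drop k es) * star (pe (b, fs))" .
  have "length (drop k es) = length fs" using True by (simp add: k_def)
  then have "Phi (star (pe (a, take k es)) * x) = pe (u, drop k es) * star (pe (b, fs))"
    unfolding sx by (simp add: Phi_mono[OF u(2) b])
  then have main: "frame_part ((a, take k es), False) x = x"
    by (simp add: frame_part_def x_def split mult.assoc)
  have "frame_part i x = 0" if i: "i \<in> idx - {((a, take k es), False)}" for i
  proof -
    from i have "i \<in> idx" by blast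
    then obtain v gs r c where ic: "i = ((v, gs), c)" "awalk v gs r" by (rule idxE)
    show ?thesis
    proof (cases "real (length es) - real (length fs) = bsign c * real (length gs)")
      case False
      then show ?thesis unfolding ic(1) x_def by (intro frame_part_zero_degree[OF ic(2) a b])
    next
      case deg: True
      show ?thesis
      proof (cases c)
        case True
        \<comment> \<open>An adjoint frame vector has degree at most 0, so here it can only come
          from a vertex, where it is 0 by definition.\<close>
        have "real (length fs) \<le> real (length es)" using \<open>length fs \<le> length es\<close> by simp
        moreover have "real (length es) - real (length fs) = - real (length gs)"
          using deg True by (simp add: bsign_def)
        ultimately have "real (length gs) \<le> 0" by linarith
        then have "gs = []" by simp
        then have "frame i = 0" using frame_True[OF ic(2)] ic True by simp
        then show ?thesis by (simp add: frame_part_def)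
      next
        case False
        then have len: "length gs = length (take k es)" using deg \<open>length fs \<le> length es\<close>
          by (auto simp: bsign_def k_def)
        have "star (pe (v, gs)) * pe (a, take k es) = 0"
          using i ic False by (intro pe_orth[OF ic(2) u(1) len]) auto
        then have "star (pe (v, gs)) * x = 0"
          unfolding x_def split by (metis mult.assoc mult_zero_left)
        then show ?thesis using False by (simp add: frame_part_def ic Phi_zero)
      qed
    qed
  qed
  then show ?thesis using main
    by (intro exI[of _ "{((a, take k es), False)}"]) (auto intro: idxI[OF u(1)])
next
  case False
  define k where "k = length fs - length es"
  have k: "k > 0" "real k = real (length fs) - real (length es)" using False by (auto simp: k_def)
  have av: "a \<in> verts E" using a by auto
  let ?N = "num_paths_into E a k"
  have N: "?N > 0" by (rule num_paths_into_pos[OF av])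
  let ?I = "(\<lambda>\<mu>. (\<mu>, True)) ` paths_into a k"
  have part: "frame_part (\<mu>, True) x = (1 / real ?N) *\<^sub>R x" if \<mu>: "\<mu> \<in> paths_into a k" for \<mu>
  proof -
    obtain v gs where vg: "\<mu> = (v, gs)" "awalk v gs a" "length gs = k"
      using \<mu> by (auto simp: paths_into_def)
    have fr: "frame (\<mu>, True) = (1 / sqrt ?N) *\<^sub>R star (pe \<mu>)"
      using frame_True[OF vg(2)] vg k by auto
    have pex: "pe \<mu> * x = pe (v, gs @ es) * star (pe (b, fs))"
      by (simp add: x_def vg pe_append[OF vg(2) a] mult.assoc)
    have "Phi (pe \<mu> * x) = pe \<mu> * x"
      unfolding pex by (subst Phi_mono[OF awalk_appendI[OF vg(2) a] b]) (use vg k False in auto)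
    moreover have "pe \<mu> * x \<in> Ac" unfolding pex by (rule Ac_gen[OF awalk_appendI[OF vg(2) a] b])
    then have "Phi ((1 / sqrt ?N) *\<^sub>R (pe \<mu> * x)) = (1 / sqrt ?N) *\<^sub>R Phi (pe \<mu> * x)"
      unfolding scaleR_scaleC by (rule Phi_scaleC)
    ultimately have "frame_part (\<mu>, True) x = (1 / sqrt ?N * (1 / sqrt ?N)) *\<^sub>R ((star (pe \<mu>) * pe \<mu>) * x)"
      by (simp add: frame_part_def fr star_scaleR star_star mult.assoc)
    also have "(star (pe \<mu>) * pe \<mu>) * x = x"
      unfolding vg(1) pe_isometry[OF vg(2)] by (simp add: x_def pe_left[OF a] flip: mult.assoc)
    also have "1 / sqrt ?N * (1 / sqrt ?N) = 1 / real ?N" by simp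
    finally show ?thesis .
  qed
  have "(\<Sum>i\<in>?I. frame_part i x) = (\<Sum>\<mu>\<in>paths_into a k. (1 / real ?N) *\<^sub>R x)"
    by (subst sum.reindex) (auto simp: inj_on_def part)
  also have "\<dots> = (real ?N * (1 / real ?N)) *\<^sub>R x"
    by (simp only: sum_constant_scaleR scaleR_scaleR num_paths_into_eq)
  also have "\<dots> = x" using N by simp
  finally have main: "(\<Sum>i\<in>?I. frame_part i x) = x" .
  have "frame_part i x = 0" if i: "i \<in> idx - ?I" for i
  proof -
    from i have "i \<in> idx" by blast
    then obtain v gs r c where ic: "i = ((v, gs), c)" "awalk v gs r" by (rule idxE)
    show ?thesis
    proof (cases "real (length es) - real (length fs) = bsign c * real (length gs)")
      case False
      then show ?thesis unfolding ic(1) x_def by (intro frame_part_zero_degree[OF ic(2) a b])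
    next
      case deg: True
      then have c: c using k by (auto simp: bsign_def split: if_splits)
      then have "length gs = k" using deg k by (auto simp: bsign_def)
      then have "(v, gs) \<notin> paths_into a k" using i ic c by auto
      then have "r \<noteq> a" using ic \<open>length gs = k\<close> by (auto simp: paths_into_def)
      have "pe (v, gs) * x = pe (v, gs) * (p r * p a) * x"
        using pe_right[OF ic(2)] pe_left[OF a] by (simp add: x_def) (metis mult.assoc)
      also have "p r * p a = 0" using ic(2) av \<open>r \<noteq> a\<close> by (intro p_orth) auto
      finally have "star (frame i) * x = 0"
        using c frame_True[OF ic(2)] by (simp add: ic star_scaleR star_star)
      then show ?thesis by (simp add: frame_part_def Phi_zero)
    qed
  qed
  then show ?thesis using main finite_paths_into[OF av]
    by (intro exI[of _ ?I]) (auto simp: paths_into_def intro: idxI)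
qed

lemma frame_part_add: "i \<in> idx \<Longrightarrow> x \<in> Ac \<Longrightarrow> y \<in> Ac \<Longrightarrow> frame_part i (x + y) = frame_part i x + frame_part i y"
  by (simp add: frame_part_def distrib_left Phi_add Ac_mult Ac_star frame_Ac)

lemma frame_part_scaleC: "i \<in> idx \<Longrightarrow> x \<in> Ac \<Longrightarrow> frame_part i (c *\<^sub>C x) = c *\<^sub>C frame_part i x"
  by (simp add: frame_part_def mult_scaleC_right Phi_scaleC Ac_mult Ac_star frame_Ac)

text \<open>Quantifying over all larger finite index sets makes the claim additive: the union of the
  sets for x and y serves x + y.\<close>

lemma frame_reconstruction:
  "x \<in> Ac \<Longrightarrow> \<exists>I0. finite I0 \<and> I0 \<subseteq> idx \<and> (\<forall>I. finite I \<longrightarrow> I0 \<subseteq> I \<longrightarrow> I \<subseteq> idx \<longrightarrow> (\<Sum>i\<in>I. frame_part i x) = x)"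
proof (induction rule: Ac_induct)
  case zero
  show ?case by (intro exI[of _ "{}"]) (simp add: frame_part_def Phi_zero)
next
  case (mono a es b fs w)
  define x where "x = pe (a, es) * star (pe (b, fs))"
  from frame_mono[OF mono, folded x_def] obtain I0 where I0: "finite I0" "I0 \<subseteq> idx"
    "(\<Sum>i\<in>I0. frame_part i x) = x" "\<forall>i\<in>idx - I0. frame_part i x = 0" by blast
  have "(\<Sum>i\<in>I. frame_part i x) = x" if "finite I" "I0 \<subseteq> I" "I \<subseteq> idx" for I
  proof -
    have "\<forall>i\<in>I - I0. frame_part i x = 0" using I0(4) that(3) by blast
    from sum.mono_neutral_left[OF that(1,2) this] show ?thesis using I0(3) by simp
  qed
  then show ?case unfolding x_def[symmetric] using I0(1,2) by (intro exI[of _ I0] conjI allI impI)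
next
  case (add x y)
  from add(3) obtain I where I: "finite I \<and> I \<subseteq> idx \<and> (\<forall>K. finite K \<longrightarrow> I \<subseteq> K \<longrightarrow> K \<subseteq> idx \<longrightarrow> (\<Sum>i\<in>K. frame_part i x) = x)"
    by (rule exE)
  from add(4) obtain J where J: "finite J \<and> J \<subseteq> idx \<and> (\<forall>K. finite K \<longrightarrow> J \<subseteq> K \<longrightarrow> K \<subseteq> idx \<longrightarrow> (\<Sum>i\<in>K. frame_part i y) = y)"
    by (rule exE)
  have "(\<Sum>i\<in>K. frame_part i (x + y)) = x + y" if K: "finite K" "I \<union> J \<subseteq> K" "K \<subseteq> idx" for K
  proof -
    have "(\<Sum>i\<in>K. frame_part i (x + y)) = (\<Sum>i\<in>K. frame_part i x + frame_part i y)"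
      using K add by (intro sum.cong refl frame_part_add) auto
    moreover have "(\<Sum>i\<in>K. frame_part i x) = x" "(\<Sum>i\<in>K. frame_part i y) = y"
      using I J K by simp_all
    ultimately show ?thesis by (simp add: sum.distrib)
  qed
  then show ?case using I J by (intro exI[of _ "I \<union> J"] conjI allI impI) simp_all
next
  case (scale c x)
  from scale(2) obtain I where I: "finite I \<and> I \<subseteq> idx \<and> (\<forall>K. finite K \<longrightarrow> I \<subseteq> K \<longrightarrow> K \<subseteq> idx \<longrightarrow> (\<Sum>i\<in>K. frame_part i x) = x)"
    by (rule exE)
  have "(\<Sum>i\<in>K. frame_part i (c *\<^sub>C x)) = c *\<^sub>C x" if K: "finite K" "I \<subseteq> K" "K \<subseteq> idx" for K
  proof -
    have "(\<Sum>i\<in>K. frame_part i (c *\<^sub>C x)) = (\<Sum>i\<in>K. c *\<^sub>C frame_part i x)"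
      using K scale by (intro sum.cong refl frame_part_scaleC) auto
    also have "\<dots> = c *\<^sub>C (\<Sum>i\<in>K. frame_part i x)" by (rule complex_vector.scale_sum_right[symmetric])
    also have "(\<Sum>i\<in>K. frame_part i x) = x" using I K by simp
    finally show ?thesis .
  qed
  then show ?case using I by (intro exI[of _ I] conjI allI impI) simp_all
qed

end


section \<open>The trace on the dense subalgebra\<close>

locale graph_trace = graph_algebra E p S for E :: "('v, 'e) pre_digraph" and p :: "'v \<Rightarrow> 'a::cstar_algebra"
    and S :: "'e \<Rightarrow> 'a" +
  fixes \<tau> :: "'a \<Rightarrow> ennreal"
  assumes trace: "is_trace \<tau>" and semifinite: "semifinite_trace \<tau>"
    and gauge_invariant: "gauge_invariant_trace E p S \<tau>"
begin

sublocale W: weight_cone pos_cone \<tau>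
proof
  fix a b c d :: 'a
  assume P: "a \<in> pos_cone" "b \<in> pos_cone" "c \<in> pos_cone" "d \<in> pos_cone"
    and eq: "(a - b) + \<i> *\<^sub>C (c - d) = 0"
  \<comment> \<open>Taking adjoints reverses the sign of the imaginary part and so separates it from
    the real part.\<close>
  have "star ((a - b) + \<i> *\<^sub>C (c - d)) = (a - b) - \<i> *\<^sub>C (c - d)"
    by (simp add: star_add star_diff star_scaleC pos_cone_star P complex_vector.scale_minus_left)
  then have 1: "\<i> *\<^sub>C (c - d) = a - b" using eq by simp
  with eq have "(a - b) + (a - b) = 0" by simp
  then have "2 *\<^sub>R (a - b) = 0" by (simp only: scaleR_2)
  then have "a = b" by simp
  with 1 show "a = b \<and> c = d" by (simp add: complex_vector.scale_eq_0_iff)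
qed (use trace in \<open>auto simp: pos_cone_zero pos_cone_add pos_cone_scaleR is_trace_def\<close>)

abbreviation "tr \<equiv> trace_ext \<tau>"

lemma tau_star: "\<tau> (star a * a) = \<tau> (a * star a)"
  using trace by (simp add: is_trace_def)

lemma fin_star_swap: "star a * a \<in> W.fin \<longleftrightarrow> a * star a \<in> W.fin"
  by (simp add: W.fin_def pos_cone_star_mult pos_cone_mult_star tau_star)

lemma wt_star_swap: "W.wt (star a * a) = W.wt (a * star a)"
  by (simp add: W.wt_def tau_star)

text \<open>Semifiniteness provides a = star b * b of finite trace within 1/2 of p = p v. The
  compression p * a * p has finite trace, because b * p * star b lies below b * star b. Moreover p -
  p * a * p lies below p / 2, so p / 2 lies below p * a * p.\<close>

lemma fin_p:
  assumes v: "v \<in> verts E"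
  shows "p v \<in> W.fin"
proof -
  let ?p = "p v"
  have pp: "star ?p * ?p = ?p" using v by simp
  then have "?p \<in> pos_cone" using pos_cone_star_mult[of ?p] by simp
  then have "?p \<in> closure {a \<in> pos_cone. \<tau> a < \<infinity>}" using semifinite by (auto simp: semifinite_trace_def)
  then obtain a where a: "a \<in> pos_cone" "\<tau> a < \<infinity>" "dist a ?p < 1 / 2"
    unfolding closure_approachable by (metis (mono_tags, lifting) half_gt_zero_iff mem_Collect_eq zero_less_one)
  then obtain b where b: "a = star b * b" by (auto simp: pos_cone_def)
  have fin_b: "b * star b \<in> W.fin" using a b by (simp add: W.fin_def pos_cone_mult_star tau_star)
  have diff_b: "b * star b - b * ?p * star b \<in> pos_cone"
  proof -
    have "b * ?p * ?p = b * ?p" using v by (simp add: mult.assoc)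
    then have "(b - b * ?p) * star (b - b * ?p) = b * star b - b * ?p * star b"
      using v by (simp add: star_diff star_mult algebra_simps)
        (simp flip: mult.assoc)
    then show ?thesis using pos_cone_mult_star[of "b - b * ?p"] by simp
  qed
  have bpb: "(b * ?p) * star (b * ?p) = b * ?p * star b"
    using v by (simp add: star_mult) (metis mult.assoc p_idem)
  then have "b * ?p * star b \<in> pos_cone" using pos_cone_mult_star[of "b * ?p"] by simp
  from W.fin_if_le[OF this fin_b diff_b] have "b * ?p * star b \<in> W.fin" .
  then have "star (b * ?p) * (b * ?p) \<in> W.fin" by (simp add: fin_star_swap bpb)
  then have pap: "?p * a * ?p \<in> W.fin" using v by (simp add: star_mult b mult.assoc)
  define c where "c = ?p * (?p - a) * ?p"
  have sc: "star c = c" using v pos_cone_star[OF a(1)] by (simp add: c_def star_mult star_diff mult.assoc)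
  have np: "norm ?p \<le> 1"
  proof (cases "norm ?p = 0")
    case False
    have "norm ?p * norm ?p = norm ?p" using cstar_identity[of ?p] pp by (simp add: power2_eq_square)
    with False show ?thesis by simp
  qed simp
  have "norm c \<le> norm ?p * norm (?p - a) * norm ?p"
    unfolding c_def by (meson mult_right_mono norm_ge_zero norm_mult_ineq order_trans)
  also have "\<dots> \<le> 1 * norm (?p - a) * 1" using np by (intro mult_mono) auto
  also have "\<dots> \<le> 1 / 2" using a(3) by (simp add: dist_norm norm_minus_commute)
  finally have "(1 / 2) *\<^sub>R (star ?p * ?p) - star ?p * c * ?p \<in> pos_cone"
    by (rule pos_cone_norm_diff[OF sc])
  moreover have "?p * c * ?p = c" using v by (simp add: c_def) (metis mult.assoc p_idem)
  moreover have "c = ?p - ?p * a * ?p" using v by (simp add: c_def algebra_simps)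
  ultimately have "(1 / 2) *\<^sub>R ?p - (?p - ?p * a * ?p) \<in> pos_cone" using v by simp
  moreover have "h - (h + h - z) = z - h" for h z :: 'a by (simp add: algebra_simps)
  from this[of "(1 / 2) *\<^sub>R ?p" "?p * a * ?p"]
  have "(1 / 2) *\<^sub>R ?p - (?p - ?p * a * ?p) = ?p * a * ?p - (1 / 2) *\<^sub>R ?p"
    by (simp flip: scaleR_add_left)
  ultimately have "?p * a * ?p - (1 / 2) *\<^sub>R ?p \<in> pos_cone" by simp
  from W.fin_if_le[OF _ pap this] have "(1 / 2) *\<^sub>R ?p \<in> W.fin"
    using \<open>?p \<in> pos_cone\<close> by (simp add: pos_cone_scaleR)
  from W.fin_scale[OF _ this, of 2] show ?thesis by simp
qed

text \<open>If z * p w = z, then star z * z is at most a multiple of p w, so z * star z has finite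
  trace. Polarization writes a monomial through four such elements.\<close>

lemma Ac_wdom: "x \<in> Ac \<Longrightarrow> x \<in> W.wdom"
proof (induction rule: Ac_induct)
  case (mono a es b fs w)
  let ?x = "pe (a, es)" and ?y = "pe (b, fs)"
  have w: "w \<in> verts E" using mono by auto
  have fin: "z * star z \<in> W.fin" if z: "z * p w = z" for z
  proof -
    let ?M = "norm (star z * z)"
    have "?M *\<^sub>R (star (p w) * p w) - star (p w) * (star z * z) * p w \<in> pos_cone"
      by (rule pos_cone_norm_diff) (simp_all add: star_mult star_star)
    moreover have "star (p w) * (star z * z) * p w = star (z * p w) * (z * p w)"
      by (simp add: star_mult mult.assoc)
    ultimately have "?M *\<^sub>R p w - star z * z \<in> pos_cone" using w by (simp add: z)
    then have "star z * z \<in> W.fin"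
      by (intro W.fin_if_le[OF pos_cone_star_mult W.fin_scale[OF _ fin_p[OF w]]]) auto
    then show ?thesis by (simp add: fin_star_swap)
  qed
  have "(?y + c *\<^sub>C ?x) * star (?y + c *\<^sub>C ?x) \<in> W.wdom" for c
    by (intro W.wdom_fin fin)
      (simp add: distrib_right pe_right[OF mono(1)] pe_right[OF mono(2)] mult_scaleC_left)
  from this[of 1] this[of "-1"] this[of \<i>] this[of "- \<i>"]
  show ?case
    by (subst polarization_mult_star)
      (intro W.wdom_add W.wdom_diff W.wdom_scale, simp_all add: scaleC_one minus_one_scaleC
        complex_vector.scale_minus_left)
qed (simp_all add: W.wdom_zero W.wdom_add W.wdom_scale)

lemma fin_star_mult: "x \<in> Ac \<Longrightarrow> star x * x \<in> W.fin"
  by (intro W.fin_if_wdom pos_cone_star_mult Ac_wdom Ac_mult Ac_star)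

lemma tr_add: "x \<in> Ac \<Longrightarrow> y \<in> Ac \<Longrightarrow> tr (x + y) = tr x + tr y"
  and tr_scaleC: "x \<in> Ac \<Longrightarrow> tr (c *\<^sub>C x) = c * tr x"
  and tr_diff: "x \<in> Ac \<Longrightarrow> y \<in> Ac \<Longrightarrow> tr (x - y) = tr x - tr y"
  and tr_zero: "tr 0 = 0"
  by (simp_all add: trace_ext_def W.lin_ext_add W.lin_ext_scale W.lin_ext_diff W.lin_ext_zero Ac_wdom)

lemma tr_star_mult: "x \<in> Ac \<Longrightarrow> tr (star x * x) = complex_of_real (W.wt (star x * x))"
  by (simp add: trace_ext_def W.lin_ext_fin fin_star_mult)

lemma tr_swap_self:
  assumes "x \<in> Ac"
  shows "tr (x * star x) = tr (star x * x)"
  using tr_star_mult[OF assms] tr_star_mult[OF Ac_star[OF assms]] wt_star_swap[of x] by (simp add: star_star)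

lemma tr_commute:
  assumes "x \<in> Ac" "y \<in> Ac"
  shows "tr (x * y) = tr (y * x)"
proof -
  have *: "tr (star y * x) = tr (x * star y)" if x: "x \<in> Ac" and y: "y \<in> Ac" for x y
  proof -
    have A: "y + x \<in> Ac" "y - x \<in> Ac" "y - \<i> *\<^sub>C x \<in> Ac" "y + \<i> *\<^sub>C x \<in> Ac"
      using x y by (auto intro: Ac_add Ac_diff Ac_scaleC)
    then have s: "tr (star z * z) = tr (z * star z)"
      if "z \<in> {y + x, y - x, y - \<i> *\<^sub>C x, y + \<i> *\<^sub>C x}" for z
      using that tr_swap_self by auto
    have B: "star z * z \<in> Ac" "z * star z \<in> Ac" if "z \<in> {y + x, y - x, y - \<i> *\<^sub>C x, y + \<i> *\<^sub>C x}" for z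
      using that A by (auto intro: Ac_mult Ac_star)
    show ?thesis
      by (subst polarization_star_mult, subst polarization_mult_star)
        (simp add: tr_scaleC tr_add tr_diff s B Ac_add Ac_diff Ac_scaleC)
  qed
  show ?thesis using *[OF assms(1) Ac_star[OF assms(2)]] by (simp add: star_star)
qed

lemma gam_pos_cone: "q \<in> pos_cone \<Longrightarrow> gam \<theta> q \<in> pos_cone"
  by (auto simp: pos_cone_def gam_simps)

lemma tr_gam:
  assumes "x \<in> Ac"
  shows "tr (gam \<theta> x) = tr x"
proof -
  from Ac_wdom[OF assms] obtain F k where F: "finite F" "F \<subseteq> W.fin" "x = (\<Sum>q\<in>F. k q *\<^sub>C q)"
    by (rule W.wdomE)
  have tau: "\<tau> (gam \<theta> q) = \<tau> q" if "q \<in> F" for q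
    using gauge_invariant F that W.finD(1) by (auto simp: gauge_invariant_trace_def gam_def)
  have sum: "gam \<theta> (sum f G) = (\<Sum>q\<in>G. gam \<theta> (f q))" for f and G :: "'a set"
    by (induction G rule: infinite_finite_induct) (auto simp: gam_zero gam_simps)
  have "gam \<theta> x = (\<Sum>q\<in>F. k q *\<^sub>C gam \<theta> q)" by (simp add: F(3) sum gam_simps)
  also have "tr \<dots> = (\<Sum>q\<in>F. k q * W.wt (gam \<theta> q))"
    unfolding trace_ext_def
  proof (rule W.lin_ext_combination[OF F(1)])
    fix q assume q: "q \<in> F"
    then have "q \<in> pos_cone" "\<tau> q < \<infinity>" using F(2) by (auto simp: W.fin_def)
    then show "gam \<theta> q \<in> W.fin" using tau[OF q] gam_pos_cone by (simp add: W.fin_def)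
  qed
  also have "\<dots> = (\<Sum>q\<in>F. k q * W.wt q)" using tau by (simp add: W.wt_def)
  also have "\<dots> = tr x" unfolding trace_ext_def F(3)
    by (rule W.lin_ext_combination[OF F(1), of "\<lambda>q. q" k, symmetric]) (use F(2) in auto)
  finally show ?thesis .
qed

text \<open>The gauge automorphism at angle pi / d sends a monomial of degree d to its negative, so
  invariance forces its trace to vanish, in agreement with Phi.\<close>

lemma tr_Phi: "x \<in> Ac \<Longrightarrow> tr (Phi x) = tr x"
proof (induction rule: Ac_induct)
  case (mono a es b fs w)
  let ?x = "pe (a, es) * star (pe (b, fs))"
  show ?case
  proof (cases "length es = length fs")
    case False
    define d where "d = real (length es) - real (length fs)"
    have "d \<noteq> 0" using False by (simp add: d_def)
    have "tr ?x = tr (gam (pi / d) ?x)" by (rule tr_gam[OF Ac_gen[OF mono], symmetric])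
    also have "gam (pi / d) ?x = cis (d * (pi / d)) *\<^sub>C ?x" unfolding d_def by (rule gam_mono[OF mono])
    also have "tr \<dots> = cis (d * (pi / d)) * tr ?x" by (rule tr_scaleC[OF Ac_gen[OF mono]])
    also have "cis (d * (pi / d)) = -1" using \<open>d \<noteq> 0\<close> by simp
    finally have "tr ?x = 0" by (simp add: equal_neg_zero)
    then show ?thesis using False by (simp add: Phi_mono[OF mono] tr_zero)
  qed (simp add: Phi_mono[OF mono])
qed (simp_all add: Phi_zero Phi_add Phi_scaleC tr_add tr_scaleC Phi_Ac)

lemma wt_mono:
  assumes "q \<in> pos_cone" "r \<in> W.fin" "r - q \<in> pos_cone"
  shows "W.wt q \<le> W.wt r"
proof -
  have "\<tau> r = \<tau> q + \<tau> (r - q)" using W.weight_add[of q "r - q"] assms by simp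
  then have "\<tau> q \<le> \<tau> r" by simp
  then show ?thesis using assms(2) by (auto simp: W.wt_def W.fin_def intro: enn2real_mono)
qed

lemma wt_scaleR: "0 \<le> r \<Longrightarrow> q \<in> pos_cone \<Longrightarrow> W.wt (r *\<^sub>R q) = r * W.wt q"
  by (simp add: W.wt_def W.weight_scale enn2real_mult)

lemma wt_mult_left_le:
  assumes "x \<in> Ac" "y \<in> Ac"
  shows "W.wt (star (x * y) * (x * y)) \<le> (norm x)\<^sup>2 * W.wt (star y * y)"
proof -
  have "(norm x)\<^sup>2 *\<^sub>R (star y * y) - star y * (star x * x) * y \<in> pos_cone"
    by (rule pos_cone_norm_diff) (simp_all add: star_mult star_star cstar_identity)
  then have "(norm x)\<^sup>2 *\<^sub>R (star y * y) - star (x * y) * (x * y) \<in> pos_cone"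
    by (simp add: star_mult mult.assoc)
  then have "W.wt (star (x * y) * (x * y)) \<le> W.wt ((norm x)\<^sup>2 *\<^sub>R (star y * y))"
    by (intro wt_mono pos_cone_star_mult W.fin_scale fin_star_mult assms) auto
  then show ?thesis by (simp add: wt_scaleR pos_cone_star_mult)
qed

text \<open>Taking adjoints turns right into left multiplication, and the trace property absorbs the
  exchange of \<open>star z * z\<close> with \<open>z * star z\<close>.\<close>

lemma wt_mult_right_le:
  assumes "x \<in> Ac" "y \<in> Ac"
  shows "W.wt (star (y * x) * (y * x)) \<le> (norm x)\<^sup>2 * W.wt (star y * y)"
proof -
  have "W.wt (star (y * x) * (y * x)) = W.wt ((y * x) * star (y * x))" by (rule wt_star_swap)
  also have "\<dots> = W.wt (star (star x * star y) * (star x * star y))" by (simp add: star_mult star_star)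
  also have "\<dots> \<le> (norm (star x))\<^sup>2 * W.wt (star (star y) * star y)"
    by (intro wt_mult_left_le Ac_star assms)
  also have "\<dots> = (norm x)\<^sup>2 * W.wt (star y * y)" by (simp add: star_star wt_star_swap[of y])
  finally show ?thesis .
qed

end


section \<open>Complex Hilbert spaces\<close>

lemma cinner_add_left: "cinner (x + y) z = cinner x z + cinner (y :: 'h::chilbert_space) z"
  by (subst (1 2 3) cinner_commute) (simp add: cinner_add_right)

lemma cinner_scaleC_left: "cinner (c *\<^sub>C x) (y :: 'h::chilbert_space) = cnj c * cinner x y"
  by (subst (1 2) cinner_commute) (simp add: cinner_scaleC_right)

lemma cinner_zero [simp]: "cinner 0 (x :: 'h::chilbert_space) = 0" "cinner x (0 :: 'h::chilbert_space) = 0"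
  using cinner_scaleC_left[of 0 0 x] cinner_scaleC_right[of x 0 0] by simp_all

lemma cinner_minus: "cinner (- x) (y :: 'h::chilbert_space) = - cinner x y" "cinner x (- y) = - cinner x y"
  using cinner_scaleC_left[of "-1" x y] cinner_scaleC_right[of x "-1" y] by (simp_all add: minus_one_scaleC)

lemma cinner_diff: "cinner (x - z) (y :: 'h::chilbert_space) = cinner x y - cinner z y"
    "cinner x (y - z) = cinner x y - cinner x z"
  using cinner_add_left[of x "- z" y] cinner_add_right[of x y "- z"] by (simp_all add: cinner_minus)

lemma cinner_scaleR: "cinner (r *\<^sub>R x) (y :: 'h::chilbert_space) = r * cinner x y" "cinner x (r *\<^sub>R y) = r * cinner x y"
  by (simp_all add: scaleR_scaleC cinner_scaleC_left cinner_scaleC_right)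

lemma cinner_sum_right: "cinner (x :: 'h::chilbert_space) (\<Sum>i\<in>I. f i) = (\<Sum>i\<in>I. cinner x (f i))"
  by (induction I rule: infinite_finite_induct) (auto simp: cinner_add_right)

lemma Re_cinner_self: "Re (cinner x x) = (norm (x :: 'h::chilbert_space))\<^sup>2"
  by (simp add: cinner_self)

lemma norm_add_square:
  "(norm (x + y))\<^sup>2 = (norm x)\<^sup>2 + 2 * Re (cinner x y) + (norm (y :: 'h::chilbert_space))\<^sup>2"
proof -
  have "Re (cinner y x) = Re (cinner x y)" by (subst cinner_commute) simp
  then show ?thesis by (simp flip: Re_cinner_self add: cinner_add_left cinner_add_right)
qed

text \<open>
  Stated for positive semidefinite forms, so that it also applies to the form of a positive operator.
\<close>

lemma form_Cauchy_Schwarz: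
  fixes B :: "'h::complex_vector \<Rightarrow> 'h \<Rightarrow> complex"
  assumes add: "\<And>x y z. B x (y + z) = B x y + B x z" and scale: "\<And>c x y. B x (c *\<^sub>C y) = c * B x y"
    and herm: "\<And>x y. B x y = cnj (B y x)" and pos: "\<And>x. Re (B x x) \<ge> 0"
  shows "(cmod (B x y))\<^sup>2 \<le> Re (B x x) * Re (B y y)"
proof -
  have addl: "B (x + y) z = B x z + B y z" for x y z by (subst (1 2 3) herm) (simp add: add)
  have scalel: "B (c *\<^sub>C x) y = cnj c * B x y" for c x y by (subst (1 2) herm) (simp add: scale)
  have real: "B x x = complex_of_real (Re (B x x))" for x
    using herm[of x x] by (simp add: complex_eq_iff)
  define b where "b = B x y"
  have yx: "B y x = cnj b" unfolding b_def by (rule herm)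
  have q: "0 \<le> Re (B x x) + 2 * t * (cmod b)\<^sup>2 + t\<^sup>2 * (cmod b)\<^sup>2 * Re (B y y)" for t :: real
  proof -
    \<comment> \<open>The factor \<open>cnj b\<close> rotates the cross terms onto the real
      axis.\<close>
    let ?c = "complex_of_real t * cnj b"
    have 1: "B (x + ?c *\<^sub>C y) (x + ?c *\<^sub>C y) = B x x + ?c * b + cnj ?c * cnj b + cnj ?c * ?c * B y y"
      by (simp add: add addl scale scalel yx flip: b_def) (simp add: algebra_simps)
    have "?c * b = complex_of_real t * (b * cnj b)" "cnj ?c * cnj b = complex_of_real t * (b * cnj b)"
      "cnj ?c * ?c = complex_of_real (t\<^sup>2) * (b * cnj b)"
      by (simp_all add: power2_eq_square mult_ac)
    then have 2: "?c * b = complex_of_real (t * (cmod b)\<^sup>2)" "cnj ?c * cnj b = complex_of_real (t * (cmod b)\<^sup>2)"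
      "cnj ?c * ?c = complex_of_real (t\<^sup>2 * (cmod b)\<^sup>2)"
      by (simp_all only: complex_norm_square[symmetric] of_real_mult)
    have "Re (complex_of_real r * z) = r * Re z" for r z by simp
    then have "Re (B (x + ?c *\<^sub>C y) (x + ?c *\<^sub>C y))
        = Re (B x x) + 2 * t * (cmod b)\<^sup>2 + t\<^sup>2 * (cmod b)\<^sup>2 * Re (B y y)"
      unfolding 1 2 plus_complex.sel Re_complex_of_real by simp
    moreover have "0 \<le> Re (B (x + ?c *\<^sub>C y) (x + ?c *\<^sub>C y))" by (rule pos)
    ultimately show ?thesis by simp
  qed
  show ?thesis
  proof (cases "Re (B y y) = 0")
    case True
    have "b = 0"
    proof (rule ccontr)
      assume "b \<noteq> 0"
      then have b: "(cmod b)\<^sup>2 > 0" by simp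
      \<comment> \<open>Without a quadratic term, t is chosen so that the linear function takes the
        value -1.\<close>
      have "0 \<le> Re (B x x) + 2 * (- (Re (B x x) + 1) / (2 * (cmod b)\<^sup>2)) * (cmod b)\<^sup>2"
        using q[of "- (Re (B x x) + 1) / (2 * (cmod b)\<^sup>2)"] True by simp
      also have "\<dots> = -1" using b by (simp add: field_simps)
      finally show False by simp
    qed
    then show ?thesis using True by (simp add: b_def)
  next
    case False
    then have y: "Re (B y y) > 0" using pos[of y] by simp
    \<comment> \<open>Here t is the minimizer of the quadratic.\<close>
    have "0 \<le> Re (B x x) + 2 * (- (1 / Re (B y y))) * (cmod b)\<^sup>2 + (- (1 / Re (B y y)))\<^sup>2 * (cmod b)\<^sup>2 * Re (B y y)"
      by (rule q)
    also have "\<dots> = Re (B x x) - (cmod b)\<^sup>2 / Re (B y y)"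
      using y by (simp add: field_simps power2_eq_square)
    finally show ?thesis using y by (simp add: b_def field_simps)
  qed
qed

lemma cinner_Cauchy_Schwarz: "cmod (cinner x y) \<le> norm x * norm (y :: 'h::chilbert_space)"
proof -
  have "(cmod (cinner x y))\<^sup>2 \<le> Re (cinner x x) * Re (cinner y y)"
    by (rule form_Cauchy_Schwarz)
      (simp_all add: cinner_add_right cinner_scaleC_right Re_cinner_self cinner_commute[symmetric])
  then have "(cmod (cinner x y))\<^sup>2 \<le> (norm x * norm y)\<^sup>2" by (simp add: Re_cinner_self power_mult_distrib)
  then show ?thesis by (rule power2_le_imp_le) simp
qed

lemma bounded_linear_cinner_right: "bounded_linear (\<lambda>y. cinner x (y :: 'h::chilbert_space))"
proof (rule bounded_linear_intro[where K = "norm x"])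
  show "norm (cinner x y) \<le> norm y * norm x" for y
    using cinner_Cauchy_Schwarz[of x y] by (simp add: mult.commute)
qed (simp_all add: cinner_add_right cinner_scaleR scaleR_conv_of_real)

lemma bounded_linear_cinner_left: "bounded_linear (\<lambda>x. cinner x (y :: 'h::chilbert_space))"
proof (rule bounded_linear_intro[where K = "norm y"])
  show "norm (cinner x y) \<le> norm x * norm y" for x
    by (rule cinner_Cauchy_Schwarz)
qed (simp_all add: cinner_add_left cinner_scaleR scaleR_conv_of_real)

lemmas tendsto_cinner_right = bounded_linear.tendsto[OF bounded_linear_cinner_right]
  and tendsto_cinner_left = bounded_linear.tendsto[OF bounded_linear_cinner_left]

lemma cinner_left_ext:
  assumes "\<And>y. cinner x y = cinner z (y :: 'h::chilbert_space)"
  shows "x = z"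
proof -
  have "cinner (x - z) (x - z) = 0" using assms by (simp add: cinner_diff)
  then have "complex_of_real ((norm (x - z))\<^sup>2) = 0" by (simp only: cinner_self)
  then show ?thesis by simp
qed

text \<open>A minimizing sequence for the norm on the affine hyperplane f = 1 is Cauchy by the
  parallelogram law, as midpoints stay on the hyperplane. Its limit w is orthogonal to the kernel of
  f, so a multiple of w represents f.\<close>

lemma Riesz_representation:
  fixes f :: "'h::chilbert_space \<Rightarrow> complex"
  assumes bl: "bounded_linear f" and scale: "\<And>c x. f (c *\<^sub>C x) = c * f x"
  shows "\<exists>w. \<forall>x. f x = cinner w x"
proof (cases "\<forall>x. f x = 0")
  case True
  then show ?thesis by (intro exI[of _ 0]) simp
next
  case False
  interpret f: bounded_linear f by fact
  from False obtain x0 where "f x0 \<noteq> 0" by blast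
  then have "f (inverse (f x0) *\<^sub>C x0) = 1" by (simp add: scale)
  then have ne: "{x. f x = 1} \<noteq> {}" by blast
  define d where "d = Inf ((\<lambda>x. (norm x)\<^sup>2) ` {x. f x = 1})"
  have bdd: "bdd_below ((\<lambda>x. (norm x)\<^sup>2) ` {x. f x = 1})" by (intro bdd_belowI[of _ 0]) auto
  have d_le: "d \<le> (norm x)\<^sup>2" if "f x = 1" for x
    unfolding d_def using bdd that by (intro cInf_lower) auto
  have "\<exists>x. f x = 1 \<and> (norm x)\<^sup>2 < d + 1 / Suc n" for n
  proof -
    have "Inf ((\<lambda>x. (norm x)\<^sup>2) ` {x. f x = 1}) < d + 1 / Suc n" unfolding d_def[symmetric] by simp
    then show ?thesis using cInf_lessD[of "(\<lambda>x. (norm x)\<^sup>2) ` {x. f x = 1}"] ne by auto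
  qed
  then obtain X where X: "\<And>n. f (X n) = 1" "\<And>n. (norm (X n))\<^sup>2 < d + 1 / Suc n" by metis
  have para: "(norm (X m - X n))\<^sup>2 \<le> 2 * (1 / Suc m) + 2 * (1 / Suc n)" for m n
  proof -
    have "f ((1 / 2) *\<^sub>R (X m + X n)) = 1" by (simp add: f.scaleR f.add X scaleR_conv_of_real)
    then have "d \<le> (norm ((1 / 2) *\<^sub>R (X m + X n)))\<^sup>2" by (rule d_le)
    moreover have "(norm ((1 / 2) *\<^sub>R (X m + X n)))\<^sup>2 = (norm (X m + X n))\<^sup>2 / 4"
      by (simp add: power_divide)
    ultimately have "4 * d \<le> (norm (X m + X n))\<^sup>2" by simp
    moreover have "(norm (X m - X n))\<^sup>2 + (norm (X m + X n))\<^sup>2 = 2 * (norm (X m))\<^sup>2 + 2 * (norm (X n))\<^sup>2"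
      using norm_add_square[of "X m" "X n"] norm_add_square[of "X m" "- X n"] by (simp add: cinner_minus)
    ultimately have "(norm (X m - X n))\<^sup>2 \<le> 2 * (norm (X m))\<^sup>2 + 2 * (norm (X n))\<^sup>2 - 4 * d" by linarith
    moreover have "z \<le> 2 * a + 2 * b" if "u < d + a" "v < d + b" "z \<le> 2 * u + 2 * v - 4 * d" for u v z a b :: real
      using that by linarith
    ultimately show ?thesis using X(2)[of m] X(2)[of n] by blast
  qed
  have "Cauchy X"
  proof (rule metric_CauchyI)
    fix e :: real assume e: "0 < e"
    then obtain N where N: "inverse (real (Suc N)) < e\<^sup>2 / 4"
      using reals_Archimedean[of "e\<^sup>2 / 4"] by auto
    have "dist (X m) (X n) < e" if "m \<ge> N" "n \<ge> N" for m n
    proof -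
      have "1 / real (Suc m) \<le> 1 / real (Suc N)" "1 / real (Suc n) \<le> 1 / real (Suc N)"
        using that by (intro divide_left_mono; simp)+
      then have "(norm (X m - X n))\<^sup>2 < e\<^sup>2"
        using para[of m n] N by (simp add: inverse_eq_divide)
      then show ?thesis using e by (simp add: dist_norm power2_less_imp_less)
    qed
    then show "\<exists>M. \<forall>m\<ge>M. \<forall>n\<ge>M. dist (X m) (X n) < e" by blast
  qed
  then obtain w where w: "X \<longlonglongrightarrow> w" by (auto simp: Cauchy_convergent_iff convergent_def)
  have fw: "f w = 1"
    using LIMSEQ_unique[OF f.tendsto[OF w]] X(1) by simp
  have "(norm w)\<^sup>2 \<le> d"
  proof (rule LIMSEQ_le)
    show "(\<lambda>n. (norm (X n))\<^sup>2) \<longlonglongrightarrow> (norm w)\<^sup>2" by (intro tendsto_intros w)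
    show "(\<lambda>n. d + inverse (real (Suc n))) \<longlonglongrightarrow> d"
      using tendsto_add[OF tendsto_const[of d] LIMSEQ_inverse_real_of_nat] by simp
    show "\<exists>N. \<forall>n\<ge>N. (norm (X n))\<^sup>2 \<le> d + inverse (real (Suc n))"
      using X(2) by (auto simp: inverse_eq_divide less_imp_le)
  qed
  then have min: "(norm w)\<^sup>2 \<le> (norm x)\<^sup>2" if "f x = 1" for x using d_le[OF that] by linarith
  have orth: "cinner w k = 0" if k: "f k = 0" for k
  proof (rule ccontr)
    assume "cinner w k \<noteq> 0"
    define b where "b = cinner w k"
    have b: "(cmod b)\<^sup>2 > 0" using \<open>cinner w k \<noteq> 0\<close> by (simp add: b_def)
    have q: "0 \<le> 2 * t * (cmod b)\<^sup>2 + t\<^sup>2 * (cmod b)\<^sup>2 * (norm k)\<^sup>2" for t :: real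
    proof -
      let ?c = "complex_of_real t * cnj b"
      have "(norm w)\<^sup>2 \<le> (norm (w + ?c *\<^sub>C k))\<^sup>2" by (rule min) (simp add: f.add scale k fw)
      also have "\<dots> = (norm w)\<^sup>2 + 2 * Re (?c * b) + (cmod ?c * norm k)\<^sup>2"
        by (simp add: norm_add_square cinner_scaleC_right norm_scaleC flip: b_def)
      also have "?c * b = complex_of_real t * (b * cnj b)" by (simp add: mult_ac)
      also have "\<dots> = complex_of_real (t * (cmod b)\<^sup>2)"
        by (simp only: complex_norm_square[symmetric] of_real_mult)
      finally show ?thesis by (simp add: power_mult_distrib norm_mult)
    qed
    \<comment> \<open>Any negative t that keeps 2 + t * \<open>(norm k)\<^sup>2\<close> positive
      contradicts minimality; the 1 in the denominator guards the division.\<close>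
    define t where "t = - 1 / (1 + (norm k)\<^sup>2)"
    have pos: "1 + (norm k)\<^sup>2 > 0" by (simp add: add_pos_nonneg)
    then have t: "t < 0" "1 + t * (norm k)\<^sup>2 > 0" by (simp_all add: t_def field_simps)
    have "0 \<le> (t * (cmod b)\<^sup>2) * (2 + t * (norm k)\<^sup>2)" using q[of t] by (simp add: algebra_simps power2_eq_square)
    moreover have "(t * (cmod b)\<^sup>2) * (2 + t * (norm k)\<^sup>2) < 0"
      using t b by (intro mult_neg_pos) (auto simp: mult_neg_pos)
    ultimately show False by simp
  qed
  have w0: "norm w > 0" using fw f.zero by auto
  have "f x = cinner ((1 / (norm w)\<^sup>2) *\<^sub>R w) x" for x
  proof -
    have "cinner w (x - f x *\<^sub>C w) = 0" by (rule orth) (simp add: f.diff scale fw)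
    then have "cinner w x = f x * (norm w)\<^sup>2" by (simp add: cinner_diff cinner_scaleC_right cinner_self)
    then show ?thesis using w0 by (simp add: cinner_scaleR)
  qed
  then show ?thesis by blast
qed


section \<open>Bounded operators\<close>

lemma cbounded_opsD: "T \<in> cbounded_ops \<Longrightarrow> blinfun_apply T (c *\<^sub>C \<xi>) = c *\<^sub>C blinfun_apply T \<xi>"
  by (simp add: cbounded_ops_def)

lemma blinfun_apply_scaleC: "blinfun_apply (c *\<^sub>C T) \<xi> = c *\<^sub>C blinfun_apply T \<xi>"
  by transfer simp

lemma cbounded_ops_closed:
  "T \<in> cbounded_ops \<Longrightarrow> R \<in> cbounded_ops \<Longrightarrow> T + R \<in> cbounded_ops"
  "T \<in> cbounded_ops \<Longrightarrow> R \<in> cbounded_ops \<Longrightarrow> T - R \<in> cbounded_ops"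
  "T \<in> cbounded_ops \<Longrightarrow> R \<in> cbounded_ops \<Longrightarrow> T o\<^sub>L R \<in> cbounded_ops"
  "T \<in> cbounded_ops \<Longrightarrow> c *\<^sub>C T \<in> cbounded_ops"
  "T \<in> cbounded_ops \<Longrightarrow> r *\<^sub>R T \<in> cbounded_ops"
  "0 \<in> cbounded_ops"
  by (auto simp: cbounded_ops_def blinfun.add_left blinfun.diff_left blinfun_apply_scaleC scaleC_add_right
      complex_vector.scale_right_diff_distrib scaleC_scaleC mult.commute blinfun.scaleR_left scaleR_scaleC)

lemma adjoint_exists:
  assumes T: "T \<in> cbounded_ops"
  shows "\<exists>R\<in>cbounded_ops. \<forall>\<xi> \<eta>. cinner (blinfun_apply R \<xi>) \<eta> = cinner \<xi> (blinfun_apply T \<eta>)"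
proof -
  have "\<exists>w. \<forall>\<eta>. cinner \<xi> (blinfun_apply T \<eta>) = cinner w \<eta>" for \<xi>
    by (rule Riesz_representation)
      (auto simp: cbounded_opsD[OF T] cinner_scaleC_right
        intro: bounded_linear_compose[OF bounded_linear_cinner_right blinfun.bounded_linear_right])
  then obtain r where r: "\<And>\<xi> \<eta>. cinner (r \<xi>) \<eta> = cinner \<xi> (blinfun_apply T \<eta>)" by metis
  have scale: "r (c *\<^sub>C \<xi>) = c *\<^sub>C r \<xi>" for c \<xi>
    by (rule cinner_left_ext) (simp add: r cinner_scaleC_left)
  have "bounded_linear r"
  proof (rule bounded_linear_intro[where K = "norm T"])
    show "r (x + y) = r x + r y" for x y
      by (rule cinner_left_ext) (simp add: r cinner_add_left)
    show "r (a *\<^sub>R x) = a *\<^sub>R r x" for a x by (simp add: scaleR_scaleC scale)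
    fix \<xi>
    have "(norm (r \<xi>))\<^sup>2 = Re (cinner \<xi> (blinfun_apply T (r \<xi>)))" by (simp add: r flip: Re_cinner_self)
    also have "\<dots> \<le> norm \<xi> * norm (blinfun_apply T (r \<xi>))"
      by (rule order_trans[OF complex_Re_le_cmod cinner_Cauchy_Schwarz])
    also have "\<dots> \<le> norm \<xi> * (norm T * norm (r \<xi>))" by (intro mult_left_mono norm_blinfun) simp
    finally have "norm (r \<xi>) * norm (r \<xi>) \<le> (norm \<xi> * norm T) * norm (r \<xi>)"
      by (simp add: power2_eq_square mult_ac)
    then show "norm (r \<xi>) \<le> norm \<xi> * norm T"
      by (cases "norm (r \<xi>) = 0") auto
  qed
  then have "blinfun_apply (Blinfun r) = r" by (rule bounded_linear_Blinfun_apply)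
  then show ?thesis using r scale by (intro bexI[of _ "Blinfun r"]) (auto simp: cbounded_ops_def)
qed

lemma op_adj:
  assumes "T \<in> cbounded_ops"
  shows "op_adj T \<in> cbounded_ops" "cinner (blinfun_apply (op_adj T) \<xi>) \<eta> = cinner \<xi> (blinfun_apply T \<eta>)"
    "cinner \<eta> (blinfun_apply (op_adj T) \<xi>) = cinner (blinfun_apply T \<eta>) \<xi>"
proof -
  obtain R where R: "R \<in> cbounded_ops" "\<forall>\<xi> \<eta>. cinner (blinfun_apply R \<xi>) \<eta> = cinner \<xi> (blinfun_apply T \<eta>)"
    using adjoint_exists[OF assms] by blast
  have "op_adj T = R" unfolding op_adj_def
  proof (rule the_equality)
    fix Q assume "\<forall>\<xi> \<eta>. cinner (blinfun_apply Q \<xi>) \<eta> = cinner \<xi> (blinfun_apply T \<eta>)"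
    with R show "Q = R" by (intro blinfun_eqI cinner_left_ext) auto
  qed (use R in blast)
  with R show "op_adj T \<in> cbounded_ops" "cinner (blinfun_apply (op_adj T) \<xi>) \<eta> = cinner \<xi> (blinfun_apply T \<eta>)"
    by auto
  then show "cinner \<eta> (blinfun_apply (op_adj T) \<xi>) = cinner (blinfun_apply T \<eta>) \<xi>"
    by (subst (1 2) cinner_commute) simp
qed

lemma op_adj_eqI:
  assumes "T \<in> cbounded_ops" "\<And>\<xi> \<eta>. cinner (blinfun_apply R \<xi>) \<eta> = cinner \<xi> (blinfun_apply T \<eta>)"
  shows "op_adj T = R"
  using op_adj(2)[OF assms(1)] assms(2) by (intro blinfun_eqI cinner_left_ext) auto

lemma op_posD:
  assumes "op_pos T"
  shows "T \<in> cbounded_ops" "Re (cinner \<xi> (blinfun_apply T \<xi>)) \<ge> 0"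
    "cinner \<xi> (blinfun_apply T \<xi>) = complex_of_real (Re (cinner \<xi> (blinfun_apply T \<xi>)))"
  using assms by (auto simp: op_pos_def complex_nonneg_Reals_iff complex_eq_iff)

text \<open>The form is real at \<open>\<xi> + \<eta>\<close> and at
  \<open>\<xi> + \<i> *\<^sub>C \<eta>\<close>; these give the imaginary and the real half of
  hermitian symmetry.\<close>

lemma op_pos_symmetric:
  assumes "op_pos T"
  shows "cinner (blinfun_apply T \<xi>) \<eta> = cinner \<xi> (blinfun_apply T \<eta>)"
proof -
  note T = op_posD(1)[OF assms]
  let ?B = "\<lambda>\<xi> \<eta>. cinner \<xi> (blinfun_apply T \<eta>)"
  have B: "Im (?B \<xi> \<xi>) = 0" for \<xi> using op_posD(3)[OF assms, of \<xi>] by (metis Im_complex_of_real)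
  have "Im (?B \<xi> \<eta> + ?B \<eta> \<xi>) = 0" for \<xi> \<eta>
    using B[of "\<xi> + \<eta>"] B[of \<xi>] B[of \<eta>] by (simp add: blinfun.add_right cinner_add_left cinner_add_right)
  moreover have "Re (?B \<xi> \<eta> - ?B \<eta> \<xi>) = 0" for \<xi> \<eta>
    using B[of "\<xi> + \<i> *\<^sub>C \<eta>"] B[of \<xi>] B[of \<eta>]
    by (simp add: blinfun.add_right cinner_add_left cinner_add_right cbounded_opsD[OF T]
        cinner_scaleC_left cinner_scaleC_right)
  ultimately have "?B \<xi> \<eta> = cnj (?B \<eta> \<xi>)" for \<xi> \<eta>
    by (simp add: complex_eq_iff) (metis add_eq_0_iff2 minus_complex.sel(1) eq_iff_diff_eq_0)
  then show ?thesis by (metis cinner_commute complex_cnj_cnj)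
qed

text \<open>This is Cauchy-Schwarz for the form of T itself, between T \<xi> and \<xi>. It converts
  bounds on quadratic forms into bounds on vectors.\<close>

lemma op_pos_norm_square_le:
  assumes "op_pos T"
  shows "(norm (blinfun_apply T \<xi>))\<^sup>2 \<le> norm T * Re (cinner \<xi> (blinfun_apply T \<xi>))"
proof (cases "norm (blinfun_apply T \<xi>) = 0")
  case True
  then show ?thesis using op_posD(2)[OF assms, of \<xi>] by simp
next
  case False
  note T = op_posD(1)[OF assms]
  let ?B = "\<lambda>\<xi> \<eta>. cinner \<xi> (blinfun_apply T \<eta>)" and ?x = "blinfun_apply T \<xi>"
  let ?n = "norm ?x"
  have "(cmod (?B ?x \<xi>))\<^sup>2 \<le> Re (?B ?x ?x) * Re (?B \<xi> \<xi>)"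
  proof (rule form_Cauchy_Schwarz)
    show "?B x y = cnj (?B y x)" for x y
      using op_pos_symmetric[OF assms, of x y] by (metis cinner_commute)
  qed (use op_posD(2)[OF assms] in \<open>simp_all add: blinfun.add_right cinner_add_right cbounded_opsD[OF T] cinner_scaleC_right\<close>)
  moreover have "(cmod (?B ?x \<xi>))\<^sup>2 = ?n\<^sup>2 * ?n\<^sup>2"
    by (simp only: cinner_self norm_of_real power2_eq_square) simp
  ultimately have "?n\<^sup>2 * ?n\<^sup>2 \<le> Re (?B ?x ?x) * Re (?B \<xi> \<xi>)" by simp
  also have "\<dots> \<le> (norm T * ?n\<^sup>2) * Re (?B \<xi> \<xi>)"
  proof (rule mult_right_mono)
    have "Re (?B ?x ?x) \<le> ?n * norm (blinfun_apply T ?x)"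
      by (rule order_trans[OF complex_Re_le_cmod cinner_Cauchy_Schwarz])
    also have "\<dots> \<le> ?n * (norm T * ?n)" by (intro mult_left_mono norm_blinfun) simp
    finally show "Re (?B ?x ?x) \<le> norm T * ?n\<^sup>2" by (simp add: power2_eq_square mult_ac)
  qed (rule op_posD(2)[OF assms])
  finally have "?n\<^sup>2 * ?n\<^sup>2 \<le> (norm T * Re (?B \<xi> \<xi>)) * ?n\<^sup>2"
    by (simp only: mult_ac)
  moreover have "?n\<^sup>2 > 0" using False by simp
  ultimately show ?thesis by (rule mult_right_le_imp_le)
qed

lemma op_pos_add: "op_pos T \<Longrightarrow> op_pos R \<Longrightarrow> op_pos (T + R)"
  by (simp add: op_pos_def cbounded_ops_closed blinfun.add_left cinner_add_right complex_nonneg_Reals_iff)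

lemma op_pos_scaleR: "0 \<le> r \<Longrightarrow> op_pos T \<Longrightarrow> op_pos (r *\<^sub>R T)"
  by (simp add: op_pos_def cbounded_ops_closed blinfun.scaleR_left cinner_scaleR complex_nonneg_Reals_iff)

lemma op_pos_zero: "op_pos 0"
  by (simp add: op_pos_def cbounded_ops_closed)

lemma op_eq_0_if_form_0:
  assumes "op_pos T" "\<And>\<xi>. cinner \<xi> (blinfun_apply T \<xi>) = 0"
  shows "T = 0"
  using op_pos_norm_square_le[OF assms(1)] assms(2) by (intro blinfun_eqI) simp

lemma op_leD:
  assumes "op_le T R"
  shows "Re (cinner \<xi> (blinfun_apply T \<xi>)) \<le> Re (cinner \<xi> (blinfun_apply R \<xi>))"
  using op_posD(2)[of "R - T" \<xi>] assms by (simp add: op_le_def blinfun.diff_left cinner_diff)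

lemma op_le_norm:
  assumes "op_pos T" "op_le T R"
  shows "norm T \<le> norm R"
proof -
  have "norm T \<le> sqrt (norm T * norm R)"
  proof (rule norm_blinfun_bound)
    fix \<eta>
    have "Re (cinner \<eta> (blinfun_apply T \<eta>)) \<le> Re (cinner \<eta> (blinfun_apply R \<eta>))" by (rule op_leD[OF assms(2)])
    also have "\<dots> \<le> norm \<eta> * norm (blinfun_apply R \<eta>)"
      by (rule order_trans[OF complex_Re_le_cmod cinner_Cauchy_Schwarz])
    also have "\<dots> \<le> norm \<eta> * (norm R * norm \<eta>)" by (intro mult_left_mono norm_blinfun) simp
    finally have le: "Re (cinner \<eta> (blinfun_apply T \<eta>)) \<le> norm R * (norm \<eta>)\<^sup>2"
      by (simp add: power2_eq_square mult_ac)
    have "(norm (blinfun_apply T \<eta>))\<^sup>2 \<le> norm T * Re (cinner \<eta> (blinfun_apply T \<eta>))"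
      by (rule op_pos_norm_square_le[OF assms(1)])
    also have "\<dots> \<le> norm T * (norm R * (norm \<eta>)\<^sup>2)" by (rule mult_left_mono[OF le]) simp
    also have "\<dots> = (sqrt (norm T * norm R) * norm \<eta>)\<^sup>2" by (simp add: power_mult_distrib)
    finally show "norm (blinfun_apply T \<eta>) \<le> sqrt (norm T * norm R) * norm \<eta>"
      by (rule power2_le_imp_le) simp
  qed simp
  then have "(norm T)\<^sup>2 \<le> (sqrt (norm T * norm R))\<^sup>2" by (rule power_mono) simp
  then have "norm T * norm T \<le> norm R * norm T" by (simp add: power2_eq_square mult.commute)
  then show ?thesis by (cases "norm T = 0") auto
qed

lemma op_le_trans: "op_le T R \<Longrightarrow> op_le R U \<Longrightarrow> op_le T U"
  using op_pos_add[of "R - T" "U - R"] by (simp add: op_le_def)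

lemma op_leI:
  assumes "T \<in> cbounded_ops" "R \<in> cbounded_ops"
    and "\<And>\<xi>. Im (cinner \<xi> (blinfun_apply T \<xi>)) = 0" "\<And>\<xi>. Im (cinner \<xi> (blinfun_apply R \<xi>)) = 0"
    and "\<And>\<xi>. Re (cinner \<xi> (blinfun_apply T \<xi>)) \<le> Re (cinner \<xi> (blinfun_apply R \<xi>))"
  shows "op_le T R"
  using assms by (simp add: op_le_def op_pos_def cbounded_ops_closed blinfun.diff_left cinner_diff
      complex_nonneg_Reals_iff)

lemma op_pos_Im: "op_pos T \<Longrightarrow> Im (cinner \<xi> (blinfun_apply T \<xi>)) = 0"
  using op_posD(3)[of T \<xi>] by (metis Im_complex_of_real)

lemma op_le_antisym:
  assumes "op_le T R" "op_le R T"
  shows "T = R"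
proof -
  have "op_pos (R - T)" using assms by (simp add: op_le_def)
  then have "cinner \<xi> (blinfun_apply (R - T) \<xi>) = 0" for \<xi>
    using op_leD[OF assms(1), of \<xi>] op_leD[OF assms(2), of \<xi>] op_pos_Im[of "R - T" \<xi>]
    by (simp add: complex_eq_iff blinfun.diff_left cinner_diff)
  then have "R - T = 0" using \<open>op_pos (R - T)\<close> by (intro op_eq_0_if_form_0)
  then show ?thesis by simp
qed

text \<open>For R below R' in D, \<open>op_pos_norm_square_le\<close> bounds the squared norm of (R'
  - R) \<xi> by norm B times the growth of the form. The forms increase and are bounded, so the net
  converges strongly. The clause on Q keeps the limit in every commutant containing D, and the last
  clause is what normality uses.\<close>

lemma monotone_net_limit:
  fixes D :: "('h::chilbert_space \<Rightarrow>\<^sub>L 'h) set"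
  assumes ne: "D \<noteq> {}" and pos: "\<And>R. R \<in> D \<Longrightarrow> op_pos R"
    and dir: "\<And>R R'. R \<in> D \<Longrightarrow> R' \<in> D \<Longrightarrow> \<exists>R''\<in>D. op_le R R'' \<and> op_le R' R''"
    and bound: "\<And>R. R \<in> D \<Longrightarrow> op_le R B"
  obtains T where "op_pos T" "\<And>R. R \<in> D \<Longrightarrow> op_le R T"
    "\<And>U. op_pos U \<Longrightarrow> (\<And>R. R \<in> D \<Longrightarrow> op_le R U) \<Longrightarrow> op_le T U"
    "\<And>Q. (\<And>R. R \<in> D \<Longrightarrow> R o\<^sub>L Q = Q o\<^sub>L R) \<Longrightarrow> T o\<^sub>L Q = Q o\<^sub>L T"
    "\<And>\<xi>. ennreal (Re (cinner \<xi> (blinfun_apply T \<xi>))) = (SUP R\<in>D. ennreal (Re (cinner \<xi> (blinfun_apply R \<xi>))))"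
proof -
  \<comment> \<open>The filter of tails of the directed set, along which the net is
    followed.\<close>
  define F where "F = (INF R\<in>D. principal {R'\<in>D. op_le R R'})"
  have ev: "eventually P F \<longleftrightarrow> (\<exists>R\<in>D. \<forall>R'\<in>D. op_le R R' \<longrightarrow> P R')" for P
    unfolding F_def
  proof (subst eventually_INF_base[OF ne])
    fix R R' assume "R \<in> D" "R' \<in> D"
    then obtain R'' where R'': "R'' \<in> D" "op_le R R''" "op_le R' R''" using dir by blast
    then show "\<exists>x\<in>D. principal {R'\<in>D. op_le x R'} \<le> inf (principal {R'\<in>D. op_le R R'}) (principal {R''\<in>D. op_le R' R''})"
      by (intro bexI[of _ R'']) (auto intro: op_le_trans)
  qed (auto simp: eventually_principal)
  have evD: "eventually (\<lambda>R. R \<in> D) F" using ne by (auto simp: ev)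
  have refl: "op_le R R" for R :: "'h \<Rightarrow>\<^sub>L 'h" by (simp add: op_le_def op_pos_zero)
  have nb: "F \<noteq> bot" unfolding trivial_limit_def ev using refl by blast
  have evge: "eventually (\<lambda>R'. R' \<in> D \<and> op_le R R') F" if "R \<in> D" for R using that by (auto simp: ev)
  have diff: "(norm (blinfun_apply R' \<xi> - blinfun_apply R \<xi>))\<^sup>2
      \<le> norm B * (Re (cinner \<xi> (blinfun_apply R' \<xi>)) - Re (cinner \<xi> (blinfun_apply R \<xi>)))"
    if R: "R \<in> D" "R' \<in> D" "op_le R R'" for R R' \<xi>
  proof -
    have p: "op_pos (R' - R)" using R by (simp add: op_le_def)
    have "op_pos ((B - R') + R)" using bound[OF R(2)] pos[OF R(1)] by (intro op_pos_add) (auto simp: op_le_def)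
    then have "op_le (R' - R) B" by (simp add: op_le_def algebra_simps)
    then have nB: "norm (R' - R) \<le> norm B" by (rule op_le_norm[OF p])
    have "(norm (blinfun_apply (R' - R) \<xi>))\<^sup>2 \<le> norm (R' - R) * Re (cinner \<xi> (blinfun_apply (R' - R) \<xi>))"
      by (rule op_pos_norm_square_le[OF p])
    also have "\<dots> \<le> norm B * Re (cinner \<xi> (blinfun_apply (R' - R) \<xi>))"
      by (intro mult_right_mono nB op_posD(2)[OF p])
    finally show ?thesis by (simp add: blinfun.diff_left cinner_diff)
  qed
  have "\<exists>l. ((\<lambda>R. blinfun_apply R \<xi>) \<longlongrightarrow> l) F" for \<xi>
  proof -
    let ?q = "\<lambda>R. Re (cinner \<xi> (blinfun_apply R \<xi>))"
    have bdd: "bdd_above (?q ` D)"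
      using op_leD[OF bound] by (intro bdd_aboveI[of _ "?q B"]) auto
    have "cauchy_filter (filtermap (\<lambda>R. blinfun_apply R \<xi>) F)"
      unfolding cauchy_filter_metric_filtermap
    proof (intro allI impI)
      fix e :: real assume e: "0 < e"
      \<comment> \<open>Chosen so that (norm B + 1) * \<epsilon> is the square of e / 2; the 1
        avoids division by 0.\<close>
      define \<epsilon> where "\<epsilon> = (e / 2)\<^sup>2 / (norm B + 1)"
      have nB: "norm B + 1 > 0" by (simp add: add_nonneg_pos)
      have eps: "\<epsilon> > 0" using e nB by (simp add: \<epsilon>_def)
      obtain R where R: "R \<in> D" "(SUP R\<in>D. ?q R) - \<epsilon> < ?q R"
        using less_cSUP_iff[OF ne bdd, of "(SUP R\<in>D. ?q R) - \<epsilon>"] eps by auto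
      have close: "norm (blinfun_apply R' \<xi> - blinfun_apply R \<xi>) < e / 2" if R': "R' \<in> D" "op_le R R'" for R'
      proof -
        have "?q R' \<le> (SUP R\<in>D. ?q R)" using R'(1) bdd by (rule cSUP_upper)
        then have d: "?q R' - ?q R < \<epsilon>" using R(2) by linarith
        have "(norm (blinfun_apply R' \<xi> - blinfun_apply R \<xi>))\<^sup>2 \<le> norm B * (?q R' - ?q R)"
          by (rule diff[OF R(1) R'])
        also have "\<dots> \<le> norm B * \<epsilon>" using d by (intro mult_left_mono) auto
        also have "\<dots> < (norm B + 1) * \<epsilon>" using eps by simp
        also have "\<dots> = (e / 2)\<^sup>2" using nB by (simp add: \<epsilon>_def)
        finally show ?thesis by (rule power2_less_imp_less) (use e in simp)
      qed
      have "dist (blinfun_apply R1 \<xi>) (blinfun_apply R2 \<xi>) < e"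
        if "R1 \<in> D \<and> op_le R R1" "R2 \<in> D \<and> op_le R R2" for R1 R2
        using close[of R1] close[of R2] that
          norm_triangle_ineq4[of "blinfun_apply R1 \<xi> - blinfun_apply R \<xi>" "blinfun_apply R2 \<xi> - blinfun_apply R \<xi>"]
        by (simp add: dist_norm)
      then show "\<exists>P. eventually P F \<and> (\<forall>x y. P x \<and> P y \<longrightarrow> dist (blinfun_apply x \<xi>) (blinfun_apply y \<xi>) < e)"
        using evge[OF R(1)] by (intro exI[of _ "\<lambda>R'. R' \<in> D \<and> op_le R R'"]) blast
    qed
    moreover have "filtermap (\<lambda>R. blinfun_apply R \<xi>) F \<noteq> bot" using nb by (simp add: filtermap_bot_iff)
    ultimately show ?thesis
      using complete_UNIV[where 'a = 'h] unfolding complete_uniform filterlim_def by auto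
  qed
  then obtain t where t: "\<And>\<xi>. ((\<lambda>R. blinfun_apply R \<xi>) \<longlongrightarrow> t \<xi>) F" by metis
  have "bounded_linear t"
  proof (rule bounded_linear_intro[where K = "norm B"])
    show "t (x + y) = t x + t y" for x y
      using tendsto_unique[OF nb t[of "x + y"]] tendsto_add[OF t[of x] t[of y]] by (simp add: blinfun.add_right)
    show "t (r *\<^sub>R x) = r *\<^sub>R t x" for r x
      using tendsto_unique[OF nb t[of "r *\<^sub>R x"]] tendsto_scaleR[OF tendsto_const t[of x]] by (simp add: blinfun.scaleR_right)
    show "norm (t x) \<le> norm x * norm B" for x
    proof (rule tendsto_upperbound[OF tendsto_norm[OF t] _ nb])
      show "eventually (\<lambda>R. norm (blinfun_apply R x) \<le> norm x * norm B) F"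
        using evD
      proof (rule eventually_mono)
        fix R assume R: "R \<in> D"
        have "norm (blinfun_apply R x) \<le> norm R * norm x" by (rule norm_blinfun)
        also have "\<dots> \<le> norm B * norm x" by (intro mult_right_mono op_le_norm pos bound R) simp
        finally show "norm (blinfun_apply R x) \<le> norm x * norm B" by (simp add: mult.commute)
      qed
    qed
  qed
  then have T: "blinfun_apply (Blinfun t) = t" by (rule bounded_linear_Blinfun_apply)
  have tC: "t (c *\<^sub>C x) = c *\<^sub>C t x" for c x
  proof (rule tendsto_unique[OF nb t])
    show "((\<lambda>R. blinfun_apply R (c *\<^sub>C x)) \<longlongrightarrow> c *\<^sub>C t x) F"
      using tendsto_scaleC_right[OF t[of x], of c]
      by (rule Lim_transform_eventually)
        (rule eventually_mono[OF evD], simp add: cbounded_opsD[OF op_posD(1)[OF pos]])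
  qed
  then have Tc: "Blinfun t \<in> cbounded_ops" by (simp add: cbounded_ops_def T)
  have form: "((\<lambda>R. cinner \<xi> (blinfun_apply R \<xi>)) \<longlongrightarrow> cinner \<xi> (t \<xi>)) F" for \<xi>
    by (rule tendsto_cinner_right[OF t])
  have Im: "Im (cinner \<xi> (t \<xi>)) = 0" for \<xi>
  proof (rule tendsto_unique[OF nb tendsto_Im[OF form]])
    show "((\<lambda>R. Im (cinner \<xi> (blinfun_apply R \<xi>))) \<longlongrightarrow> 0) F"
      by (rule tendsto_eventually) (rule eventually_mono[OF evD], rule op_pos_Im[OF pos])
  qed
  have ge: "Re (cinner \<xi> (blinfun_apply R \<xi>)) \<le> Re (cinner \<xi> (t \<xi>))" if "R \<in> D" for R \<xi>
    by (rule tendsto_lowerbound[OF tendsto_Re[OF form] _ nb])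
      (rule eventually_mono[OF evge[OF that]], simp add: op_leD)
  have le: "Re (cinner \<xi> (t \<xi>)) \<le> Re (cinner \<xi> (blinfun_apply U \<xi>))" if "\<And>R. R \<in> D \<Longrightarrow> op_le R U" for U \<xi>
    by (rule tendsto_upperbound[OF tendsto_Re[OF form] _ nb])
      (rule eventually_mono[OF evD], rule op_leD[OF that])
  show thesis
  proof (rule that[of "Blinfun t"])
    obtain R where R: "R \<in> D" using ne by blast
    have "Re (cinner \<xi> (t \<xi>)) \<ge> 0" for \<xi>
      using ge[OF R, of \<xi>] op_posD(2)[OF pos[OF R], of \<xi>] by linarith
    then show "op_pos (Blinfun t)" using Tc Im by (simp add: op_pos_def T complex_nonneg_Reals_iff)
    show "op_le R (Blinfun t)" if "R \<in> D" for R
      using Tc Im ge[OF that] op_posD(1)[OF pos[OF that]] op_pos_Im[OF pos[OF that]] by (intro op_leI) (simp_all add: T)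
    show "op_le (Blinfun t) U" if "op_pos U" "\<And>R. R \<in> D \<Longrightarrow> op_le R U" for U
      using Tc Im le[OF that(2)] op_posD(1)[OF that(1)] op_pos_Im[OF that(1)] by (intro op_leI) (simp_all add: T)
    show "Blinfun t o\<^sub>L Q = Q o\<^sub>L Blinfun t" if "\<And>R. R \<in> D \<Longrightarrow> R o\<^sub>L Q = Q o\<^sub>L R" for Q
    proof (rule blinfun_eqI)
      fix \<xi>
      have "((\<lambda>R. blinfun_apply Q (blinfun_apply R \<xi>)) \<longlongrightarrow> blinfun_apply Q (t \<xi>)) F"
        by (rule bounded_linear.tendsto[OF blinfun.bounded_linear_right t])
      moreover have "eventually (\<lambda>R. blinfun_apply Q (blinfun_apply R \<xi>) = blinfun_apply R (blinfun_apply Q \<xi>)) F"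
        using evD
      proof (rule eventually_mono)
        fix R assume "R \<in> D"
        then show "blinfun_apply Q (blinfun_apply R \<xi>) = blinfun_apply R (blinfun_apply Q \<xi>)"
          using arg_cong[OF that, of R "\<lambda>A. blinfun_apply A \<xi>"] by simp
      qed
      ultimately have "((\<lambda>R. blinfun_apply R (blinfun_apply Q \<xi>)) \<longlongrightarrow> blinfun_apply Q (t \<xi>)) F"
        by (rule Lim_transform_eventually)
      then have "t (blinfun_apply Q \<xi>) = blinfun_apply Q (t \<xi>)" by (rule tendsto_unique[OF nb t])
      then show "blinfun_apply (Blinfun t o\<^sub>L Q) \<xi> = blinfun_apply (Q o\<^sub>L Blinfun t) \<xi>" by (simp add: T)
    qed
    show "ennreal (Re (cinner \<xi> (blinfun_apply (Blinfun t) \<xi>))) = (SUP R\<in>D. ennreal (Re (cinner \<xi> (blinfun_apply R \<xi>))))" for \<xi>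
    proof (rule antisym)
      show "ennreal (Re (cinner \<xi> (blinfun_apply (Blinfun t) \<xi>))) \<le> (SUP R\<in>D. ennreal (Re (cinner \<xi> (blinfun_apply R \<xi>))))"
        unfolding T
        by (rule tendsto_upperbound[OF tendsto_ennrealI[OF tendsto_Re[OF form]] _ nb])
          (rule eventually_mono[OF evD], rule SUP_upper)
      show "(SUP R\<in>D. ennreal (Re (cinner \<xi> (blinfun_apply R \<xi>)))) \<le> ennreal (Re (cinner \<xi> (blinfun_apply (Blinfun t) \<xi>)))"
        unfolding T by (intro SUP_least ennreal_leI ge)
    qed
  qed
qed

lemma commutant_closed:
  assumes M: "M \<subseteq> cbounded_ops" and T: "T \<in> commutant M"
  shows "R \<in> commutant M \<Longrightarrow> T + R \<in> commutant M" "R \<in> commutant M \<Longrightarrow> T o\<^sub>L R \<in> commutant M"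
    "c *\<^sub>C T \<in> commutant M" "r *\<^sub>R T \<in> commutant M"
proof -
  have ap: "blinfun_apply A (blinfun_apply Q \<xi>) = blinfun_apply Q (blinfun_apply A \<xi>)"
    if "A \<in> commutant M" "Q \<in> M" for A Q \<xi>
  proof -
    have "A o\<^sub>L Q = Q o\<^sub>L A" using that by (simp add: commutant_def)
    from arg_cong[OF this, of "\<lambda>A. blinfun_apply A \<xi>"] show ?thesis by simp
  qed
  have cb: "A \<in> cbounded_ops" if "A \<in> commutant M" for A using that by (simp add: commutant_def)
  have I: "A \<in> commutant M" if "A \<in> cbounded_ops"
    "\<And>Q \<xi>. Q \<in> M \<Longrightarrow> blinfun_apply A (blinfun_apply Q \<xi>) = blinfun_apply Q (blinfun_apply A \<xi>)" for A
    using that by (auto simp: commutant_def intro!: blinfun_eqI)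
  show "c *\<^sub>C T \<in> commutant M" "r *\<^sub>R T \<in> commutant M"
    using M by (auto intro!: I simp: cbounded_ops_closed cb T blinfun_apply_scaleC ap[OF T] cbounded_opsD
        blinfun.scaleR_left blinfun.scaleR_right subset_iff)
  assume R: "R \<in> commutant M"
  show "T + R \<in> commutant M" "T o\<^sub>L R \<in> commutant M"
    by (auto intro!: I simp: cbounded_ops_closed cb T R blinfun.add_left blinfun.add_right ap[OF T] ap[OF R])
qed

lemma bicommutant_extensive: "M \<subseteq> cbounded_ops \<Longrightarrow> M \<subseteq> commutant (commutant M)"
  by (auto simp: commutant_def)


section \<open>Unordered sums in the extended nonnegative reals\<close>

text \<open>This is \<open>infsum\<close> for \<open>ennreal\<close> terms, kept as a supremum so
  that it can be exchanged with directed suprema.\<close>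

definition esum :: "'i set \<Rightarrow> ('i \<Rightarrow> ennreal) \<Rightarrow> ennreal" where
  "esum A f = (SUP F\<in>{F. finite F \<and> F \<subseteq> A}. sum f F)"

lemma infsum_eq_esum: "infsum f A = esum A f"
  unfolding esum_def by (rule nonneg_infsum_complete) simp

lemma esum_cong: "(\<And>i. i \<in> A \<Longrightarrow> f i = g i) \<Longrightarrow> esum A f = esum A g"
  unfolding esum_def by (intro SUP_cong refl sum.cong) auto

lemma esum_mono: "(\<And>i. i \<in> A \<Longrightarrow> f i \<le> g i) \<Longrightarrow> esum A f \<le> esum A g"
  unfolding esum_def by (intro SUP_mono) (auto intro!: sum_mono)

lemma sum_SUP_directed_ennreal:
  fixes g :: "'i \<Rightarrow> 'd \<Rightarrow> ennreal"
  assumes "finite F" "D \<noteq> {}"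
    and "\<And>d d'. d \<in> D \<Longrightarrow> d' \<in> D \<Longrightarrow> \<exists>d''\<in>D. \<forall>i\<in>F. g i d \<le> g i d'' \<and> g i d' \<le> g i d''"
  shows "(\<Sum>i\<in>F. SUP d\<in>D. g i d) = (SUP d\<in>D. \<Sum>i\<in>F. g i d)"
  using assms(1,3)
proof (induction F rule: finite_induct)
  case empty
  then show ?case using assms(2) by simp
next
  case (insert j F)
  have "(SUP d\<in>D. g j d + (\<Sum>i\<in>F. g i d)) = (SUP d\<in>D. g j d) + (SUP d\<in>D. \<Sum>i\<in>F. g i d)"
  proof (rule SUP_add_directed_ennreal)
    fix d d' assume "d \<in> D" "d' \<in> D"
    then obtain e where e: "e \<in> D" "\<forall>i\<in>insert j F. g i d \<le> g i e \<and> g i d' \<le> g i e" using insert.prems by blast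
    then show "\<exists>k\<in>D. g j d + (\<Sum>i\<in>F. g i d') \<le> g j k + (\<Sum>i\<in>F. g i k)"
      by (intro bexI[of _ e] add_mono sum_mono) auto
  qed
  moreover have "(\<Sum>i\<in>F. SUP d\<in>D. g i d) = (SUP d\<in>D. \<Sum>i\<in>F. g i d)"
  proof (rule insert.IH)
    fix d d' assume "d \<in> D" "d' \<in> D"
    from insert.prems[OF this] show "\<exists>d''\<in>D. \<forall>i\<in>F. g i d \<le> g i d'' \<and> g i d' \<le> g i d''" by blast
  qed
  ultimately show ?case using insert.hyps by simp
qed

lemma esum_SUP_directed:
  assumes "D \<noteq> {}" "\<And>d d'. d \<in> D \<Longrightarrow> d' \<in> D \<Longrightarrow> \<exists>d''\<in>D. \<forall>i\<in>A. g i d \<le> g i d'' \<and> g i d' \<le> g i d''"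
  shows "esum A (\<lambda>i. SUP d\<in>D. g i d) = (SUP d\<in>D. esum A (\<lambda>i. g i d))"
proof -
  have "(\<Sum>i\<in>F. SUP d\<in>D. g i d) = (SUP d\<in>D. \<Sum>i\<in>F. g i d)" if "finite F" "F \<subseteq> A" for F
  proof (rule sum_SUP_directed_ennreal[OF that(1) assms(1)])
    fix d d' assume "d \<in> D" "d' \<in> D"
    from assms(2)[OF this] obtain e where "e \<in> D" "\<forall>i\<in>A. g i d \<le> g i e \<and> g i d' \<le> g i e" by blast
    then show "\<exists>d''\<in>D. \<forall>i\<in>F. g i d \<le> g i d'' \<and> g i d' \<le> g i d''" using that(2) by blast
  qed
  then have "esum A (\<lambda>i. SUP d\<in>D. g i d) = (SUP F\<in>{F. finite F \<and> F \<subseteq> A}. SUP d\<in>D. \<Sum>i\<in>F. g i d)"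
    unfolding esum_def by (intro SUP_cong) auto
  then show ?thesis unfolding esum_def by (simp add: SUP_commute[of _ D])
qed

text \<open>Tonelli for sums: the inner sum is a supremum over the directed family of finite subsets
  and moves out of the outer sum, leaving a finite sum to commute.\<close>

lemma esum_swap: "esum A (\<lambda>i. esum B (f i)) = esum B (\<lambda>j. esum A (\<lambda>i. f i j))"
proof -
  have "esum A (\<lambda>i. esum B (f i)) = (SUP G\<in>{G. finite G \<and> G \<subseteq> B}. esum A (\<lambda>i. sum (f i) G))"
    unfolding esum_def[of B]
  proof (rule esum_SUP_directed)
    fix G H assume "G \<in> {G. finite G \<and> G \<subseteq> B}" "H \<in> {G. finite G \<and> G \<subseteq> B}"
    then show "\<exists>K\<in>{G. finite G \<and> G \<subseteq> B}. \<forall>i\<in>A. sum (f i) G \<le> sum (f i) K \<and> sum (f i) H \<le> sum (f i) K"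
      by (intro bexI[of _ "G \<union> H"]) (auto intro!: sum_mono2)
  qed auto
  also have "\<dots> = (SUP G\<in>{G. finite G \<and> G \<subseteq> B}. \<Sum>j\<in>G. esum A (\<lambda>i. f i j))"
  proof (rule SUP_cong)
    fix G assume G: "G \<in> {G. finite G \<and> G \<subseteq> B}"
    have "(\<Sum>j\<in>G. esum A (\<lambda>i. f i j)) = (SUP F\<in>{F. finite F \<and> F \<subseteq> A}. \<Sum>j\<in>G. \<Sum>i\<in>F. f i j)"
      unfolding esum_def
    proof (rule sum_SUP_directed_ennreal)
      fix F H assume "F \<in> {F. finite F \<and> F \<subseteq> A}" "H \<in> {F. finite F \<and> F \<subseteq> A}"
      then show "\<exists>K\<in>{F. finite F \<and> F \<subseteq> A}. \<forall>j\<in>G. (\<Sum>i\<in>F. f i j) \<le> (\<Sum>i\<in>K. f i j) \<and> (\<Sum>i\<in>H. f i j) \<le> (\<Sum>i\<in>K. f i j)"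
        by (intro bexI[of _ "F \<union> H"]) (auto intro!: sum_mono2)
    qed (use G in auto)
    also have "\<dots> = esum A (\<lambda>i. sum (f i) G)" unfolding esum_def by (subst sum.swap) simp
    finally show "esum A (\<lambda>i. sum (f i) G) = (\<Sum>j\<in>G. esum A (\<lambda>i. f i j))" by simp
  qed simp
  finally show ?thesis unfolding esum_def[of B] .
qed

lemma esum_add: "esum A (\<lambda>i. f i + g i) = esum A f + esum A g"
  unfolding esum_def sum.distrib
proof (rule SUP_add_directed_ennreal)
  fix F H assume "F \<in> {F. finite F \<and> F \<subseteq> A}" "H \<in> {F. finite F \<and> F \<subseteq> A}"
  then show "\<exists>K\<in>{F. finite F \<and> F \<subseteq> A}. sum f F + sum g H \<le> sum f K + sum g K"
    by (intro bexI[of _ "F \<union> H"] add_mono) (auto intro!: sum_mono2)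
qed

lemma esum_cmult: "esum A (\<lambda>i. c * f i) = c * esum A f"
  unfolding esum_def by (simp add: SUP_mult_left_ennreal flip: sum_distrib_left)

lemma esum_eq_0D: "esum A f = 0 \<Longrightarrow> i \<in> A \<Longrightarrow> f i = 0"
  using SUP_upper[of "{i}" "{F. finite F \<and> F \<subseteq> A}" "sum f"] by (simp add: esum_def)

lemma esum_Times_bool: "esum (A \<times> (UNIV :: bool set)) f = esum A (\<lambda>a. f (a, False) + f (a, True))"
proof (rule antisym)
  have sum_eq: "sum f (F \<times> (UNIV :: bool set)) = (\<Sum>a\<in>F. f (a, False) + f (a, True))" for F
  proof -
    have "sum f (F \<times> (UNIV :: bool set)) = (\<Sum>a\<in>F. \<Sum>b\<in>UNIV. f (a, b))" by (simp add: sum.cartesian_product)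
    then show ?thesis by (simp add: UNIV_bool)
  qed
  show "esum (A \<times> UNIV) f \<le> esum A (\<lambda>a. f (a, False) + f (a, True))"
    unfolding esum_def
  proof (rule SUP_mono)
    fix G assume "G \<in> {G. finite G \<and> G \<subseteq> A \<times> (UNIV :: bool set)}"
    then show "\<exists>F\<in>{F. finite F \<and> F \<subseteq> A}. sum f G \<le> (\<Sum>a\<in>F. f (a, False) + f (a, True))"
      unfolding sum_eq[symmetric] by (intro bexI[of _ "fst ` G"] sum_mono2) (auto intro: rev_image_eqI)
  qed
  show "esum A (\<lambda>a. f (a, False) + f (a, True)) \<le> esum (A \<times> UNIV) f"
    unfolding esum_def sum_eq[symmetric]
  proof (rule SUP_mono)
    fix F assume "F \<in> {F. finite F \<and> F \<subseteq> A}"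
    then show "\<exists>G\<in>{G. finite G \<and> G \<subseteq> A \<times> (UNIV :: bool set)}. sum f (F \<times> UNIV) \<le> sum f G"
      by (intro bexI[of _ "F \<times> UNIV"]) auto
  qed
qed


section \<open>The von Neumann algebra of the module\<close>

locale graph_trace_hilbert = graph_trace E p S \<tau>
  for E :: "('v, 'e) pre_digraph" and p :: "'v \<Rightarrow> 'a::cstar_algebra" and S :: "'e \<Rightarrow> 'a"
    and \<tau> :: "'a \<Rightarrow> ennreal" +
  fixes \<iota> :: "'a \<Rightarrow> 'h::chilbert_space"
  assumes completion: "hilbert_completion E p S \<tau> \<iota>"
begin

section \<open>The Hilbert space and bounded extension from its dense subspace\<close>

lemma iota_add: "x \<in> Ac \<Longrightarrow> y \<in> Ac \<Longrightarrow> \<iota> (x + y) = \<iota> x + \<iota> y"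
  and iota_scaleC: "x \<in> Ac \<Longrightarrow> \<iota> (c *\<^sub>C x) = c *\<^sub>C \<iota> x"
  and iota_dense: "closure (\<iota> ` Ac) = UNIV"
  using completion by (simp_all add: hilbert_completion_def)

lemma cinner_iota: "x \<in> Ac \<Longrightarrow> y \<in> Ac \<Longrightarrow> cinner (\<iota> x) (\<iota> y) = tr (star x * y)"
  using completion by (simp add: hilbert_completion_def module_inner_def tr_Phi Ac_mult Ac_star)

lemma iota_zero: "\<iota> 0 = 0"
  using iota_scaleC[OF Ac_zero, of 0] by simp

lemma iota_diff: "x \<in> Ac \<Longrightarrow> y \<in> Ac \<Longrightarrow> \<iota> (x - y) = \<iota> x - \<iota> y"
  using iota_add[of x "(-1) *\<^sub>C y"] iota_scaleC[of y "-1"] Ac_scaleC[of y "-1"] by (simp add: minus_one_scaleC)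

lemma iota_sum: "(\<And>i. i \<in> I \<Longrightarrow> f i \<in> Ac) \<Longrightarrow> \<iota> (sum f I) = (\<Sum>i\<in>I. \<iota> (f i))"
  by (induction I rule: infinite_finite_induct) (auto simp: iota_zero iota_add Ac_sum)

lemma norm_iota_square: "x \<in> Ac \<Longrightarrow> (norm (\<iota> x))\<^sup>2 = W.wt (star x * x)"
  using cinner_iota[of x x] by (simp add: tr_star_mult cinner_self flip: of_real_power)

lemma norm_iota_star:
  assumes "x \<in> Ac"
  shows "norm (\<iota> (star x)) = norm (\<iota> x)"
proof -
  have "(norm (\<iota> (star x)))\<^sup>2 = (norm (\<iota> x))\<^sup>2"
    using assms wt_star_swap[of x] by (simp add: norm_iota_square Ac_star star_star)
  then show ?thesis by simp
qed

lemma norm_iota_mult_left: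
  assumes "x \<in> Ac" "y \<in> Ac"
  shows "norm (\<iota> (x * y)) \<le> norm x * norm (\<iota> y)"
proof (rule power2_le_imp_le)
  show "(norm (\<iota> (x * y)))\<^sup>2 \<le> (norm x * norm (\<iota> y))\<^sup>2"
    using wt_mult_left_le[OF assms] assms by (simp add: norm_iota_square Ac_mult power_mult_distrib)
qed simp

lemma norm_iota_mult_right:
  assumes "x \<in> Ac" "y \<in> Ac"
  shows "norm (\<iota> (y * x)) \<le> norm x * norm (\<iota> y)"
proof (rule power2_le_imp_le)
  show "(norm (\<iota> (y * x)))\<^sup>2 \<le> (norm x * norm (\<iota> y))\<^sup>2"
    using wt_mult_right_le[OF assms] assms by (simp add: norm_iota_square Ac_mult power_mult_distrib)
qed simp

text \<open>On the Hilbert space Phi thus acts as the orthogonal projection onto the closure of the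
  image of \<open>Fc\<close>, whence its contractivity.\<close>

lemma cinner_iota_Phi:
  assumes "f \<in> Fc" "x \<in> Ac"
  shows "cinner (\<iota> f) (\<iota> (Phi x)) = cinner (\<iota> f) (\<iota> x)"
proof -
  have "tr (star f * Phi x) = tr (Phi (star f * x))" by (simp add: Phi_mult_left Fc_star assms)
  also have "\<dots> = tr (star f * x)" by (simp add: tr_Phi Ac_mult Ac_star FcD assms)
  finally show ?thesis using assms by (simp add: cinner_iota FcD Phi_Ac)
qed

lemma norm_iota_Phi:
  assumes "x \<in> Ac"
  shows "norm (\<iota> (Phi x)) \<le> norm (\<iota> x)"
proof (cases "norm (\<iota> (Phi x)) = 0")
  case False
  have "(norm (\<iota> (Phi x)))\<^sup>2 = Re (cinner (\<iota> (Phi x)) (\<iota> x))"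
    using cinner_iota_Phi[OF Phi_Fc[OF assms] assms] by (simp flip: Re_cinner_self)
  also have "\<dots> \<le> norm (\<iota> (Phi x)) * norm (\<iota> x)"
    by (rule order_trans[OF complex_Re_le_cmod cinner_Cauchy_Schwarz])
  finally show ?thesis using False by (simp add: power2_eq_square)
qed simp

lemma iota_approx:
  obtains X where "\<And>n. X n \<in> Ac" "(\<lambda>n. \<iota> (X n)) \<longlonglongrightarrow> \<xi>"
proof -
  have "\<xi> \<in> closure (\<iota> ` Ac)" by (simp add: iota_dense)
  then obtain Y where Y: "\<forall>n. Y n \<in> \<iota> ` Ac" "Y \<longlonglongrightarrow> \<xi>" unfolding closure_sequential by blast
  from Y(1) have "\<forall>n. \<exists>x. x \<in> Ac \<and> Y n = \<iota> x" by blast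
  from choice[OF this] obtain X where X: "\<forall>n. X n \<in> Ac \<and> Y n = \<iota> (X n)" by blast
  then have "Y = (\<lambda>n. \<iota> (X n))" by (simp add: fun_eq_iff)
  then have "(\<lambda>n. \<iota> (X n)) \<longlonglongrightarrow> \<xi>" using Y(2) by simp
  then show thesis using X by (intro that[of X]) simp_all
qed

lemma bounded_linear_ext:
  assumes "bounded_linear F" "bounded_linear G" "\<And>x. x \<in> Ac \<Longrightarrow> F (\<iota> x) = G (\<iota> x)"
  shows "F \<xi> = G \<xi>"
proof -
  obtain X where X: "\<And>n. X n \<in> Ac" "(\<lambda>n. \<iota> (X n)) \<longlonglongrightarrow> \<xi>" by (rule iota_approx[of \<xi>]) blast
  have "(\<lambda>n. F (\<iota> (X n))) \<longlonglongrightarrow> G \<xi>"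
    unfolding assms(3)[OF X(1)] by (rule bounded_linear.tendsto[OF assms(2) X(2)])
  with bounded_linear.tendsto[OF assms(1) X(2)] show ?thesis by (rule LIMSEQ_unique)
qed

lemma blinfun_ext:
  assumes "\<And>x. x \<in> Ac \<Longrightarrow> blinfun_apply T (\<iota> x) = blinfun_apply R (\<iota> x)"
  shows "T = R"
  by (rule blinfun_eqI)
    (rule bounded_linear_ext[OF blinfun.bounded_linear_right blinfun.bounded_linear_right assms])

lemma operator_extension:
  assumes add: "\<And>x y. x \<in> Ac \<Longrightarrow> y \<in> Ac \<Longrightarrow> g (x + y) = g x + g y"
    and scale: "\<And>c x. x \<in> Ac \<Longrightarrow> g (c *\<^sub>C x) = c *\<^sub>C g x"
    and bound: "\<And>x. x \<in> Ac \<Longrightarrow> norm (g x) \<le> K * norm (\<iota> x)" and K: "0 \<le> K"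
  shows "\<exists>T\<in>cbounded_ops. \<forall>x\<in>Ac. blinfun_apply T (\<iota> x) = (g x :: 'h)"
proof -
  have dist: "norm (g x - g y) \<le> K * norm (\<iota> x - \<iota> y)" if "x \<in> Ac" "y \<in> Ac" for x y
  proof -
    have "g (x - y) = g x - g y"
      using add[of x "(-1) *\<^sub>C y"] scale[of y "-1"] that Ac_scaleC[of y "-1"] by (simp add: minus_one_scaleC)
    then show ?thesis using bound[of "x - y"] that by (simp add: Ac_diff iota_diff)
  qed
  \<comment> \<open>\<open>inv_into\<close> picks some preimage; the estimate \<open>dist\<close>
    shows that g depends only on the image under \<iota>.\<close>
  define h where "h \<xi> = g (inv_into Ac \<iota> \<xi>)" for \<xi>
  have h: "h (\<iota> x) = g x" if "x \<in> Ac" for x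
    using dist[of "inv_into Ac \<iota> (\<iota> x)" x] that inv_into_into[of "\<iota> x" \<iota> Ac] f_inv_into_f[of "\<iota> x" \<iota> Ac]
    by (simp add: h_def)
  have "K-lipschitz_on (\<iota> ` Ac) h"
    using dist K by (intro lipschitz_onI) (auto simp: h dist_norm)
  then have "uniformly_continuous_on (\<iota> ` Ac) h" by (rule lipschitz_on_uniformly_continuous)
  then obtain k where k: "uniformly_continuous_on (closure (\<iota> ` Ac)) k" "\<And>\<xi>. \<xi> \<in> \<iota> ` Ac \<Longrightarrow> h \<xi> = k \<xi>"
    by (rule uniformly_continuous_on_extension_on_closure) blast
  have k_eq: "k (\<iota> x) = g x" if "x \<in> Ac" for x using k(2)[of "\<iota> x"] h that by simp
  have "continuous_on UNIV k" using uniformly_continuous_imp_continuous[OF k(1)] by (simp add: iota_dense)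
  then have cont: "(\<lambda>n. k (Y n)) \<longlonglongrightarrow> k \<xi>" if "Y \<longlonglongrightarrow> \<xi>" for Y \<xi>
    using that by (intro continuous_on_tendsto_compose[of UNIV k]) auto
  have lim: "(\<lambda>n. g (X n)) \<longlonglongrightarrow> k \<xi>" if "\<And>n. X n \<in> Ac" "(\<lambda>n. \<iota> (X n)) \<longlonglongrightarrow> \<xi>" for X \<xi>
    using cont[OF that(2)] by (simp add: k_eq that(1))
  have kadd: "k (\<xi> + \<eta>) = k \<xi> + k \<eta>" for \<xi> \<eta>
  proof -
    obtain X where X: "\<And>n. X n \<in> Ac" "(\<lambda>n. \<iota> (X n)) \<longlonglongrightarrow> \<xi>" by (rule iota_approx[of \<xi>]) blast
    obtain Y where Y: "\<And>n. Y n \<in> Ac" "(\<lambda>n. \<iota> (Y n)) \<longlonglongrightarrow> \<eta>" by (rule iota_approx[of \<eta>]) blast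
    have "(\<lambda>n. \<iota> (X n + Y n)) \<longlonglongrightarrow> \<xi> + \<eta>" using tendsto_add[OF X(2) Y(2)] by (simp add: iota_add X Y)
    then have "(\<lambda>n. g (X n + Y n)) \<longlonglongrightarrow> k (\<xi> + \<eta>)" by (intro lim Ac_add X Y)
    moreover have "(\<lambda>n. g (X n + Y n)) \<longlonglongrightarrow> k \<xi> + k \<eta>"
      using tendsto_add[OF lim[OF X] lim[OF Y]] by (simp add: add X Y)
    ultimately show ?thesis by (rule LIMSEQ_unique)
  qed
  have kscale: "k (c *\<^sub>C \<xi>) = c *\<^sub>C k \<xi>" for c \<xi>
  proof -
    obtain X where X: "\<And>n. X n \<in> Ac" "(\<lambda>n. \<iota> (X n)) \<longlonglongrightarrow> \<xi>" by (rule iota_approx[of \<xi>]) blast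
    have "(\<lambda>n. \<iota> (c *\<^sub>C X n)) \<longlonglongrightarrow> c *\<^sub>C \<xi>" using tendsto_scaleC_right[OF X(2)] by (simp add: iota_scaleC X)
    then have "(\<lambda>n. g (c *\<^sub>C X n)) \<longlonglongrightarrow> k (c *\<^sub>C \<xi>)" by (intro lim Ac_scaleC X)
    moreover have "(\<lambda>n. g (c *\<^sub>C X n)) \<longlonglongrightarrow> c *\<^sub>C k \<xi>"
      using tendsto_scaleC_right[OF lim[OF X]] by (simp add: scale X)
    ultimately show ?thesis by (rule LIMSEQ_unique)
  qed
  have "norm (k \<xi>) \<le> norm \<xi> * K" for \<xi>
  proof -
    obtain X where X: "\<And>n. X n \<in> Ac" "(\<lambda>n. \<iota> (X n)) \<longlonglongrightarrow> \<xi>" by (rule iota_approx[of \<xi>]) blast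
    show ?thesis
      by (rule LIMSEQ_le[OF tendsto_norm[OF lim[OF X]] tendsto_mult_right[OF tendsto_norm[OF X(2)]]])
        (use bound[OF X(1)] in \<open>auto simp: mult.commute\<close>)
  qed
  then have "bounded_linear k"
    by (intro bounded_linear_intro[where K = K]) (auto simp: kadd kscale scaleR_scaleC)
  then have "blinfun_apply (Blinfun k) = k" by (rule bounded_linear_Blinfun_apply)
  then show ?thesis by (intro bexI[of _ "Blinfun k"]) (auto simp: k_eq cbounded_ops_def kscale)
qed

text \<open>\<open>coeff_op y\<close> is the map \<open>z \<mapsto> (y|z)\<^sub>R\<close>.\<close>

definition "ext_op g = (SOME T. T \<in> cbounded_ops \<and> (\<forall>x\<in>Ac. blinfun_apply T (\<iota> x) = (g x :: 'h)))"
definition "left_op x = ext_op (\<lambda>z. \<iota> (x * z))"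
definition "right_op f = ext_op (\<lambda>z. \<iota> (z * f))"
definition "coeff_op y = ext_op (\<lambda>z. \<iota> (Phi (star y * z)))"

lemma ext_op:
  assumes "\<exists>T\<in>cbounded_ops. \<forall>x\<in>Ac. blinfun_apply T (\<iota> x) = (g x :: 'h)"
  shows "ext_op g \<in> cbounded_ops" "x \<in> Ac \<Longrightarrow> blinfun_apply (ext_op g) (\<iota> x) = g x"
  using someI_ex[of "\<lambda>T. T \<in> cbounded_ops \<and> (\<forall>x\<in>Ac. blinfun_apply T (\<iota> x) = g x)"] assms
  unfolding ext_op_def by blast+

lemma left_op:
  assumes "x \<in> Ac"
  shows "left_op x \<in> cbounded_ops" "z \<in> Ac \<Longrightarrow> blinfun_apply (left_op x) (\<iota> z) = \<iota> (x * z)"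
proof -
  have "\<exists>T\<in>cbounded_ops. \<forall>z\<in>Ac. blinfun_apply T (\<iota> z) = \<iota> (x * z)"
    by (rule operator_extension[where K = "norm x"])
      (auto simp: distrib_left iota_add iota_scaleC mult_scaleC_right Ac_mult assms norm_iota_mult_left)
  from ext_op[OF this] show "left_op x \<in> cbounded_ops" "z \<in> Ac \<Longrightarrow> blinfun_apply (left_op x) (\<iota> z) = \<iota> (x * z)"
    by (auto simp: left_op_def)
qed

lemma right_op:
  assumes "x \<in> Ac"
  shows "right_op x \<in> cbounded_ops" "z \<in> Ac \<Longrightarrow> blinfun_apply (right_op x) (\<iota> z) = \<iota> (z * x)"
proof -
  have "\<exists>T\<in>cbounded_ops. \<forall>z\<in>Ac. blinfun_apply T (\<iota> z) = \<iota> (z * x)"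
    by (rule operator_extension[where K = "norm x"])
      (auto simp: distrib_right iota_add iota_scaleC mult_scaleC_left Ac_mult assms norm_iota_mult_right)
  from ext_op[OF this] show "right_op x \<in> cbounded_ops" "z \<in> Ac \<Longrightarrow> blinfun_apply (right_op x) (\<iota> z) = \<iota> (z * x)"
    by (auto simp: right_op_def)
qed

lemma coeff_op:
  assumes y: "y \<in> Ac"
  shows "coeff_op y \<in> cbounded_ops" "z \<in> Ac \<Longrightarrow> blinfun_apply (coeff_op y) (\<iota> z) = \<iota> (Phi (star y * z))"
proof -
  have "\<exists>T\<in>cbounded_ops. \<forall>z\<in>Ac. blinfun_apply T (\<iota> z) = \<iota> (Phi (star y * z))"
  proof (rule operator_extension[where K = "norm y"])
    fix x assume x: "x \<in> Ac"
    have "norm (\<iota> (Phi (star y * x))) \<le> norm (\<iota> (star y * x))" by (intro norm_iota_Phi Ac_mult Ac_star x y)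
    also have "\<dots> \<le> norm y * norm (\<iota> x)" using norm_iota_mult_left[OF Ac_star[OF y] x] by simp
    finally show "norm (\<iota> (Phi (star y * x))) \<le> norm y * norm (\<iota> x)" .
  qed (auto simp: distrib_left iota_add iota_scaleC mult_scaleC_right Phi_add Phi_scaleC Phi_Ac Ac_mult Ac_star y)
  from ext_op[OF this] show "coeff_op y \<in> cbounded_ops"
    "z \<in> Ac \<Longrightarrow> blinfun_apply (coeff_op y) (\<iota> z) = \<iota> (Phi (star y * z))"
    by (auto simp: coeff_op_def)
qed

abbreviation "Th \<equiv> Theta E p S \<iota>"
abbreviation "N \<equiv> vN_alg E p S \<iota>"

text \<open>The factorization supplies the bounded extension that the definite description asks for,
  and density makes it unique.\<close>

lemma Theta_eq:
  assumes "x \<in> Ac" "y \<in> Ac"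
  shows "Th x y = left_op x o\<^sub>L coeff_op y"
  unfolding Theta_def
proof (rule the_equality)
  show *: "left_op x o\<^sub>L coeff_op y \<in> cbounded_ops \<and>
    (\<forall>z\<in>Ac. blinfun_apply (left_op x o\<^sub>L coeff_op y) (\<iota> z) = \<iota> (x * module_inner E p S y z))"
    using assms by (simp add: cbounded_ops_closed left_op coeff_op module_inner_def Phi_Ac Ac_mult Ac_star)
  fix T assume "T \<in> cbounded_ops \<and> (\<forall>z\<in>Ac. blinfun_apply T (\<iota> z) = \<iota> (x * module_inner E p S y z))"
  with * show "T = left_op x o\<^sub>L coeff_op y" by (intro blinfun_ext) auto
qed

lemma Theta_cbounded: "x \<in> Ac \<Longrightarrow> y \<in> Ac \<Longrightarrow> Th x y \<in> cbounded_ops"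
  by (simp add: Theta_eq cbounded_ops_closed left_op coeff_op)

lemma Theta_iota: "x \<in> Ac \<Longrightarrow> y \<in> Ac \<Longrightarrow> z \<in> Ac \<Longrightarrow> blinfun_apply (Th x y) (\<iota> z) = \<iota> (x * Phi (star y * z))"
  by (simp add: Theta_eq left_op coeff_op Phi_Ac Ac_mult Ac_star)

lemma subspace_commutant: "M \<subseteq> cbounded_ops \<Longrightarrow> module.subspace scaleC (commutant M)"
proof (rule complex_vector.subspaceI)
  show "0 \<in> commutant M"
    by (auto simp: commutant_def cbounded_ops_closed blinfun.zero_right intro!: blinfun_eqI)
qed (simp_all add: commutant_closed)

lemma End00_cbounded: "End00 E p S \<iota> \<subseteq> cbounded_ops"
  unfolding End00_def
  by (intro complex_vector.span_minimal complex_vector.subspaceI) (auto simp: Theta_cbounded cbounded_ops_closed)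

lemma Theta_N: "x \<in> Ac \<Longrightarrow> y \<in> Ac \<Longrightarrow> Th x y \<in> N"
  using bicommutant_extensive[OF End00_cbounded] unfolding vN_alg_def End00_def
  by (blast intro: complex_vector.span_base)

lemma commutant_End00_cbounded: "commutant (End00 E p S \<iota>) \<subseteq> cbounded_ops"
  by (auto simp: commutant_def)

lemmas N_closed = commutant_closed[OF commutant_End00_cbounded, folded vN_alg_def]

lemma N_zero: "0 \<in> N"
  using complex_vector.subspace_0[OF subspace_commutant[OF commutant_End00_cbounded]] by (simp add: vN_alg_def)

lemma N_cbounded: "T \<in> N \<Longrightarrow> T \<in> cbounded_ops"
  by (simp add: vN_alg_def commutant_def)

text \<open>Right multiplication by f passes through Phi and so commutes with each rank one
  operator. The operators commuting with it form a subspace, so generators suffice. Elements of the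
  bicommutant are therefore right \<open>Fc\<close>-linear.\<close>

lemma right_op_commutant:
  assumes f: "f \<in> Fc"
  shows "right_op f \<in> commutant (End00 E p S \<iota>)"
proof -
  have R: "right_op f \<in> cbounded_ops" using right_op(1) FcD(1)[OF f] .
  have "End00 E p S \<iota> \<subseteq> commutant {right_op f}"
    unfolding End00_def
  proof (rule complex_vector.span_minimal)
    show "{Th x y |x y. x \<in> Ac \<and> y \<in> Ac} \<subseteq> commutant {right_op f}"
    proof clarify
      fix x y assume xy: "x \<in> Ac" "y \<in> Ac"
      have "Th x y o\<^sub>L right_op f = right_op f o\<^sub>L Th x y"
      proof (rule blinfun_ext)
        fix z assume z: "z \<in> Ac"
        have "Phi (star y * (z * f)) = Phi (star y * z) * f"
          using Phi_mult_right[OF f, of "star y * z"] xy z by (simp add: Ac_mult Ac_star mult.assoc)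
        then show "blinfun_apply (Th x y o\<^sub>L right_op f) (\<iota> z) = blinfun_apply (right_op f o\<^sub>L Th x y) (\<iota> z)"
          using xy z f by (simp add: right_op FcD Theta_iota Ac_mult Phi_Ac Ac_star mult.assoc)
      qed
      then show "Th x y \<in> commutant {right_op f}" using xy by (simp add: commutant_def Theta_cbounded)
    qed
    show "module.subspace scaleC (commutant {right_op f})" using R by (intro subspace_commutant) simp
  qed
  then show ?thesis using R by (auto simp: commutant_def)
qed

lemma N_right_op:
  assumes "T \<in> N" "f \<in> Fc"
  shows "blinfun_apply T (blinfun_apply (right_op f) \<xi>) = blinfun_apply (right_op f) (blinfun_apply T \<xi>)"
proof -
  have "T o\<^sub>L right_op f = right_op f o\<^sub>L T"
    using assms right_op_commutant by (auto simp: vN_alg_def commutant_def[of "commutant _"])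
  from arg_cong[OF this, of "\<lambda>A. blinfun_apply A \<xi>"] show ?thesis by simp
qed

subsection \<open>The trace property\<close>

text \<open>Since f is gauge invariant it moves inside Phi, and the trace then absorbs Phi. So left
  multiplication by x is the adjoint of \<open>coeff_op x\<close> on \<open>Fc\<close>.\<close>

lemma coeff_op_adjoint:
  assumes "x \<in> Ac" "f \<in> Fc"
  shows "cinner (blinfun_apply (coeff_op x) \<xi>) (\<iota> f) = cinner \<xi> (\<iota> (x * f))"
proof (rule bounded_linear_ext[of "\<lambda>\<xi>. cinner (blinfun_apply (coeff_op x) \<xi>) (\<iota> f)" "\<lambda>\<xi>. cinner \<xi> (\<iota> (x * f))"])
  show "bounded_linear (\<lambda>\<xi>. cinner (blinfun_apply (coeff_op x) \<xi>) (\<iota> f))"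
    by (rule bounded_linear_compose[OF bounded_linear_cinner_left blinfun.bounded_linear_right])
  show "bounded_linear (\<lambda>\<xi>. cinner \<xi> (\<iota> (x * f)))" by (rule bounded_linear_cinner_left)
  fix z assume z: "z \<in> Ac"
  have "star (Phi (star x * z)) * f = Phi (star z * x * f)"
    using assms z by (simp add: Phi_mult_right Ac_mult Ac_star star_mult star_star flip: Phi_star)
  then have "cinner (blinfun_apply (coeff_op x) (\<iota> z)) (\<iota> f) = tr (Phi (star z * x * f))"
    using assms z by (simp add: coeff_op cinner_iota Phi_Ac Ac_mult Ac_star FcD)
  also have "\<dots> = cinner (\<iota> z) (\<iota> (x * f))"
    using assms z by (simp add: cinner_iota tr_Phi Ac_mult Ac_star FcD mult.assoc)
  finally show "cinner (blinfun_apply (coeff_op x) (\<iota> z)) (\<iota> f) = cinner (\<iota> z) (\<iota> (x * f))" .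
qed

text \<open>Cyclicity of the trace carries f from the right end of one vector to the other vector as
  its adjoint.\<close>

lemma right_op_adjoint:
  assumes "y \<in> Ac" "f \<in> Fc"
  shows "cinner (\<iota> y) (blinfun_apply (right_op f) \<xi>) = cinner (\<iota> (y * star f)) \<xi>"
proof (rule bounded_linear_ext[of "\<lambda>\<xi>. cinner (\<iota> y) (blinfun_apply (right_op f) \<xi>)" "\<lambda>\<xi>. cinner (\<iota> (y * star f)) \<xi>"])
  show "bounded_linear (\<lambda>\<xi>. cinner (\<iota> y) (blinfun_apply (right_op f) \<xi>))"
    by (rule bounded_linear_compose[OF bounded_linear_cinner_right blinfun.bounded_linear_right])
  show "bounded_linear (\<lambda>\<xi>. cinner (\<iota> (y * star f)) \<xi>)" by (rule bounded_linear_cinner_right)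
  fix z assume z: "z \<in> Ac"
  have "tr (star y * (z * f)) = tr (f * (star y * z))"
    using tr_commute[of "star y * z" f] assms z by (simp add: Ac_mult Ac_star FcD mult.assoc)
  then show "cinner (\<iota> y) (blinfun_apply (right_op f) (\<iota> z)) = cinner (\<iota> (y * star f)) (\<iota> z)"
    using assms z by (simp add: right_op cinner_iota Ac_mult Ac_star FcD star_mult star_star mult.assoc)
qed

lemma coeff_op_approx:
  assumes x: "x \<in> Ac"
  obtains f where "\<And>n. f n \<in> Fc" "(\<lambda>n. \<iota> (f n)) \<longlonglongrightarrow> blinfun_apply (coeff_op x) \<xi>"
proof -
  obtain X where X: "\<And>n. X n \<in> Ac" "(\<lambda>n. \<iota> (X n)) \<longlonglongrightarrow> \<xi>" by (rule iota_approx[of \<xi>]) blast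
  have "(\<lambda>n. blinfun_apply (coeff_op x) (\<iota> (X n))) \<longlonglongrightarrow> blinfun_apply (coeff_op x) \<xi>"
    by (rule bounded_linear.tendsto[OF blinfun.bounded_linear_right X(2)])
  then have "(\<lambda>n. \<iota> (Phi (star x * X n))) \<longlonglongrightarrow> blinfun_apply (coeff_op x) \<xi>" by (simp add: coeff_op x X)
  then show thesis by (rule that[rotated]) (intro Phi_Fc Ac_mult Ac_star x X)
qed

text \<open>The vector is a limit of images of \<open>Fc\<close>, so testing against
  \<open>Fc\<close> already determines its norm.\<close>

lemma coeff_op_norm_le:
  assumes x: "x \<in> Ac" and K: "0 \<le> K"
    and le: "\<And>f. f \<in> Fc \<Longrightarrow> cmod (cinner (blinfun_apply (coeff_op x) \<xi>) (\<iota> f)) \<le> K * norm (\<iota> f)"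
  shows "norm (blinfun_apply (coeff_op x) \<xi>) \<le> K"
proof -
  let ?\<eta> = "blinfun_apply (coeff_op x) \<xi>"
  obtain f where f: "\<And>n. f n \<in> Fc" "(\<lambda>n. \<iota> (f n)) \<longlonglongrightarrow> ?\<eta>" by (rule coeff_op_approx[OF x, of \<xi>]) blast
  have "cmod (cinner ?\<eta> ?\<eta>) \<le> K * norm ?\<eta>"
    by (rule LIMSEQ_le[OF tendsto_norm[OF tendsto_cinner_right[OF f(2)]] tendsto_mult_left[OF tendsto_norm[OF f(2)]]])
      (use le[OF f(1)] in blast)
  moreover have "cmod (cinner ?\<eta> ?\<eta>) = norm ?\<eta> * norm ?\<eta>"
    by (simp only: cinner_self norm_of_real power2_eq_square) simp
  ultimately show ?thesis using K by (cases "?\<eta> = 0") auto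
qed

text \<open>
  Under the conjugation \<open>f \<mapsto> f\<^sup>*\<close>, which is isometric because \<open>\<tau>\<close> is a trace, the vectors
  \<open>(y|Tx)\<^sub>R\<close> and \<open>(x|T\<^sup>*y)\<^sub>R\<close> correspond to each other. Only the fact that
  \<open>T\<close> commutes with right multiplications is used.
\<close>

lemma coeff_op_swap:
  assumes T: "T \<in> N" and x: "x \<in> Ac" and y: "y \<in> Ac"
  shows "norm (blinfun_apply (coeff_op y) (blinfun_apply T (\<iota> x)))
    = norm (blinfun_apply (coeff_op x) (blinfun_apply (op_adj T) (\<iota> y)))"
proof -
  note Tc = N_cbounded[OF T]
  let ?\<eta> = "blinfun_apply (coeff_op y) (blinfun_apply T (\<iota> x))"
  let ?\<zeta> = "blinfun_apply (coeff_op x) (blinfun_apply (op_adj T) (\<iota> y))"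
  \<comment> \<open>Both sides reduce to the inner product of y with T applied to x * f; in between,
    T moves past right multiplication by f.\<close>
  have eq: "cinner ?\<zeta> (\<iota> f) = cnj (cinner ?\<eta> (\<iota> (star f)))" if f: "f \<in> Fc" for f
  proof -
    have "cinner ?\<zeta> (\<iota> f) = cinner (\<iota> y) (blinfun_apply T (\<iota> (x * f)))"
      by (simp add: coeff_op_adjoint x f op_adj(2)[OF Tc])
    also have "\<dots> = cinner (\<iota> y) (blinfun_apply (right_op f) (blinfun_apply T (\<iota> x)))"
      using N_right_op[OF T f, of "\<iota> x"] x f by (simp add: right_op FcD)
    also have "\<dots> = cinner (\<iota> (y * star f)) (blinfun_apply T (\<iota> x))" by (rule right_op_adjoint[OF y f])
    also have "\<dots> = cnj (cinner (blinfun_apply T (\<iota> x)) (\<iota> (y * star f)))" by (rule cinner_commute)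
    also have "\<dots> = cnj (cinner ?\<eta> (\<iota> (star f)))" by (simp add: coeff_op_adjoint y Fc_star f)
    finally show ?thesis .
  qed
  have "norm ?\<zeta> \<le> norm ?\<eta>"
  proof (rule coeff_op_norm_le[OF x])
    fix f assume f: "f \<in> Fc"
    have "cmod (cinner ?\<zeta> (\<iota> f)) = cmod (cinner ?\<eta> (\<iota> (star f)))" by (simp add: eq f)
    also have "\<dots> \<le> norm ?\<eta> * norm (\<iota> (star f))" by (rule cinner_Cauchy_Schwarz)
    finally show "cmod (cinner ?\<zeta> (\<iota> f)) \<le> norm ?\<eta> * norm (\<iota> f)" by (simp add: norm_iota_star FcD f)
  qed simp
  moreover have "norm ?\<eta> \<le> norm ?\<zeta>"
  proof (rule coeff_op_norm_le[OF y])
    fix f assume f: "f \<in> Fc"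
    have "cmod (cinner ?\<eta> (\<iota> f)) = cmod (cinner ?\<zeta> (\<iota> (star f)))"
      using eq[OF Fc_star[OF f]] by (simp add: star_star)
    also have "\<dots> \<le> norm ?\<zeta> * norm (\<iota> (star f))" by (rule cinner_Cauchy_Schwarz)
    finally show "cmod (cinner ?\<eta> (\<iota> f)) \<le> norm ?\<zeta> * norm (\<iota> f)" by (simp add: norm_iota_star FcD f)
  qed simp
  ultimately show ?thesis by simp
qed

section \<open>Parseval's identity for the frame\<close>

abbreviation "cf i \<equiv> blinfun_apply (coeff_op (frame i))"

lemma frame_part_Ac: "i \<in> idx \<Longrightarrow> z \<in> Ac \<Longrightarrow> frame_part i z \<in> Ac"
  by (simp add: frame_part_def Ac_mult Phi_Ac Ac_star frame_Ac)

lemma cinner_frame_part: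
  assumes i: "i \<in> idx" and z: "z \<in> Ac"
  shows "cinner (\<iota> z) (\<iota> (frame_part i z)) = complex_of_real ((norm (cf i (\<iota> z)))\<^sup>2)"
proof -
  let ?f = "Phi (star (frame i) * z)"
  have e: "frame i \<in> Ac" using i by (rule frame_Ac)
  have f: "?f \<in> Fc" using e z by (intro Phi_Fc Ac_mult Ac_star)
  have "cinner (\<iota> z) (\<iota> (frame i * ?f)) = cinner (cf i (\<iota> z)) (\<iota> ?f)"
    by (rule coeff_op_adjoint[OF e f, symmetric])
  then show ?thesis using e z by (simp add: frame_part_def coeff_op cinner_self)
qed

lemma frame_Parseval_Ac:
  assumes z: "z \<in> Ac"
  shows "\<exists>I0. finite I0 \<and> I0 \<subseteq> idx \<and>
    (\<forall>I. finite I \<longrightarrow> I0 \<subseteq> I \<longrightarrow> I \<subseteq> idx \<longrightarrow> (\<Sum>i\<in>I. (norm (cf i (\<iota> z)))\<^sup>2) = (norm (\<iota> z))\<^sup>2)"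
proof -
  from frame_reconstruction[OF z] obtain I0 where I0: "finite I0 \<and> I0 \<subseteq> idx \<and>
    (\<forall>I. finite I \<longrightarrow> I0 \<subseteq> I \<longrightarrow> I \<subseteq> idx \<longrightarrow> (\<Sum>i\<in>I. frame_part i z) = z)" by (rule exE)
  have "(\<Sum>i\<in>I. (norm (cf i (\<iota> z)))\<^sup>2) = (norm (\<iota> z))\<^sup>2" if I: "finite I" "I0 \<subseteq> I" "I \<subseteq> idx" for I
  proof -
    have "complex_of_real (\<Sum>i\<in>I. (norm (cf i (\<iota> z)))\<^sup>2) = (\<Sum>i\<in>I. cinner (\<iota> z) (\<iota> (frame_part i z)))"
      unfolding of_real_sum by (intro sum.cong refl cinner_frame_part[symmetric] z) (use I in auto)
    also have "\<dots> = cinner (\<iota> z) (\<iota> (\<Sum>i\<in>I. frame_part i z))"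
    proof -
      have "\<iota> (\<Sum>i\<in>I. frame_part i z) = (\<Sum>i\<in>I. \<iota> (frame_part i z))"
        using I z by (intro iota_sum frame_part_Ac) auto
      then show ?thesis by (simp add: cinner_sum_right)
    qed
    also have "(\<Sum>i\<in>I. frame_part i z) = z" using I0 I by simp
    also have "cinner (\<iota> z) (\<iota> z) = complex_of_real ((norm (\<iota> z))\<^sup>2)" by (rule cinner_self)
    finally show ?thesis by (simp only: of_real_eq_iff)
  qed
  then show ?thesis using I0 by (intro exI[of _ I0]) simp
qed

lemma frame_Bessel:
  assumes I: "finite I" "I \<subseteq> idx"
  shows "(\<Sum>i\<in>I. (norm (cf i \<xi>))\<^sup>2) \<le> (norm \<xi>)\<^sup>2"
proof -
  obtain X where X: "\<And>n. X n \<in> Ac" "(\<lambda>n. \<iota> (X n)) \<longlonglongrightarrow> \<xi>" by (rule iota_approx[of \<xi>]) blast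
  have le: "(\<Sum>i\<in>I. (norm (cf i (\<iota> z)))\<^sup>2) \<le> (norm (\<iota> z))\<^sup>2" if z: "z \<in> Ac" for z
  proof -
    from frame_Parseval_Ac[OF z] obtain I0 where I0: "finite I0 \<and> I0 \<subseteq> idx \<and> (\<forall>I. finite I \<longrightarrow> I0 \<subseteq> I \<longrightarrow>
        I \<subseteq> idx \<longrightarrow> (\<Sum>i\<in>I. (norm (cf i (\<iota> z)))\<^sup>2) = (norm (\<iota> z))\<^sup>2)" by (rule exE)
    have "(\<Sum>i\<in>I. (norm (cf i (\<iota> z)))\<^sup>2) \<le> (\<Sum>i\<in>I \<union> I0. (norm (cf i (\<iota> z)))\<^sup>2)"
      using I I0 by (intro sum_mono2) auto
    also have "\<dots> = (norm (\<iota> z))\<^sup>2" using I I0 by simp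
    finally show ?thesis .
  qed
  show ?thesis
  proof (rule LIMSEQ_le)
    show "(\<lambda>n. \<Sum>i\<in>I. (norm (cf i (\<iota> (X n))))\<^sup>2) \<longlonglongrightarrow> (\<Sum>i\<in>I. (norm (cf i \<xi>))\<^sup>2)"
      by (intro tendsto_sum tendsto_power tendsto_norm bounded_linear.tendsto[OF blinfun.bounded_linear_right X(2)])
    show "(\<lambda>n. (norm (\<iota> (X n)))\<^sup>2) \<longlonglongrightarrow> (norm \<xi>)\<^sup>2" by (intro tendsto_power tendsto_norm X(2))
  qed (use le X(1) in blast)
qed

text \<open>Equality holds for approximating vectors on finite index sets that vary with the vector,
  so the lower bound is not a termwise limit. Instead the triangle inequality in
  \<open>L2_set\<close> compares the coefficients of \<xi> with those of the approximant, the error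
  being controlled by \<open>frame_Bessel\<close>.\<close>

lemma frame_Parseval: "esum idx (\<lambda>i. ennreal ((norm (cf i \<xi>))\<^sup>2)) = ennreal ((norm \<xi>)\<^sup>2)"
proof (rule antisym)
  show "esum idx (\<lambda>i. ennreal ((norm (cf i \<xi>))\<^sup>2)) \<le> ennreal ((norm \<xi>)\<^sup>2)"
    unfolding esum_def by (intro SUP_least) (auto simp: sum_ennreal intro!: ennreal_leI frame_Bessel)
  obtain X where X: "\<And>n. X n \<in> Ac" "(\<lambda>n. \<iota> (X n)) \<longlonglongrightarrow> \<xi>" by (rule iota_approx[of \<xi>]) blast
  \<comment> \<open>Truncating at 0 lets the lower bound survive squaring.\<close>
  have "(\<lambda>n. ennreal ((max 0 (norm (\<iota> (X n)) - norm (\<xi> - \<iota> (X n))))\<^sup>2)) \<longlonglongrightarrow> ennreal ((max 0 (norm \<xi> - norm (\<xi> - \<xi>)))\<^sup>2)"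
    by (intro tendsto_ennrealI tendsto_power tendsto_max tendsto_const tendsto_diff tendsto_norm X(2))
  then have lim: "(\<lambda>n. ennreal ((max 0 (norm (\<iota> (X n)) - norm (\<xi> - \<iota> (X n))))\<^sup>2)) \<longlonglongrightarrow> ennreal ((norm \<xi>)\<^sup>2)"
    by simp
  show "ennreal ((norm \<xi>)\<^sup>2) \<le> esum idx (\<lambda>i. ennreal ((norm (cf i \<xi>))\<^sup>2))"
  proof (rule LIMSEQ_le_const2[OF lim], intro exI[of _ 0] allI impI)
    fix n
    let ?z = "\<iota> (X n)"
    from frame_Parseval_Ac[OF X(1)[of n]] obtain I where I: "finite I \<and> I \<subseteq> idx \<and> (\<forall>J. finite J \<longrightarrow> I \<subseteq> J \<longrightarrow>
        J \<subseteq> idx \<longrightarrow> (\<Sum>i\<in>J. (norm (cf i ?z))\<^sup>2) = (norm ?z)\<^sup>2)" by (rule exE)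
    have "norm ?z = L2_set (\<lambda>i. norm (cf i ?z)) I" using I by (simp add: L2_set_def)
    also have "\<dots> \<le> L2_set (\<lambda>i. norm (cf i \<xi>) + norm (cf i (\<xi> - ?z))) I"
    proof (rule L2_set_mono)
      show "norm (cf i ?z) \<le> norm (cf i \<xi>) + norm (cf i (\<xi> - ?z))" for i
        using norm_triangle_ineq4[of "cf i \<xi>" "cf i (\<xi> - ?z)"] by (simp add: blinfun.diff_right)
    qed simp
    also have "\<dots> \<le> L2_set (\<lambda>i. norm (cf i \<xi>)) I + L2_set (\<lambda>i. norm (cf i (\<xi> - ?z))) I"
      by (rule L2_set_triangle_ineq)
    also have "L2_set (\<lambda>i. norm (cf i (\<xi> - ?z))) I \<le> norm (\<xi> - ?z)"
      unfolding L2_set_def using I frame_Bessel[of I "\<xi> - ?z"] by (intro real_le_lsqrt) auto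
    finally have "max 0 (norm ?z - norm (\<xi> - ?z)) \<le> L2_set (\<lambda>i. norm (cf i \<xi>)) I"
      using L2_set_nonneg[of "\<lambda>i. norm (cf i \<xi>)" I] by linarith
    then have "(max 0 (norm ?z - norm (\<xi> - ?z)))\<^sup>2 \<le> (L2_set (\<lambda>i. norm (cf i \<xi>)) I)\<^sup>2"
      by (intro power_mono) auto
    also have "\<dots> = (\<Sum>i\<in>I. (norm (cf i \<xi>))\<^sup>2)" by (simp add: L2_set_def sum_nonneg)
    finally have "ennreal ((max 0 (norm ?z - norm (\<xi> - ?z)))\<^sup>2) \<le> (\<Sum>i\<in>I. ennreal ((norm (cf i \<xi>))\<^sup>2))"
      by (simp add: sum_ennreal ennreal_leI)
    also have "\<dots> \<le> esum idx (\<lambda>i. ennreal ((norm (cf i \<xi>))\<^sup>2))"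
      unfolding esum_def using I by (intro SUP_upper) auto
    finally show "ennreal ((max 0 (norm ?z - norm (\<xi> - ?z)))\<^sup>2) \<le> esum idx (\<lambda>i. ennreal ((norm (cf i \<xi>))\<^sup>2))" .
  qed
qed

section \<open>The induced weight as a sum over the frame\<close>

abbreviation "\<phi> \<equiv> tau_tilde E p S \<iota>"
abbreviation "form T \<xi> \<equiv> Re (cinner \<xi> (blinfun_apply T \<xi>))"

text \<open>The two terms of \<open>omega\<close> are the values of the form at the two frame
  vectors of one path: the factor \<open>1 / sqrt n\<close> enters quadratically and becomes the
  weight 1 / n.\<close>

lemma tau_tilde_eq:
  assumes "op_pos T"
  shows "\<phi> T = esum idx (\<lambda>i. ennreal (form T (\<iota> (frame i))))"
proof -
  note T = op_posD(1)[OF assms]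
  have "ennreal (Re (omega E p S \<iota> \<mu> T))
      = ennreal (form T (\<iota> (frame (\<mu>, False)))) + ennreal (form T (\<iota> (frame (\<mu>, True))))" if \<mu>: "\<mu> \<in> paths E" for \<mu>
  proof -
    obtain u gs v where ug: "\<mu> = (u, gs)" "awalk u gs v" using \<mu> by (auto simp: paths_def)
    let ?s = "\<iota> (pe \<mu>)" and ?t = "\<iota> (star (pe \<mu>))"
    have "Re (omega E p S \<iota> \<mu> T) = form T (\<iota> (frame (\<mu>, False))) + form T (\<iota> (frame (\<mu>, True)))"
    proof (cases "gs = []")
      case True
      then show ?thesis by (simp add: omega_def Let_def ug path_length_def frame_def iota_zero)
    next
      case False
      let ?n = "num_paths_into E v (length gs)"
      have "star (pe \<mu>) \<in> Ac" using ug Ac_pe Ac_star by simp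
      then have "\<iota> (frame (\<mu>, True)) = (1 / sqrt ?n) *\<^sub>R ?t"
        using False by (simp add: ug(1) frame_True[OF ug(2)] scaleR_scaleC iota_scaleC)
      then have "cinner (\<iota> (frame (\<mu>, True))) (blinfun_apply T (\<iota> (frame (\<mu>, True))))
          = complex_of_real (1 / sqrt ?n * (1 / sqrt ?n)) * cinner ?t (blinfun_apply T ?t)"
        by (simp only: blinfun.scaleR_right cinner_scaleR of_real_mult mult.assoc)
      also have "1 / sqrt ?n * (1 / sqrt ?n) = 1 / real ?n" by simp
      finally show ?thesis using False
        by (simp add: omega_def Let_def ug(1) path_length_def path_range_eq[OF ug(2)])
    qed
    then show ?thesis using op_posD(2)[OF assms] by (simp add: ennreal_plus)
  qed
  then have "\<phi> T = esum (paths E) (\<lambda>\<mu>. ennreal (form T (\<iota> (frame (\<mu>, False)))) + ennreal (form T (\<iota> (frame (\<mu>, True)))))"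
    unfolding tau_tilde_def infsum_eq_esum by (intro esum_cong)
  also have "\<dots> = esum idx (\<lambda>i. ennreal (form T (\<iota> (frame i))))"
    unfolding idx_def by (rule esum_Times_bool[symmetric])
  finally show ?thesis .
qed

text \<open>The square of the Hilbert-Schmidt norm relative to the frame.\<close>

definition "hs T = esum idx (\<lambda>i. ennreal ((norm (blinfun_apply T (\<iota> (frame i))))\<^sup>2))"

lemma op_adj_op_adj: "T \<in> cbounded_ops \<Longrightarrow> op_adj (op_adj T) = T" for T :: "'h \<Rightarrow>\<^sub>L 'h"
  by (rule op_adj_eqI) (simp_all add: op_adj)

lemma form_adj_comp: "T \<in> cbounded_ops \<Longrightarrow> cinner \<xi> (blinfun_apply (op_adj T o\<^sub>L T) \<xi>) = complex_of_real ((norm (blinfun_apply T \<xi>))\<^sup>2)"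
  for T :: "'h \<Rightarrow>\<^sub>L 'h"
  by (simp only: blinfun_apply_blinfun_compose op_adj(3) cinner_self)

lemma op_pos_adj_comp: "T \<in> cbounded_ops \<Longrightarrow> op_pos (op_adj T o\<^sub>L T)" for T :: "'h \<Rightarrow>\<^sub>L 'h"
  unfolding op_pos_def form_adj_comp by (simp add: cbounded_ops_closed op_adj complex_nonneg_Reals_iff)

lemma tau_tilde_adj_comp:
  assumes "T \<in> cbounded_ops"
  shows "\<phi> (op_adj T o\<^sub>L T) = hs T"
  unfolding tau_tilde_eq[OF op_pos_adj_comp[OF assms]] form_adj_comp[OF assms] hs_def by simp

lemma hs_adj:
  assumes T: "T \<in> N"
  shows "hs T = hs (op_adj T)"
proof -
  have "hs T = esum idx (\<lambda>i. esum idx (\<lambda>j. ennreal ((norm (cf j (blinfun_apply T (\<iota> (frame i)))))\<^sup>2)))"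
    unfolding hs_def frame_Parseval ..
  also have "\<dots> = esum idx (\<lambda>i. esum idx (\<lambda>j. ennreal ((norm (cf i (blinfun_apply (op_adj T) (\<iota> (frame j)))))\<^sup>2)))"
    by (intro esum_cong) (simp add: coeff_op_swap[OF T] frame_Ac)
  also have "\<dots> = esum idx (\<lambda>j. esum idx (\<lambda>i. ennreal ((norm (cf i (blinfun_apply (op_adj T) (\<iota> (frame j)))))\<^sup>2)))"
    by (rule esum_swap)
  also have "\<dots> = hs (op_adj T)" unfolding hs_def frame_Parseval ..
  finally show ?thesis .
qed

lemma vn_posD: "T \<in> vn_pos N \<Longrightarrow> T \<in> N" "T \<in> vn_pos N \<Longrightarrow> op_pos T"
  by (auto simp: vn_pos_def)

lemma tau_tilde_add:
  assumes "T \<in> vn_pos N" "R \<in> vn_pos N"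
  shows "\<phi> (T + R) = \<phi> T + \<phi> R"
proof -
  note T = vn_posD(2)[OF assms(1)] and R = vn_posD(2)[OF assms(2)]
  show ?thesis
    unfolding tau_tilde_eq[OF T] tau_tilde_eq[OF R] tau_tilde_eq[OF op_pos_add[OF T R]] esum_add[symmetric]
    by (intro esum_cong) (simp add: blinfun.add_left cinner_add_right ennreal_plus op_posD(2)[OF T] op_posD(2)[OF R])
qed

lemma tau_tilde_scale:
  assumes "0 \<le> r" "T \<in> vn_pos N"
  shows "\<phi> (r *\<^sub>R T) = ennreal r * \<phi> T"
proof -
  note T = vn_posD(2)[OF assms(2)]
  show ?thesis
    unfolding tau_tilde_eq[OF T] tau_tilde_eq[OF op_pos_scaleR[OF assms(1) T]] esum_cmult[symmetric]
    by (intro esum_cong) (simp add: blinfun.scaleR_left cinner_scaleR ennreal_mult assms op_posD(2)[OF T])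
qed

lemma tau_tilde_trace: "vn_trace N \<phi>"
  unfolding vn_trace_def
proof (intro conjI ballI allI impI)
  fix T assume T: "T \<in> N"
  note Tc = N_cbounded[OF T]
  have "\<phi> (T o\<^sub>L op_adj T) = hs (op_adj T)"
    using tau_tilde_adj_comp[OF op_adj(1)[OF Tc]] by (simp add: op_adj_op_adj Tc)
  then show "\<phi> (op_adj T o\<^sub>L T) = \<phi> (T o\<^sub>L op_adj T)"
    by (simp add: tau_tilde_adj_comp Tc hs_adj[OF T])
qed (simp_all add: tau_tilde_add tau_tilde_scale)

text \<open>A vanishing sum means that T kills every frame vector. Being right
  \<open>Fc\<close>-linear, T then kills every \<open>frame_part\<close>, and finitely many of these
  add up to any given element of \<open>Ac\<close>.\<close>

lemma tau_tilde_faithful: "vn_faithful N \<phi>"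
  unfolding vn_faithful_def
proof (intro ballI impI)
  fix T assume T: "T \<in> N" and "\<phi> (op_adj T o\<^sub>L T) = 0"
  then have "hs T = 0" by (simp add: tau_tilde_adj_comp N_cbounded)
  then have e: "blinfun_apply T (\<iota> (frame i)) = 0" if "i \<in> idx" for i
    unfolding hs_def using esum_eq_0D that by fastforce
  show "T = 0"
  proof (rule blinfun_ext)
    fix z assume z: "z \<in> Ac"
    from frame_reconstruction[OF z] obtain I where I: "finite I \<and> I \<subseteq> idx \<and>
      (\<forall>J. finite J \<longrightarrow> I \<subseteq> J \<longrightarrow> J \<subseteq> idx \<longrightarrow> (\<Sum>i\<in>J. frame_part i z) = z)" by (rule exE)
    have part: "blinfun_apply T (\<iota> (frame_part i z)) = 0" if i: "i \<in> idx" for i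
    proof -
      let ?f = "Phi (star (frame i) * z)"
      have f: "?f \<in> Fc" by (intro Phi_Fc Ac_mult Ac_star frame_Ac i z)
      have "\<iota> (frame_part i z) = blinfun_apply (right_op ?f) (\<iota> (frame i))"
        by (simp add: frame_part_def right_op FcD[OF f] frame_Ac i)
      then show ?thesis using N_right_op[OF T f] e[OF i] by (simp add: blinfun.zero_right)
    qed
    have "\<iota> z = (\<Sum>i\<in>I. \<iota> (frame_part i z))"
      using iota_sum[of I "\<lambda>i. frame_part i z"] I frame_part_Ac[OF _ z] by auto
    then have "blinfun_apply T (\<iota> z) = (\<Sum>i\<in>I. blinfun_apply T (\<iota> (frame_part i z)))"
      by (simp add: blinfun.sum_right)
    also have "\<dots> = 0" using part I by (intro sum.neutral) auto
    finally show "blinfun_apply T (\<iota> z) = blinfun_apply 0 (\<iota> z)" by simp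
  qed
qed

text \<open>The supremum T is given only through the order. The strong limit L of D lies in N,
  because it commutes with whatever D commutes with, so leastness identifies it with T. The forms of
  L are suprema of the forms of D.\<close>

lemma tau_tilde_normal: "vn_normal N \<phi>"
  unfolding vn_normal_def
proof (intro allI impI, elim conjE)
  fix D T
  assume ne: "D \<noteq> {}" and D: "D \<subseteq> vn_pos N"
    and dir: "\<forall>R\<in>D. \<forall>R'\<in>D. \<exists>R''\<in>D. op_le R R'' \<and> op_le R' R''"
    and T: "T \<in> vn_pos N" "\<forall>R\<in>D. op_le R T"
    and least: "\<forall>U\<in>vn_pos N. (\<forall>R\<in>D. op_le R U) \<longrightarrow> op_le T U"
  have pos: "op_pos R" if "R \<in> D" for R using D that vn_posD by blast
  obtain L where L: "op_pos L" "\<And>R. R \<in> D \<Longrightarrow> op_le R L"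
    "\<And>U. op_pos U \<Longrightarrow> (\<And>R. R \<in> D \<Longrightarrow> op_le R U) \<Longrightarrow> op_le L U"
    "\<And>Q. (\<And>R. R \<in> D \<Longrightarrow> R o\<^sub>L Q = Q o\<^sub>L R) \<Longrightarrow> L o\<^sub>L Q = Q o\<^sub>L L"
    "\<And>\<xi>. ennreal (form L \<xi>) = (SUP R\<in>D. ennreal (form R \<xi>))"
  proof (rule monotone_net_limit[OF ne pos])
    show "\<exists>R''\<in>D. op_le R R'' \<and> op_le R' R''" if "R \<in> D" "R' \<in> D" for R R' using dir that by blast
    show "op_le R T" if "R \<in> D" for R using T(2) that by blast
  qed blast+
  have "L o\<^sub>L Q = Q o\<^sub>L L" if Q: "Q \<in> commutant (End00 E p S \<iota>)" for Q
  proof (rule L(4))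
    fix R assume "R \<in> D"
    then have "R \<in> N" using D vn_posD by blast
    then show "R o\<^sub>L Q = Q o\<^sub>L R" using Q by (simp add: vN_alg_def commutant_def[of "commutant _"])
  qed
  then have "L \<in> N" using op_posD(1)[OF L(1)] by (simp add: vN_alg_def commutant_def[of "commutant _"])
  then have "L \<in> vn_pos N" using L(1) by (simp add: vn_pos_def)
  then have "op_le T L" using least L(2) by blast
  moreover have "op_le L T" using T vn_posD(2) by (intro L(3)) auto
  ultimately have "T = L" by (rule op_le_antisym)
  then have "\<phi> T = esum idx (\<lambda>i. SUP R\<in>D. ennreal (form R (\<iota> (frame i))))"
    by (simp add: tau_tilde_eq[OF L(1)] L(5))
  also have "\<dots> = (SUP R\<in>D. esum idx (\<lambda>i. ennreal (form R (\<iota> (frame i)))))"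
  proof (rule esum_SUP_directed[OF ne])
    fix R R' assume "R \<in> D" "R' \<in> D"
    then obtain R'' where "R'' \<in> D" "op_le R R''" "op_le R' R''" using dir by blast
    then show "\<exists>R''\<in>D. \<forall>i\<in>idx. ennreal (form R (\<iota> (frame i))) \<le> ennreal (form R'' (\<iota> (frame i)))
        \<and> ennreal (form R' (\<iota> (frame i))) \<le> ennreal (form R'' (\<iota> (frame i)))"
      by (intro bexI[of _ R'']) (auto intro!: ennreal_leI op_leD)
  qed
  also have "\<dots> = (SUP R\<in>D. \<phi> R)" by (intro SUP_cong refl) (simp add: tau_tilde_eq pos)
  finally show "\<phi> T = (SUP R\<in>D. \<phi> R)" .
qed

subsection \<open>The finite rank operators\<close>

text \<open>The adjoint relation for \<open>coeff_op x\<close> is available against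
  \<open>Fc\<close>, so the coefficient of \<eta> is approximated from there.\<close>

lemma Theta_form:
  assumes x: "x \<in> Ac"
  shows "cinner \<xi> (blinfun_apply (Th x x) \<eta>) = cinner (blinfun_apply (coeff_op x) \<xi>) (blinfun_apply (coeff_op x) \<eta>)"
proof -
  obtain f where f: "\<And>n. f n \<in> Fc" "(\<lambda>n. \<iota> (f n)) \<longlonglongrightarrow> blinfun_apply (coeff_op x) \<eta>"
    by (rule coeff_op_approx[OF x, of \<eta>]) blast
  have "(\<lambda>n. cinner (blinfun_apply (coeff_op x) \<xi>) (\<iota> (f n)))
      \<longlonglongrightarrow> cinner (blinfun_apply (coeff_op x) \<xi>) (blinfun_apply (coeff_op x) \<eta>)"
    by (rule tendsto_cinner_right[OF f(2)])
  moreover have "cinner (blinfun_apply (coeff_op x) \<xi>) (\<iota> (f n)) = cinner \<xi> (blinfun_apply (left_op x) (\<iota> (f n)))" for n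
    using f(1)[of n] x by (simp add: coeff_op_adjoint left_op FcD)
  moreover have "(\<lambda>n. cinner \<xi> (blinfun_apply (left_op x) (\<iota> (f n))))
      \<longlonglongrightarrow> cinner \<xi> (blinfun_apply (left_op x) (blinfun_apply (coeff_op x) \<eta>))"
    by (rule tendsto_cinner_right[OF bounded_linear.tendsto[OF blinfun.bounded_linear_right f(2)]])
  ultimately show ?thesis by (simp add: Theta_eq x LIMSEQ_unique)
qed

lemma Theta_pos: "x \<in> Ac \<Longrightarrow> Th x x \<in> vn_pos N"
  by (simp add: vn_pos_def Theta_N op_pos_def Theta_cbounded Theta_form cinner_self complex_nonneg_Reals_iff)

text \<open>Taking adjoints exchanges the coefficient of a frame vector against x with that of x
  against the frame vector and preserves its norm. The sum thus becomes the one in Parseval's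
  identity for x.\<close>

lemma tau_tilde_Theta_self:
  assumes x: "x \<in> Ac"
  shows "\<phi> (Th x x) = ennreal ((norm (\<iota> x))\<^sup>2)"
proof -
  have "\<phi> (Th x x) = esum idx (\<lambda>i. ennreal ((norm (blinfun_apply (coeff_op x) (\<iota> (frame i))))\<^sup>2))"
    unfolding tau_tilde_eq[OF vn_posD(2)[OF Theta_pos[OF x]]] Theta_form[OF x] Re_cinner_self ..
  also have "\<dots> = esum idx (\<lambda>i. ennreal ((norm (cf i (\<iota> x)))\<^sup>2))"
  proof (rule esum_cong)
    fix i assume "i \<in> idx"
    then have e: "frame i \<in> Ac" by (rule frame_Ac)
    have "star (Phi (star x * frame i)) = Phi (star (frame i) * x)"
      using x e by (simp add: Ac_mult Ac_star star_mult star_star flip: Phi_star)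
    then have "norm (blinfun_apply (coeff_op x) (\<iota> (frame i))) = norm (cf i (\<iota> x))"
      using norm_iota_star[of "Phi (star x * frame i)"] x e by (simp add: coeff_op Phi_Ac Ac_mult Ac_star)
    then show "ennreal ((norm (blinfun_apply (coeff_op x) (\<iota> (frame i))))\<^sup>2) = ennreal ((norm (cf i (\<iota> x)))\<^sup>2)" by simp
  qed
  also have "\<dots> = ennreal ((norm (\<iota> x))\<^sup>2)" by (rule frame_Parseval)
  finally show ?thesis .
qed

lemma tau_tilde_semifinite: "vn_semifinite N \<phi>"
  unfolding vn_semifinite_def
proof (intro ballI impI)
  fix T assume T: "T \<in> vn_pos N" and T0: "T \<noteq> 0"
  note TN = vn_posD(1)[OF T] and Tp = vn_posD(2)[OF T]
  \<comment> \<open>Otherwise all frame coefficients of every T \<xi> vanish, and Parseval's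
    identity gives T = 0.\<close>
  have "\<exists>j\<in>idx. Th (frame j) (frame j) o\<^sub>L T \<noteq> 0"
  proof (rule ccontr)
    assume "\<not> ?thesis"
    then have 0: "Th (frame j) (frame j) o\<^sub>L T = 0" if "j \<in> idx" for j using that by blast
    have "blinfun_apply T \<xi> = 0" for \<xi>
    proof -
      have "norm (cf j (blinfun_apply T \<xi>)) = 0" if j: "j \<in> idx" for j
      proof -
        have "blinfun_apply (Th (frame j) (frame j)) (blinfun_apply T \<xi>) = 0"
          using arg_cong[OF 0[OF j], of "\<lambda>A. blinfun_apply A \<xi>"] by simp
        then have "cinner (cf j (blinfun_apply T \<xi>)) (cf j (blinfun_apply T \<xi>)) = 0"
          using Theta_form[OF frame_Ac[OF j], of "blinfun_apply T \<xi>" "blinfun_apply T \<xi>"] by simp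
        then show ?thesis by (simp add: cinner_self)
      qed
      then have "esum idx (\<lambda>j. ennreal ((norm (cf j (blinfun_apply T \<xi>)))\<^sup>2)) = esum idx (\<lambda>j. 0)"
        by (intro esum_cong) simp
      then have "ennreal ((norm (blinfun_apply T \<xi>))\<^sup>2) = 0"
        unfolding frame_Parseval using esum_cmult[of idx 0 "\<lambda>_. 0"] by simp
      then show ?thesis by simp
    qed
    then have "T = 0" by (intro blinfun_eqI) simp
    with T0 show False by simp
  qed
  then obtain j where j: "j \<in> idx" "Th (frame j) (frame j) o\<^sub>L T \<noteq> 0" by blast
  let ?Q = "Th (frame j) (frame j)"
  define A where "A = ?Q o\<^sub>L T"
  have Q: "?Q \<in> vn_pos N" by (intro Theta_pos frame_Ac j)
  note QN = vn_posD(1)[OF Q] and Qp = vn_posD(2)[OF Q]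
  have AN: "A \<in> N" unfolding A_def by (rule N_closed(2)[OF QN TN])
  note Ac = N_cbounded[OF AN]
  have adj: "op_adj A = T o\<^sub>L ?Q"
    by (rule op_adj_eqI[OF Ac]) (simp add: A_def op_pos_symmetric[OF Tp] op_pos_symmetric[OF Qp])
  have A0: "A \<noteq> 0" using j by (simp add: A_def)
  have nT: "norm T > 0" using T0 by simp
  have nQ: "norm ?Q > 0" using A0 by (auto simp: A_def)
  \<comment> \<open>The first factor bounds Q applied to T \<xi>; the second is the constant of
    \<open>op_pos_norm_square_le\<close> for T.\<close>
  define c where "c = (norm ?Q)\<^sup>2 * norm T"
  have c: "c > 0" using nT nQ by (simp add: c_def)
  define B where "B = op_adj A o\<^sub>L A"
  have BN: "B \<in> vn_pos N"
    unfolding vn_pos_def B_def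
    by (simp add: op_pos_adj_comp[OF Ac]) (simp add: adj N_closed(2) TN QN AN)
  have B0: "B \<noteq> 0"
  proof
    assume "B = 0"
    then have "norm (blinfun_apply A \<xi>) = 0" for \<xi>
      using form_adj_comp[OF Ac, of \<xi>] by (simp add: B_def)
    then have "A = 0" by (intro blinfun_eqI) simp
    with A0 show False by simp
  qed
  have le: "form B \<xi> \<le> c * form T \<xi>" for \<xi>
  proof -
    have "form B \<xi> = (norm (blinfun_apply ?Q (blinfun_apply T \<xi>)))\<^sup>2"
      unfolding B_def form_adj_comp[OF Ac] by (simp add: A_def)
    also have "\<dots> \<le> (norm ?Q * norm (blinfun_apply T \<xi>))\<^sup>2" by (intro power_mono norm_blinfun) simp
    also have "\<dots> = (norm ?Q)\<^sup>2 * (norm (blinfun_apply T \<xi>))\<^sup>2" by (simp add: power_mult_distrib)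
    also have "\<dots> \<le> (norm ?Q)\<^sup>2 * (norm T * form T \<xi>)"
      by (intro mult_left_mono op_pos_norm_square_le[OF Tp]) simp
    finally show ?thesis by (simp add: c_def mult.assoc)
  qed
  have "\<phi> B = hs A" unfolding B_def by (rule tau_tilde_adj_comp[OF Ac])
  \<comment> \<open>Passing to the adjoint puts Q next to the frame vectors, so that the bounded T
    can be pulled out and the finite weight of Q remains.\<close>
  also have "\<dots> = hs (T o\<^sub>L ?Q)" using hs_adj[OF AN] by (simp only: adj)
  also have "\<dots> \<le> ennreal ((norm T)\<^sup>2 * norm ?Q) * \<phi> ?Q"
    unfolding hs_def tau_tilde_eq[OF Qp] esum_cmult[symmetric]
  proof (rule esum_mono)
    fix i
    let ?e = "\<iota> (frame i)"
    have "(norm (blinfun_apply (T o\<^sub>L ?Q) ?e))\<^sup>2 \<le> (norm T * norm (blinfun_apply ?Q ?e))\<^sup>2"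
      by (simp add: power_mono norm_blinfun)
    also have "\<dots> = (norm T)\<^sup>2 * (norm (blinfun_apply ?Q ?e))\<^sup>2" by (simp add: power_mult_distrib)
    also have "\<dots> \<le> (norm T)\<^sup>2 * (norm ?Q * form ?Q ?e)"
      by (intro mult_left_mono op_pos_norm_square_le[OF Qp]) simp
    finally show "ennreal ((norm (blinfun_apply (T o\<^sub>L ?Q) ?e))\<^sup>2) \<le> ennreal ((norm T)\<^sup>2 * norm ?Q) * ennreal (form ?Q ?e)"
      using op_posD(2)[OF Qp, of ?e] by (simp add: mult.assoc ennreal_leI flip: ennreal_mult)
  qed
  also have "\<dots> < \<infinity>" by (simp add: tau_tilde_Theta_self frame_Ac j ennreal_mult_less_top)
  finally have fin: "\<phi> B < \<infinity>" .
  have cB: "(1 / c) *\<^sub>R B \<in> vn_pos N"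
    using BN c by (simp add: vn_pos_def N_closed(4) op_pos_scaleR)
  have "op_le ((1 / c) *\<^sub>R B) T"
  proof (rule op_leI)
    show "form ((1 / c) *\<^sub>R B) \<xi> \<le> form T \<xi>" for \<xi>
      using le[of \<xi>] c by (simp add: blinfun.scaleR_left cinner_scaleR field_simps)
  qed (use vn_posD(2)[OF cB] Tp in \<open>simp_all add: op_posD(1) op_pos_Im\<close>)
  moreover have "\<phi> ((1 / c) *\<^sub>R B) < \<infinity>"
    using fin c by (simp add: tau_tilde_scale BN ennreal_mult_less_top)
  moreover have "(1 / c) *\<^sub>R B \<noteq> 0" using B0 c by simp
  ultimately show "\<exists>R\<in>vn_pos N. R \<noteq> 0 \<and> op_le R T \<and> \<phi> R < \<infinity>" using cB by blast
qed

section \<open>Linear extension of the induced weight to the finite rank operators\<close>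

sublocale V: weight_cone "vn_pos N" \<phi>
proof
  show "0 \<in> vn_pos N" by (simp add: vn_pos_def N_zero op_pos_zero)
  show "a + b \<in> vn_pos N" if "a \<in> vn_pos N" "b \<in> vn_pos N" for a b
    using that by (simp add: vn_pos_def N_closed(1) op_pos_add)
  show "r *\<^sub>R a \<in> vn_pos N" if "0 \<le> r" "a \<in> vn_pos N" for r a
    using that by (simp add: vn_pos_def N_closed(4) op_pos_scaleR)
  fix a b c d
  assume P: "a \<in> vn_pos N" "b \<in> vn_pos N" "c \<in> vn_pos N" "d \<in> vn_pos N"
    and eq: "(a - b) + \<i> *\<^sub>C (c - d) = 0"
  note pos = P[THEN vn_posD(2)]
  have "(form a \<xi> - form b \<xi> = 0) \<and> (form c \<xi> - form d \<xi> = 0)" for \<xi>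
  proof -
    have "cinner \<xi> (blinfun_apply ((a - b) + \<i> *\<^sub>C (c - d)) \<xi>) = 0" by (simp add: eq)
    then have "(cinner \<xi> (blinfun_apply a \<xi>) - cinner \<xi> (blinfun_apply b \<xi>))
        + \<i> * (cinner \<xi> (blinfun_apply c \<xi>) - cinner \<xi> (blinfun_apply d \<xi>)) = 0"
      by (simp add: blinfun.add_left blinfun.diff_left blinfun_apply_scaleC cinner_add_right cinner_diff
          cinner_scaleC_right)
    then show ?thesis using pos[THEN op_pos_Im, of \<xi>] by (simp add: complex_eq_iff)
  qed
  then have f: "form a = form b" "form c = form d" by (auto simp: fun_eq_iff)
  have eqI: "x = y" if "op_pos x" "op_pos y" "form x = form y" for x y :: "'h \<Rightarrow>\<^sub>L 'h"
  proof -
    have "form x \<xi> = form y \<xi>" for \<xi> using that(3) by (rule fun_cong)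
    then show ?thesis using that(1,2) by (intro op_le_antisym op_leI) (simp_all add: op_posD(1) op_pos_Im)
  qed
  show "a = b \<and> c = d" using eqI pos f by blast
qed (simp_all add: tau_tilde_add tau_tilde_scale)

lemma Theta_fin:
  assumes "x \<in> Ac"
  shows "Th x x \<in> V.fin" "V.wt (Th x x) = (norm (\<iota> x))\<^sup>2"
  using assms by (simp_all add: V.fin_def V.wt_def Theta_pos tau_tilde_Theta_self)

text \<open>\<open>Q c\<close> expands with coefficients 1, c, cnj c and c * cnj c. Weighting by c
  and averaging over the fourth roots of unity leaves the cnj c term, which is
  \<open>Th x y\<close>. The operators \<open>Q c\<close> are positive with known weight.\<close>

lemma Theta_polarization:
  assumes x: "x \<in> Ac" and y: "y \<in> Ac"
  defines "Q \<equiv> \<lambda>c. Th (x + c *\<^sub>C y) (x + c *\<^sub>C y)"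
  shows "Th x y = (1 / 4) *\<^sub>C ((Q 1 - Q (-1)) + \<i> *\<^sub>C (Q \<i> - Q (- \<i>)))"
proof (rule blinfun_ext)
  fix z assume z: "z \<in> Ac"
  define a b where "a = Phi (star x * z)" and "b = Phi (star y * z)"
  have ab: "a \<in> Ac" "b \<in> Ac" using x y z by (auto simp: a_def b_def intro: Phi_Ac Ac_mult Ac_star)
  define u where "u c = (x + c *\<^sub>C y) * (a + cnj c *\<^sub>C b)" for c
  have u: "u c \<in> Ac" for c using x y ab by (auto simp: u_def intro: Ac_mult Ac_add Ac_scaleC)
  have Q: "blinfun_apply (Q c) (\<iota> z) = \<iota> (u c)" for c
  proof -
    have "Phi (star (x + c *\<^sub>C y) * z) = a + cnj c *\<^sub>C b"
      using x y z by (simp add: star_add star_scaleC distrib_right mult_scaleC_left Phi_add Phi_scaleC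
          Ac_mult Ac_star Ac_scaleC a_def b_def)
    then show ?thesis using x y z by (simp add: Q_def Theta_iota Ac_add Ac_scaleC u_def)
  qed
  have "(u 1 - u (-1)) + \<i> *\<^sub>C (u \<i> - u (- \<i>)) = x * b + x * b + (x * b + x * b)"
    by (simp add: u_def distrib_left distrib_right left_diff_distrib right_diff_distrib scaleC_algebra
        complex_vector.scale_minus_left minus_one_scaleC scaleC_one)
  then have e: "x * b = (1 / 4) *\<^sub>C ((u 1 - u (-1)) + \<i> *\<^sub>C (u \<i> - u (- \<i>)))"
    by (simp add: four_scaleC scaleC_scaleC scaleC_one)
  have "blinfun_apply (Th x y) (\<iota> z) = \<iota> (x * b)" using x y z by (simp add: Theta_iota b_def)
  also have "\<dots> = (1 / 4) *\<^sub>C ((\<iota> (u 1) - \<iota> (u (-1))) + \<i> *\<^sub>C (\<iota> (u \<i>) - \<iota> (u (- \<i>))))"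
    unfolding e by (simp add: iota_scaleC iota_add iota_diff u Ac_scaleC Ac_add Ac_diff)
  also have "\<dots> = blinfun_apply ((1 / 4) *\<^sub>C ((Q 1 - Q (-1)) + \<i> *\<^sub>C (Q \<i> - Q (- \<i>)))) (\<iota> z)"
    by (simp add: blinfun_apply_scaleC blinfun.add_left blinfun.diff_left Q)
  finally show "blinfun_apply (Th x y) (\<iota> z)
      = blinfun_apply ((1 / 4) *\<^sub>C ((Q 1 - Q (-1)) + \<i> *\<^sub>C (Q \<i> - Q (- \<i>)))) (\<iota> z)" .
qed

lemma Theta_wdom:
  assumes "x \<in> Ac" "y \<in> Ac"
  shows "Th x y \<in> V.wdom"
proof -
  have "Th (x + c *\<^sub>C y) (x + c *\<^sub>C y) \<in> V.wdom" for c
    using assms by (intro V.wdom_fin Theta_fin Ac_add Ac_scaleC)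
  then show ?thesis unfolding Theta_polarization[OF assms] by (intro V.wdom_scale V.wdom_add V.wdom_diff)
qed

text \<open>The same average over fourth roots of unity, applied to the expansion of the squared
  norm of x + c y, leaves its cnj c coefficient.\<close>

lemma lin_ext_Theta:
  assumes x: "x \<in> Ac" and y: "y \<in> Ac"
  shows "lin_ext (vn_pos N) \<phi> (Th x y) = cinner (\<iota> y) (\<iota> x)"
proof -
  let ?Q = "\<lambda>c. Th (x + c *\<^sub>C y) (x + c *\<^sub>C y)"
  have A: "x + c *\<^sub>C y \<in> Ac" for c using x y by (intro Ac_add Ac_scaleC)
  have dom: "?Q c \<in> V.wdom" for c by (intro V.wdom_fin Theta_fin A)
  have val: "lin_ext (vn_pos N) \<phi> (?Q c) = cinner (\<iota> x) (\<iota> x) + c * cinner (\<iota> x) (\<iota> y)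
      + cnj c * cinner (\<iota> y) (\<iota> x) + c * cnj c * cinner (\<iota> y) (\<iota> y)" for c
  proof -
    have "lin_ext (vn_pos N) \<phi> (?Q c) = cinner (\<iota> (x + c *\<^sub>C y)) (\<iota> (x + c *\<^sub>C y))"
      unfolding cinner_self by (simp add: V.lin_ext_fin Theta_fin A)
    also have "\<iota> (x + c *\<^sub>C y) = \<iota> x + c *\<^sub>C \<iota> y" using x y by (simp add: iota_add iota_scaleC Ac_scaleC)
    finally show ?thesis
      by (simp add: cinner_add_left cinner_add_right cinner_scaleC_left cinner_scaleC_right algebra_simps)
  qed
  have "lin_ext (vn_pos N) \<phi> (Th x y) = (1 / 4) * ((lin_ext (vn_pos N) \<phi> (?Q 1) - lin_ext (vn_pos N) \<phi> (?Q (-1)))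
      + \<i> * (lin_ext (vn_pos N) \<phi> (?Q \<i>) - lin_ext (vn_pos N) \<phi> (?Q (- \<i>))))"
    by (simp only: Theta_polarization[OF x y] V.lin_ext_scale V.lin_ext_add V.lin_ext_diff
        V.wdom_scale V.wdom_add V.wdom_diff dom)
  also have "\<dots> = cinner (\<iota> y) (\<iota> x)"
    unfolding val by (simp add: algebra_simps)
  finally show ?thesis .
qed

lemma End00_subset: "End00 E p S \<iota> \<subseteq> cspan {T \<in> vn_pos N. \<phi> T < \<infinity>}"
  unfolding End00_def
proof (rule complex_vector.span_minimal)
  show "{Th x y |x y. x \<in> Ac \<and> y \<in> Ac} \<subseteq> cspan {T \<in> vn_pos N. \<phi> T < \<infinity>}"
    using Theta_wdom by (auto simp: V.wdom_def V.fin_def)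
qed (rule complex_vector.subspace_span)

end

theorem proposition5p11:
  fixes E :: "('v, 'e) pre_digraph"
    and p :: "'v \<Rightarrow> 'a::cstar_algebra" and S :: "'e \<Rightarrow> 'a"
    and \<tau> :: "'a \<Rightarrow> ennreal"
    and \<iota> :: "'a \<Rightarrow> 'h::chilbert_space"
  assumes "directed_graph E" and "locally_finite_graph E" and "no_sources E"
    and "is_graph_cstar_algebra E p S"
    and "is_trace \<tau>" and "faithful_trace \<tau>" and "semifinite_trace \<tau>" and "lsc_trace \<tau>"
    and "gauge_invariant_trace E p S \<tau>"
    and "hilbert_completion E p S \<tau> \<iota>"
  defines "N \<equiv> vN_alg E p S \<iota>" and "\<phi> \<equiv> tau_tilde E p S \<iota>"
  shows "(vn_trace N \<phi> \<and> vn_faithful N \<phi> \<and> vn_normal N \<phi> \<and> vn_semifinite N \<phi>)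
    \<and> End00 E p S \<iota> \<subseteq> cspan {T \<in> vn_pos N. \<phi> T < \<infinity>}
    \<and> (\<forall>x\<in>A_c E p S. \<forall>y\<in>A_c E p S.
         lin_ext (vn_pos N) \<phi> (Theta E p S \<iota> x y) = cinner (\<iota> y) (\<iota> x)
       \<and> cinner (\<iota> y) (\<iota> x) = trace_ext \<tau> (star y * x))"
proof -
  interpret wf_digraph E using assms(1) by (simp add: directed_graph_def)
  interpret graph_trace_hilbert E p S \<tau> \<iota>
    by unfold_locales (use assms in auto)
  show ?thesis
    unfolding N_def \<phi>_def
    using tau_tilde_trace tau_tilde_faithful tau_tilde_normal tau_tilde_semifinite End00_subset
      lin_ext_Theta cinner_iota by blast
qed

end
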